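(* Let $\mathbb G$ be a Carnot group with a splitting $\mathbb G=\mathbb W\mathbb V$ by homogeneous complementary subgroups such that $\mathbb V$ is horizontal (and $\mathbb V\neq\{0\}$); set $k:=\dim\mathbb V$ and identify $\mathbb V$ with $\mathbb R^k$. If $S\subset\mathbb G$ is not empty, then the following statements are equivalent: (a) there exist $A\subset\mathbb W$ and an intrinsic Lipschitz map $\phi:A\to\mathbb V$ such that $S=\mathrm{gr}_\phi$; (b) there exist $\delta>0$ and a Lipschitz map $f:\mathbb G\to\mathbb R^k$ such that $S\subset\{x\in\mathbb G:f(x)=0\}$ and $$\langle f(xv)-f(x),v\rangle\ge\delta|v|^2\qquad\text{for every }v\in\mathbb V\text{ and }x\in\mathbb G .$$
   Context: A Carnot group $\mathbb G$ is a connected, simply connected nilpotent Lie group whose Lie algebra is stratified: $\mathfrak g=\mathfrak g_1\oplus\dots\oplus\mathfrak g_s$, $\mathfrak g_{j+1}=[\mathfrak g_j,\mathfrak g_1]$, $\mathfrak g_s\ne\{0\}$, $[\mathfrak g_s,\mathfrak g]=\{0\}$. Dilations $\delta_\lambda$, $\lambda>0$, are the group automorphisms induced via $\exp$ by $X\mapsto\lambda^jX$ on $\mathfrak g_j$. $d$ is a fixed left-invariant distance on $\mathbb G$ inducing the manifold topology with $d(\delta_\lambda x,\delta_\lambda y)=\lambda d(x,y)$; $\|x\|_{\mathbb G}:=d(0,x)$, $0$ being the identity. Lipschitz continuity of $f:\mathbb G\to\mathbb R^k$ is with respect to $d$ and the Euclidean norm. Homogeneous complementary subgroups: Lie subgroups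 $\mathbb W,\mathbb V$ invariant under dilations with $\mathbb W\cap\mathbb V=\{0\}$ and $\mathbb G=\mathbb W\mathbb V$; every $x\in\mathbb G$ is uniquely $x=x_{\mathbb W}x_{\mathbb V}$. $\mathbb V$ is horizontal if $\mathbb V\subset\exp(\mathfrak g_1)$; then $\mathbb V$ is Abelian. Fixing a basis $X_1,\dots,X_k$ of the Lie algebra of $\mathbb V$ (part of a basis of $\mathfrak g$ adapted to the stratification), $\mathbb V$ is identified with $\mathbb R^k$ through $(v_1,\dots,v_k)\leftrightarrow\exp(v_1X_1+\dots+v_kX_k)$; $|v|$ and $\langle\cdot,v\rangle$ are Euclidean under this identification. For $A\subset\mathbb W$ and $\phi:A\to\mathbb V$, $\mathrm{gr}_\phi:=\{w\phi(w):w\in A\}$. With $\mathscr C_\alpha:=\{x\in\mathbb G:\|x_{\mathbb W}\|_{\mathbb G}\le\alpha\|x_{\mathbb V}\|_{\mathbb G}\}$, $\phi$ is intrinsic Lipschitz if there is $\alpha>0$ with $\mathrm{gr}_\phi\cap x\mathscr C_\alpha=\{x\}$ for every $x\in\mathrm{gr}_\phi$. *)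

theory Defs
  imports "HOL-Analysis.Analysis" "HOL-Library.Function_Algebras"
begin

text \<open>
  The group law is written additively, with neutral element \<open>0\<close>: the class
  \<open>group_add\<close> does not assume commutativity.  So \<open>x + y\<close> is the product \<open>xy\<close>,
  \<open>- x\<close> the inverse, and the order of the summands matters.
\<close>

section \<open>Smooth maps and manifolds\<close>

text \<open>Both predicates are meant for open \<open>S\<close>.\<close>

primrec Ck_on :: "nat \<Rightarrow> 'a::real_normed_vector set \<Rightarrow> ('a \<Rightarrow> 'b::real_normed_vector) \<Rightarrow> bool" where
  "Ck_on 0 S f \<longleftrightarrow> continuous_on S f"
| "Ck_on (Suc k) S f \<longleftrightarrow> (\<forall>x\<in>S. f differentiable (at x)) \<and>
     (\<forall>v. Ck_on k S (\<lambda>x. frechet_derivative f (at x) v))"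

definition smooth_on :: "'a::real_normed_vector set \<Rightarrow> ('a \<Rightarrow> 'b::real_normed_vector) \<Rightarrow> bool" where
  "smooth_on S f \<longleftrightarrow> (\<forall>k. Ck_on k S f)"

text \<open>A chart is a pair \<open>(U, c)\<close>; the values of \<open>c\<close> outside \<open>U\<close> are irrelevant.\<close>

type_synonym ('m, 'e) atlas = "('m set \<times> ('m \<Rightarrow> 'e)) set"

definition chart :: "'m::topological_space set \<times> ('m \<Rightarrow> 'e::euclidean_space) \<Rightarrow> bool" where
  "chart = (\<lambda>(U, c). open U \<and> open (c ` U) \<and> homeomorphism U (c ` U) c (inv_into U c))"

definition smooth_compat ::
  "'m::topological_space set \<times> ('m \<Rightarrow> 'e::euclidean_space) \<Rightarrow> 'm set \<times> ('m \<Rightarrow> 'e) \<Rightarrow> bool" where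
  "smooth_compat = (\<lambda>(U, c) (U', c').
     smooth_on (c ` (U \<inter> U')) (c' \<circ> inv_into U c) \<and>
     smooth_on (c' ` (U \<inter> U')) (c \<circ> inv_into U' c'))"

definition smooth_atlas :: "('m::topological_space, 'e::euclidean_space) atlas \<Rightarrow> bool" where
  "smooth_atlas \<A> \<longleftrightarrow> (\<forall>C\<in>\<A>. chart C) \<and> (\<Union>C\<in>\<A>. fst C) = UNIV \<and>
     (\<forall>C\<in>\<A>. \<forall>C'\<in>\<A>. smooth_compat C C')"

definition eucl_atlas :: "('e::euclidean_space, 'e) atlas" where
  "eucl_atlas = {(UNIV, id)}"

definition prod_atlas :: "('m, 'e) atlas \<Rightarrow> ('n, 'f) atlas \<Rightarrow> ('m \<times> 'n, 'e \<times> 'f) atlas" where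
  "prod_atlas \<A> \<B> = {(U \<times> U', map_prod c c') | U c U' c'. (U, c) \<in> \<A> \<and> (U', c') \<in> \<B>}"

definition smooth_map :: "('m::topological_space, 'e::euclidean_space) atlas \<Rightarrow>
    ('n::topological_space, 'f::euclidean_space) atlas \<Rightarrow> ('m \<Rightarrow> 'n) \<Rightarrow> bool" where
  "smooth_map \<A> \<B> f \<longleftrightarrow> continuous_on UNIV f \<and>
     (\<forall>(U, c)\<in>\<A>. \<forall>(U', c')\<in>\<B>. smooth_on (c ` (U \<inter> f -` U')) (c' \<circ> f \<circ> inv_into U c))"

definition embedded_submanifold ::
  "('m::topological_space, 'e::euclidean_space) atlas \<Rightarrow> 'm set \<Rightarrow> bool" where
  "embedded_submanifold \<A> H \<longleftrightarrow> (\<exists>E. subspace E \<and>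
     (\<forall>p\<in>H. \<exists>U c. chart (U, c) \<and> (\<forall>C\<in>\<A>. smooth_compat (U, c) C) \<and> p \<in> U \<and>
        c ` (U \<inter> H) = c ` U \<inter> E))"

section \<open>Lie groups\<close>

definition lie_group ::
  "('g::{t2_space, second_countable_topology, group_add}, 'e::euclidean_space) atlas \<Rightarrow> bool" where
  "lie_group \<A> \<longleftrightarrow> smooth_atlas \<A> \<and>
     smooth_map (prod_atlas \<A> \<A>) \<A> (\<lambda>(x, y). x + y) \<and> smooth_map \<A> \<A> uminus"

definition add_subgroup :: "'g::group_add set \<Rightarrow> bool" where
  "add_subgroup H \<longleftrightarrow> 0 \<in> H \<and> (\<forall>x\<in>H. \<forall>y\<in>H. x + y \<in> H) \<and> (\<forall>x\<in>H. - x \<in> H)"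

text \<open>
  Lie subgroups are embedded.  For the dilation-invariant subgroups of a Carnot group considered
  below this is no restriction: immersed ones are exponentials of graded subalgebras, hence closed.
\<close>

definition lie_subgroup ::
  "('g::{topological_space, group_add}, 'e::euclidean_space) atlas \<Rightarrow> 'g set \<Rightarrow> bool" where
  "lie_subgroup \<A> H \<longleftrightarrow> add_subgroup H \<and> embedded_submanifold \<A> H"

primrec lower_central :: "nat \<Rightarrow> 'g::group_add set" where
  "lower_central 0 = UNIV"
| "lower_central (Suc n) = add_subgroup hull {x + y + (- x) + (- y) | x y. x \<in> lower_central n}"

definition nilpotent_group :: "'g::group_add itself \<Rightarrow> bool" where
  "nilpotent_group _ \<longleftrightarrow> (\<exists>n. lower_central n = {0::'g})"

text \<open>
  The Lie algebra is the space of left-invariant vector fields.  A vector field is identified with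
  the operator by which it acts on the smooth functions, extended by \<open>0\<close> to all functions.  The
  left-invariant fields are the left translates of the velocities at \<open>0\<close> of smooth curves
  through \<open>0\<close>; the bracket is the commutator of operators.
\<close>

type_synonym 'g field = "('g \<Rightarrow> real) \<Rightarrow> ('g \<Rightarrow> real)"

definition C_infinity :: "('g::topological_space, 'e::euclidean_space) atlas \<Rightarrow> ('g \<Rightarrow> real) set" where
  "C_infinity \<A> = {f. smooth_map \<A> eucl_atlas f}"

definition left_field ::
  "('g::{topological_space, group_add}, 'e::euclidean_space) atlas \<Rightarrow> (real \<Rightarrow> 'g) \<Rightarrow> 'g field" where
  "left_field \<A> \<gamma> = (\<lambda>f p. if f \<in> C_infinity \<A> then deriv (\<lambda>t. f (p + \<gamma> t)) 0 else 0)"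

definition lie_algebra ::
  "('g::{topological_space, group_add}, 'e::euclidean_space) atlas \<Rightarrow> 'g field set" where
  "lie_algebra \<A> = {left_field \<A> \<gamma> | \<gamma>. smooth_map eucl_atlas \<A> \<gamma> \<and> \<gamma> 0 = 0}"

definition fscale :: "real \<Rightarrow> 'g field \<Rightarrow> 'g field" where
  "fscale a X = (\<lambda>f p. a * X f p)"

lemma vector_space_fscale: "vector_space fscale"
  by unfold_locales (auto simp: fscale_def fun_eq_iff algebra_simps)

definition bracket :: "'g field \<Rightarrow> 'g field \<Rightarrow> 'g field" where
  "bracket X Y = (\<lambda>f p. X (Y f) p - Y (X f) p)"

definition bracket_span :: "'g field set \<Rightarrow> 'g field set \<Rightarrow> 'g field set" where
  "bracket_span P Q = module.span fscale {bracket X Y | X Y. X \<in> P \<and> Y \<in> Q}"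

definition one_parameter_subgroup ::
  "('g::{topological_space, group_add}, 'e::euclidean_space) atlas \<Rightarrow> (real \<Rightarrow> 'g) \<Rightarrow> bool" where
  "one_parameter_subgroup \<A> \<gamma> \<longleftrightarrow> smooth_map eucl_atlas \<A> \<gamma> \<and> (\<forall>s t. \<gamma> (s + t) = \<gamma> s + \<gamma> t)"

definition lie_exp ::
  "('g::{topological_space, group_add}, 'e::euclidean_space) atlas \<Rightarrow> 'g field \<Rightarrow> 'g" where
  "lie_exp \<A> X = (THE p. \<exists>\<gamma>. one_parameter_subgroup \<A> \<gamma> \<and> left_field \<A> \<gamma> = X \<and> p = \<gamma> 1)"

definition subgroup_lie_algebra ::
  "('g::{topological_space, group_add}, 'e::euclidean_space) atlas \<Rightarrow> 'g set \<Rightarrow> 'g field set" where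
  "subgroup_lie_algebra \<A> H = {X \<in> lie_algebra \<A>. \<forall>t. lie_exp \<A> (fscale t X) \<in> H}"

section \<open>Carnot groups\<close>

text \<open>The layers are \<open>L 1, \<dots>, L s\<close>; other values of \<open>L\<close> are irrelevant.\<close>

definition direct_sum_decomposition :: "nat \<Rightarrow> (nat \<Rightarrow> 'g field set) \<Rightarrow> 'g field set \<Rightarrow> bool" where
  "direct_sum_decomposition s L \<gg> \<longleftrightarrow>
     (\<forall>j\<in>{1..s}. module.subspace fscale (L j) \<and> L j \<subseteq> \<gg>) \<and>
     (\<forall>X\<in>\<gg>. \<exists>!Y. (\<forall>j\<in>{1..s}. Y j \<in> L j) \<and> (\<forall>j. j \<notin> {1..s} \<longrightarrow> Y j = 0) \<and> X = (\<Sum>j=1..s. Y j))"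

definition stratification ::
  "('g::{topological_space, group_add}, 'e::euclidean_space) atlas \<Rightarrow> nat \<Rightarrow> (nat \<Rightarrow> 'g field set) \<Rightarrow> bool" where
  "stratification \<A> s L \<longleftrightarrow> 1 \<le> s \<and> direct_sum_decomposition s L (lie_algebra \<A>) \<and>
     (\<forall>j. 1 \<le> j \<and> j < s \<longrightarrow> L (Suc j) = bracket_span (L j) (L 1)) \<and>
     L s \<noteq> {0} \<and> bracket_span (L s) (lie_algebra \<A>) = {0}"

definition carnot_group ::
  "('g::{t2_space, second_countable_topology, group_add}, 'e::euclidean_space) atlas
     \<Rightarrow> nat \<Rightarrow> (nat \<Rightarrow> 'g field set) \<Rightarrow> bool" where
  "carnot_group \<A> s L \<longleftrightarrow> lie_group \<A> \<and> connected (UNIV :: 'g set) \<and>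
     simply_connected (UNIV :: 'g set) \<and> nilpotent_group TYPE('g) \<and> stratification \<A> s L"

text \<open>
  As \<open>lie_exp\<close> is onto in a Carnot group, the values \<open>\<delta> r\<close> for \<open>r > 0\<close> are uniquely determined.
\<close>

definition carnot_dilations ::
  "('g::{topological_space, group_add}, 'e::euclidean_space) atlas \<Rightarrow> nat \<Rightarrow> (nat \<Rightarrow> 'g field set)
     \<Rightarrow> (real \<Rightarrow> 'g \<Rightarrow> 'g) \<Rightarrow> bool" where
  "carnot_dilations \<A> s L \<delta> \<longleftrightarrow> (\<forall>r>0. bij (\<delta> r) \<and> (\<forall>x y. \<delta> r (x + y) = \<delta> r x + \<delta> r y) \<and>
     (\<forall>Y. (\<forall>j\<in>{1..s}. Y j \<in> L j) \<longrightarrow>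
        \<delta> r (lie_exp \<A> (\<Sum>j=1..s. Y j)) = lie_exp \<A> (\<Sum>j=1..s. fscale (r ^ j) (Y j))))"

text \<open>The distance is \<open>dist\<close>; that it induces the manifold topology is part of \<open>metric_space\<close>.\<close>

definition homogeneous_distance :: "(real \<Rightarrow> 'g \<Rightarrow> 'g::{metric_space, group_add}) \<Rightarrow> bool" where
  "homogeneous_distance \<delta> \<longleftrightarrow> (\<forall>p x y :: 'g. dist (p + x) (p + y) = dist x y) \<and>
     (\<forall>r>0. \<forall>x y. dist (\<delta> r x) (\<delta> r y) = r * dist x y)"

definition gnorm :: "'g::{metric_space, group_add} \<Rightarrow> real" where
  "gnorm x = dist 0 x"

definition homogeneous_subgroup ::
  "('g::{topological_space, group_add}, 'e::euclidean_space) atlas \<Rightarrow> (real \<Rightarrow> 'g \<Rightarrow> 'g) \<Rightarrow> 'g set \<Rightarrow> bool" where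
  "homogeneous_subgroup \<A> \<delta> H \<longleftrightarrow> lie_subgroup \<A> H \<and> (\<forall>r>0. \<delta> r ` H \<subseteq> H)"

definition complementary :: "'g::group_add set \<Rightarrow> 'g set \<Rightarrow> bool" where
  "complementary W V \<longleftrightarrow> W \<inter> V = {0} \<and> {w + v | w v. w \<in> W \<and> v \<in> V} = UNIV"

definition horizontal ::
  "('g::{topological_space, group_add}, 'e::euclidean_space) atlas \<Rightarrow> (nat \<Rightarrow> 'g field set) \<Rightarrow> 'g set \<Rightarrow> bool" where
  "horizontal \<A> L V \<longleftrightarrow> V \<subseteq> lie_exp \<A> ` L 1"

definition field_basis :: "('k::finite \<Rightarrow> 'g field) \<Rightarrow> 'g field set \<Rightarrow> bool" where
  "field_basis X \<hh> \<longleftrightarrow>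
     inj X \<and> \<not> module.dependent fscale (range X) \<and> module.span fscale (range X) = \<hh>"

text \<open>The identification of \<open>V\<close> with \<open>\<real>\<^sup>k\<close>, from \<open>V\<close> to \<open>\<real>\<^sup>k\<close>.\<close>

definition exp_coords :: "('g::{topological_space, group_add}, 'e::euclidean_space) atlas \<Rightarrow>
    ('k::finite \<Rightarrow> 'g field) \<Rightarrow> 'g \<Rightarrow> real ^ 'k" where
  "exp_coords \<A> X v = (THE a. v = lie_exp \<A> (\<Sum>i\<in>UNIV. fscale (a $ i) (X i)))"

section \<open>Intrinsic Lipschitz graphs\<close>

definition proj_W :: "'g::group_add set \<Rightarrow> 'g set \<Rightarrow> 'g \<Rightarrow> 'g" where
  "proj_W W V x = (THE w. w \<in> W \<and> (\<exists>v\<in>V. x = w + v))"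

definition proj_V :: "'g::group_add set \<Rightarrow> 'g set \<Rightarrow> 'g \<Rightarrow> 'g" where
  "proj_V W V x = (THE v. v \<in> V \<and> (\<exists>w\<in>W. x = w + v))"

definition intrinsic_cone :: "'g::{metric_space, group_add} set \<Rightarrow> 'g set \<Rightarrow> real \<Rightarrow> 'g set" where
  "intrinsic_cone W V \<alpha> = {x. gnorm (proj_W W V x) \<le> \<alpha> * gnorm (proj_V W V x)}"

definition intrinsic_graph :: "'g::group_add set \<Rightarrow> ('g \<Rightarrow> 'g) \<Rightarrow> 'g set" where
  "intrinsic_graph A \<phi> = {w + \<phi> w | w. w \<in> A}"

definition intrinsic_lipschitz ::
  "'g::{metric_space, group_add} set \<Rightarrow> 'g set \<Rightarrow> 'g set \<Rightarrow> ('g \<Rightarrow> 'g) \<Rightarrow> bool" where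
  "intrinsic_lipschitz W V A \<phi> \<longleftrightarrow> (\<exists>\<alpha>>0. \<forall>x\<in>intrinsic_graph A \<phi>.
     intrinsic_graph A \<phi> \<inter> (\<lambda>y. x + y) ` intrinsic_cone W V \<alpha> = {x})"

end

theory Submission
  imports Defs
begin

text \<open>
  Writing \<open>x\<^sub>V\<close> for the \<open>V\<close>-component of \<open>x\<close>, a set \<open>S\<close> is an intrinsic Lipschitz graph iff
  \<open>|p\<^sub>V| \<le> C \<parallel>p\<^sub>W\<parallel>\<close> for all \<open>p = x\<^sup>-\<^sup>1 y\<close> with \<open>x, y \<in> S\<close>.  If \<open>f\<close> is Lipschitz, coercive along \<open>V\<close>
  and zero on \<open>S\<close>, this holds because \<open>\<delta> |p\<^sub>V|\<^sup>2 \<le> \<langle>f (x p) - f (x p\<^sub>W), p\<^sub>V\<rangle> = \<langle>f x - f (x p\<^sub>W), p\<^sub>V\<rangle>\<close>.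

  Conversely, take \<open>f = \<pi> - \<Phi>\<close> with \<open>\<pi> x = x\<^sub>V\<close>, which is a Lipschitz homomorphism onto \<open>V = \<real>\<^sup>k\<close>, and
  \<open>\<Phi>\<close> the McShane-type extension \<open>\<Phi>\<^sub>i x = inf {\<pi>\<^sub>i y + h (y\<^sup>-\<^sup>1 x) | y \<in> S}\<close> of \<open>\<pi>\<close> from \<open>S\<close>.  This works
  if \<open>h\<close> is Lipschitz, \<open>h 0 = 0\<close>, \<open>|p\<^sub>V| \<le> h p\<close> whenever \<open>|p\<^sub>V| \<le> C \<parallel>p\<^sub>W\<parallel>\<close>, and \<open>h\<close> has a small Lipschitz
  constant \<open>\<epsilon>\<close> along the fibres \<open>p V\<close>.  Such an \<open>h\<close> is the supremum over all dilations of the profile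
  \<open>max 0 (A \<beta> (p\<^sub>W) - \<epsilon> |p\<^sub>V|)\<close>, where \<open>\<beta>\<close> is a cut-off function on \<open>W\<close> that is Lipschitz in a chart;
  the map \<open>p \<mapsto> p\<^sub>W\<close> itself is not Lipschitz for the homogeneous distance.

  From Lie theory this uses that the exponential map is defined on the whole Lie algebra, that the
  homogeneous norm dominates the norm of a chart at the identity, and that \<open>\<pi>\<close> is a homomorphism.
\<close>

section \<open>Calculus of continuously differentiable maps\<close>

text \<open>Left-invariant fields are encoded as operators on smooth functions, so everything is
  brought back to one chart \<open>c\<close> at the identity: a field becomes its velocity there, a
  one-parameter subgroup an integral curve. That \<pi> is a homomorphism rests on the velocity of
  \<open>\<delta> r x\<close> at r = 0, additive in x because the group law has derivative h + k at
  the identity. The delicate point is that no w in W has the velocity of a nonzero element of V: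
  otherwise the n-th powers of \<open>\<delta> (\<tau> / n) w\<close>, all in the closed set W,
  would tend to a nontrivial point of V. The size of \<epsilon> is dictated by coercivity: \<pi>
  contributes |v|^2, and k coordinates with fibre constant 1 / (2k) take away at most half of it. A
  profile that decreases with slope \<epsilon> along the fibres vanishes for large p_V, so
  conjugation by p_V matters only on a bounded set, which a small scale \<sigma> brings into the
  range of the chart estimates. Rescaling by dilations preserves Lipschitz constants, so the
  supremum keeps that of the profile.\<close>

lemma Ck_on_subset: "Ck_on k T f \<Longrightarrow> S \<subseteq> T \<Longrightarrow> Ck_on k S f"
  by (induction k arbitrary: f) (auto intro: continuous_on_subset)

lemma Ck_on_Suc_imp_Ck_on: "Ck_on (Suc k) S f \<Longrightarrow> Ck_on k S f"
proof (induction k arbitrary: f)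
  case 0
  then show ?case
    by (auto intro!: continuous_at_imp_continuous_on differentiable_imp_continuous_within)
next
  case (Suc k)
  then show ?case by (metis Ck_on.simps(2))
qed

lemma Ck_on_continuous_on: "Ck_on k S f \<Longrightarrow> continuous_on S f"
proof (induction k)
  case (Suc k)
  then show ?case using Ck_on_Suc_imp_Ck_on by blast
qed simp

lemma Ck_on_cong:
  assumes "open S" "\<And>x. x \<in> S \<Longrightarrow> f x = g x" "Ck_on k S f"
  shows "Ck_on k S g"
  using assms(2,3)
proof (induction k arbitrary: f g)
  case 0
  then show ?case by (simp cong: continuous_on_cong)
next
  case (Suc k)
  have D: "(g has_derivative frechet_derivative f (at x)) (at x)" if "x \<in> S" for x
  proof (rule has_derivative_transform_within_open[OF _ \<open>open S\<close> that])
    show "(f has_derivative frechet_derivative f (at x)) (at x)"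
      using Suc.prems(2) that by (simp add: frechet_derivative_works)
  qed (rule Suc.prems(1))
  have "Ck_on k S (\<lambda>x. frechet_derivative g (at x) v)" for v
  proof (rule Suc.IH[of "\<lambda>x. frechet_derivative f (at x) v"])
    show "Ck_on k S (\<lambda>x. frechet_derivative f (at x) v)"
      using Suc.prems(2) by simp
    show "frechet_derivative f (at x) v = frechet_derivative g (at x) v" if "x \<in> S" for x
      by (simp add: frechet_derivative_at[OF D[OF that]])
  qed
  moreover have "\<forall>x\<in>S. g differentiable (at x)"
    using D unfolding differentiable_def by blast
  ultimately show ?case by simp
qed

lemma Ck_on_local:
  assumes "\<And>x. x \<in> S \<Longrightarrow> \<exists>T. open T \<and> x \<in> T \<and> Ck_on k T f"
  shows "Ck_on k S f"
  using assms
proof (induction k arbitrary: f)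
  case 0
  have "isCont f x" if "x \<in> S" for x
    using 0[OF that] continuous_on_eq_continuous_at by (metis Ck_on.simps(1))
  then show ?case by (simp add: continuous_at_imp_continuous_on)
next
  case (Suc k)
  have "Ck_on k S (\<lambda>x. frechet_derivative f (at x) v)" for v
    by (rule Suc.IH) (use Suc.prems in force)
  with Suc.prems show ?case by force
qed

lemma Ck_on_SucI:
  assumes "open S" "\<And>x. x \<in> S \<Longrightarrow> (f has_derivative f' x) (at x)"
    "\<And>v. Ck_on k S (\<lambda>x. f' x v)"
  shows "Ck_on (Suc k) S f"
proof -
  have "Ck_on k S (\<lambda>x. frechet_derivative f (at x) v)" for v
    by (rule Ck_on_cong[OF assms(1) _ assms(3)])
       (use frechet_derivative_at[OF assms(2)] in simp)
  then show ?thesis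
    using assms(2) unfolding Ck_on.simps differentiable_def by blast
qed

lemma Ck_on_SucD:
  assumes "Ck_on (Suc k) S f" "x \<in> S"
  shows "(f has_derivative frechet_derivative f (at x)) (at x)"
  using assms frechet_derivative_works unfolding Ck_on.simps by blast

lemma Ck_on_const [simp]: "Ck_on k S (\<lambda>x. c)"
  by (induction k arbitrary: c) (auto simp: frechet_derivative_const)

lemma Ck_on_bounded_linear:
  assumes "bounded_linear f"
  shows "Ck_on k S f"
proof (cases k)
  case 0
  then show ?thesis by (simp add: assms linear_continuous_on)
next
  case (Suc m)
  have "(f has_derivative f) (at x)" for x
    using assms bounded_linear_imp_has_derivative by blast
  then have "frechet_derivative f (at x) = f" for x
    using frechet_derivative_at by metis
  moreover have "f differentiable (at x)" for x
    using assms bounded_linear_imp_differentiable by blast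
  ultimately show ?thesis using Suc by simp
qed

lemma Ck_on_add:
  assumes "open S" "Ck_on k S f" "Ck_on k S g"
  shows "Ck_on k S (\<lambda>x. f x + g x)"
  using assms(2,3)
proof (induction k arbitrary: f g)
  case 0
  then show ?case by (simp add: continuous_on_add)
next
  case (Suc k)
  show ?case
    by (rule Ck_on_SucI[OF \<open>open S\<close> has_derivative_add])
       (use Suc in \<open>auto simp: frechet_derivative_works\<close>)
qed

lemma Ck_on_sum:
  assumes "open S" "\<And>i. i \<in> I \<Longrightarrow> Ck_on k S (f i)"
  shows "Ck_on k S (\<lambda>x. \<Sum>i\<in>I. f i x)"
  using assms(2)
proof (induction I rule: infinite_finite_induct)
  case (insert i I)
  then show ?case by (simp add: Ck_on_add[OF \<open>open S\<close>])
qed auto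

lemma (in bounded_bilinear) Ck_on:
  assumes "open S" "Ck_on k S f" "Ck_on k S g"
  shows "Ck_on k S (\<lambda>x. prod (f x) (g x))"
  using assms(2,3)
proof (induction k arbitrary: f g)
  case 0
  then show ?case by (simp add: continuous_on)
next
  case (Suc k)
  show ?case
  proof (rule Ck_on_SucI[OF \<open>open S\<close> FDERIV])
    show "(f has_derivative frechet_derivative f (at x)) (at x)"
      "(g has_derivative frechet_derivative g (at x)) (at x)" if "x \<in> S" for x
      using Suc.prems that by (auto simp: frechet_derivative_works)
    show "Ck_on k S (\<lambda>x. prod (f x) (frechet_derivative g (at x) v) + prod (frechet_derivative f (at x) v) (g x))"
      for v
      using Suc.prems Suc.prems[THEN Ck_on_Suc_imp_Ck_on]
      by (intro Ck_on_add[OF \<open>open S\<close>] Suc.IH) auto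
  qed
qed

text \<open>\<open>Ck_on\<close> tests derivatives in one fixed direction at a time, whereas the
  chain rule differentiates f in a direction that moves with x. Expanding this direction in
  \<open>Basis\<close> gives a finite sum of products of coordinates with derivatives in fixed
  directions, to which the induction hypothesis applies; hence the Euclidean middle space.\<close>

lemma Ck_on_compose:
  fixes f :: "'b::euclidean_space \<Rightarrow> 'c::real_normed_vector"
    and g :: "'a::real_normed_vector \<Rightarrow> 'b"
  assumes "open S" "g ` S \<subseteq> T" "Ck_on k T f" "Ck_on k S g"
  shows "Ck_on k S (\<lambda>x. f (g x))"
  using assms(2,3,4)
proof (induction k arbitrary: f)
  case 0
  then show ?case by (auto intro: continuous_on_compose2)
next
  case (Suc k)
  let ?Df = "\<lambda>y. frechet_derivative f (at y)" and ?Dg = "\<lambda>x. frechet_derivative g (at x)"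
  have "((\<lambda>x. f (g x)) has_derivative
      (\<lambda>v. \<Sum>b\<in>Basis. (?Dg x v \<bullet> b) *\<^sub>R ?Df (g x) b)) (at x)" if "x \<in> S" for x
  proof -
    have f: "(f has_derivative ?Df (g x)) (at (g x))"
      using Suc.prems that by (blast intro: Ck_on_SucD)
    have g: "(g has_derivative ?Dg x) (at x)"
      using Suc.prems that by (blast intro: Ck_on_SucD)
    have "?Df (g x) w = (\<Sum>b\<in>Basis. (w \<bullet> b) *\<^sub>R ?Df (g x) b)" for w
    proof -
      interpret Df: bounded_linear "?Df (g x)"
        using f by (rule has_derivative_bounded_linear)
      show ?thesis
        by (subst euclidean_representation[of w, symmetric]) (simp add: Df.sum Df.scaleR)
    qed
    then have "(\<lambda>v. ?Df (g x) (?Dg x v)) = (\<lambda>v. \<Sum>b\<in>Basis. (?Dg x v \<bullet> b) *\<^sub>R ?Df (g x) b)"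
      by blast
    with has_derivative_compose[OF g f] show ?thesis by metis
  qed
  then show ?case
  proof (rule Ck_on_SucI[OF \<open>open S\<close>])
    show "Ck_on k S (\<lambda>x. \<Sum>b\<in>Basis. (?Dg x v \<bullet> b) *\<^sub>R ?Df (g x) b)" for v
    proof (intro Ck_on_sum bounded_bilinear.Ck_on[OF bounded_bilinear_scaleR] \<open>open S\<close>)
      fix b :: 'b
      show "Ck_on k S (\<lambda>x. ?Dg x v \<bullet> b)"
        by (rule bounded_bilinear.Ck_on[OF bounded_bilinear_inner \<open>open S\<close> _ Ck_on_const])
           (use Suc.prems(3) in simp)
      show "Ck_on k S (\<lambda>x. ?Df (g x) b)"
        by (rule Suc.IH[OF Suc.prems(1) _ Suc.prems(3)[THEN Ck_on_Suc_imp_Ck_on]])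
           (use Suc.prems(2) in simp)
    qed
  qed
qed

lemma smooth_on_compose:
  fixes f :: "'b::euclidean_space \<Rightarrow> 'c::real_normed_vector"
    and g :: "'a::real_normed_vector \<Rightarrow> 'b"
  assumes "open S" "g ` S \<subseteq> T" "smooth_on T f" "smooth_on S g"
  shows "smooth_on S (\<lambda>x. f (g x))"
  using assms Ck_on_compose unfolding smooth_on_def by blast

lemma Ck_on_Pair:
  assumes "open S" "Ck_on k S f" "Ck_on k S g"
  shows "Ck_on k S (\<lambda>x. (f x :: 'b::euclidean_space, g x :: 'c::euclidean_space))"
proof -
  have f: "Ck_on k S (\<lambda>x. (f x, 0::'c))"
    by (rule Ck_on_compose[OF assms(1) subset_UNIV Ck_on_bounded_linear assms(2),
          of "\<lambda>y. (y, 0)"]) (auto intro: bounded_linear_intros)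
  have g: "Ck_on k S (\<lambda>x. (0::'b, g x))"
    by (rule Ck_on_compose[OF assms(1) subset_UNIV Ck_on_bounded_linear assms(3),
          of "\<lambda>y. (0, y)"]) (auto intro: bounded_linear_intros)
  show ?thesis
    using Ck_on_add[OF assms(1) f g] by simp
qed

lemma smooth_on_Pair:
  assumes "open S" "smooth_on S f" "smooth_on S g"
  shows "smooth_on S (\<lambda>x. (f x :: 'b::euclidean_space, g x :: 'c::euclidean_space))"
  using assms Ck_on_Pair unfolding smooth_on_def by blast

lemma smooth_on_cong: "open S \<Longrightarrow> (\<And>x. x \<in> S \<Longrightarrow> f x = g x) \<Longrightarrow> smooth_on S f \<Longrightarrow> smooth_on S g"
  using Ck_on_cong unfolding smooth_on_def by blast

lemma smooth_on_subset: "smooth_on T f \<Longrightarrow> S \<subseteq> T \<Longrightarrow> smooth_on S f"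
  using Ck_on_subset unfolding smooth_on_def by blast

lemma smooth_on_local:
  assumes "\<And>x. x \<in> S \<Longrightarrow> \<exists>T. open T \<and> x \<in> T \<and> smooth_on T f"
  shows "smooth_on S f"
  using assms unfolding smooth_on_def by (meson Ck_on_local)

lemma smooth_on_bounded_linear: "bounded_linear f \<Longrightarrow> smooth_on S f"
  by (simp add: smooth_on_def Ck_on_bounded_linear)

lemma smooth_on_const [simp]: "smooth_on S (\<lambda>x. c)"
  by (simp add: smooth_on_def)

lemma smooth_on_has_derivative:
  "smooth_on S f \<Longrightarrow> x \<in> S \<Longrightarrow> (f has_derivative frechet_derivative f (at x)) (at x)"
  using Ck_on_SucD unfolding smooth_on_def by blast

lemma smooth_on_frechet_derivative: "smooth_on S f \<Longrightarrow> smooth_on S (\<lambda>x. frechet_derivative f (at x) v)"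
  unfolding smooth_on_def by (metis Ck_on.simps(2))

lemma smooth_on_continuous_on: "smooth_on S f \<Longrightarrow> continuous_on S f"
  using Ck_on_continuous_on unfolding smooth_on_def by blast

text \<open>On a compact ball the partial derivatives are bounded, and the mean value inequality
  turns the sum of their bounds into a Lipschitz constant. The constants of the differential
  equations and of the group law near the identity come from here.\<close>

lemma Ck_on_1_lipschitz_near:
  fixes f :: "'a::euclidean_space \<Rightarrow> 'b::real_normed_vector"
  assumes "open S" "Ck_on 1 S f" "x \<in> S"
  obtains r K where "r > 0" "K \<ge> 0" "cball x r \<subseteq> S"
    "\<And>y z. y \<in> cball x r \<Longrightarrow> z \<in> cball x r \<Longrightarrow> norm (f y - f z) \<le> K * norm (y - z)"
proof -
  obtain r where r: "r > 0" "cball x r \<subseteq> S"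
    using assms open_contains_cball by blast
  let ?D = "\<lambda>y. frechet_derivative f (at y)"
  define B where "B b = (SOME M. \<forall>y\<in>cball x r. norm (?D y b) \<le> M)" for b
  have B: "norm (?D y b) \<le> B b" if "y \<in> cball x r" for y b
  proof -
    have "continuous_on (cball x r) (\<lambda>y. ?D y b)"
      using assms(2) r(2) by (auto intro: continuous_on_subset)
    then have "bounded ((\<lambda>y. ?D y b) ` cball x r)"
      by (intro compact_imp_bounded compact_continuous_image) auto
    then have "\<exists>M. \<forall>y\<in>cball x r. norm (?D y b) \<le> M"
      by (auto simp: bounded_iff)
    then have "\<forall>y\<in>cball x r. norm (?D y b) \<le> B b"
      unfolding B_def by (rule someI_ex)
    with that show ?thesis by blast
  qed
  have "0 \<le> B b" for b
    using B[of x b] r(1) norm_ge_zero[of "?D x b"] by (smt (verit) centre_in_cball)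
  then have K0: "0 \<le> (\<Sum>b\<in>Basis. B b)" by (simp add: sum_nonneg)
  have D: "(f has_derivative ?D y) (at y)" if "y \<in> cball x r" for y
    using assms(2) r(2) that by (auto simp: frechet_derivative_works)
  have "norm (f y - f z) \<le> (\<Sum>b\<in>Basis. B b) * norm (y - z)"
    if "y \<in> cball x r" "z \<in> cball x r" for y z
  proof (rule differentiable_bound[OF convex_cball _ _ that])
    show "(f has_derivative ?D y) (at y within cball x r)" if "y \<in> cball x r" for y
      using D[OF that] has_derivative_at_withinI by blast
    show "onorm (?D y) \<le> (\<Sum>b\<in>Basis. B b)" if "y \<in> cball x r" for y
      by (rule order_trans[OF onorm_componentwise sum_mono])
         (use B that D has_derivative_bounded_linear in blast)+
  qed
  with r K0 show ?thesis using that by blast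
qed

section \<open>Smooth bump functions\<close>

text \<open>The functions P(1/x) exp(-1/x), continued by 0, form a family closed under
  differentiation: P becomes y^2 (P - P'). So smoothness is an induction with arbitrary P.\<close>

definition flat_fun :: "real poly \<Rightarrow> real \<Rightarrow> real" where
  "flat_fun P x = (if x > 0 then poly P (1 / x) * exp (- (1 / x)) else 0)"

lemma flat_fun_tendsto_0: "((\<lambda>x. poly P (1 / x) * exp (- (1 / x))) \<longlongrightarrow> 0) (at_right (0::real))"
proof -
  have "((\<lambda>y. poly P y / exp y) \<longlongrightarrow> 0) at_top"
  proof -
    have "((\<lambda>y. \<Sum>i\<le>degree P. coeff P i * (y ^ i / exp y)) \<longlongrightarrow> (\<Sum>i\<le>degree P. coeff P i * 0)) at_top"
      by (intro tendsto_sum tendsto_mult tendsto_const tendsto_power_div_exp_0)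
    then show ?thesis by (simp add: poly_altdef sum_divide_distrib)
  qed
  then have "((\<lambda>x. poly P (inverse x) / exp (inverse x)) \<longlongrightarrow> 0) (at_right (0::real))"
    using filterlim_compose[OF _ filterlim_inverse_at_top_right] by blast
  then show ?thesis
    by (simp add: exp_minus field_simps inverse_eq_divide)
qed

lemma flat_fun_has_derivative:
  "(flat_fun P has_real_derivative flat_fun ([:0,0,1:] * (P - pderiv P)) x) (at x)"
proof -
  consider "x > 0" | "x < 0" | "x = 0" by linarith
  then show ?thesis
  proof cases
    case 1
    have "((\<lambda>x. poly P (1 / x) * exp (- (1 / x))) has_real_derivative
        flat_fun ([:0,0,1:] * (P - pderiv P)) x) (at x)"
      using 1 unfolding flat_fun_def
      by (auto intro!: derivative_eq_intros simp: field_simps power2_eq_square)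
    then show ?thesis
      by (rule has_field_derivative_transform_within_open[of _ _ _ "{0<..}"])
         (use 1 in \<open>auto simp: flat_fun_def\<close>)
  next
    case 2
    have "((\<lambda>x. 0) has_real_derivative flat_fun ([:0,0,1:] * (P - pderiv P)) x) (at x)"
      using 2 by (auto simp: flat_fun_def)
    then show ?thesis
      by (rule has_field_derivative_transform_within_open[of _ _ _ "{..<0}"])
         (use 2 in \<open>auto simp: flat_fun_def\<close>)
  next
    case 3
    \<comment> \<open>The factor 1 / h of the difference quotient at 0 is absorbed by multiplying
      the polynomial by its variable.\<close>
    have "((\<lambda>h. poly (pCons 0 P) (1 / h) * exp (- (1 / h))) \<longlongrightarrow> 0) (at_right (0::real))"
      by (rule flat_fun_tendsto_0)
    then have "((\<lambda>h. flat_fun P h / h) \<longlongrightarrow> 0) (at_right 0)"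
      by (rule Lim_transform_eventually)
         (auto simp: flat_fun_def eventually_at_filter)
    moreover have "((\<lambda>h. flat_fun P h / h) \<longlongrightarrow> 0) (at_left 0)"
      by (rule Lim_transform_eventually[OF tendsto_const])
         (auto simp: flat_fun_def eventually_at_filter)
    ultimately have "((\<lambda>h. flat_fun P h / h) \<longlongrightarrow> 0) (at 0)"
      by (simp add: filterlim_split_at)
    then show ?thesis
      using 3 by (simp add: DERIV_def flat_fun_def)
  qed
qed

lemma Ck_on_flat_fun: "Ck_on k UNIV (flat_fun P)"
proof (induction k arbitrary: P)
  case 0
  then show ?case
    using flat_fun_has_derivative by (auto intro!: continuous_at_imp_continuous_on DERIV_isCont)
next
  case (Suc k)
  show ?case
  proof (rule Ck_on_SucI)
    show "(flat_fun P has_derivative (\<lambda>v. flat_fun ([:0,0,1:] * (P - pderiv P)) x * v)) (at x)" for x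
      using flat_fun_has_derivative by (rule has_field_derivative_imp_has_derivative)
    show "Ck_on k UNIV (\<lambda>x. flat_fun ([:0,0,1:] * (P - pderiv P)) x * v)" for v
      by (intro bounded_bilinear.Ck_on[OF bounded_bilinear_mult] Suc) auto
  qed auto
qed

lemma smooth_bump_exists:
  fixes a :: "'a::euclidean_space"
  assumes "r > 0"
  obtains \<psi> :: "'a \<Rightarrow> real" where "smooth_on UNIV \<psi>" "\<psi> a \<noteq> 0" "\<And>y. y \<notin> ball a r \<Longrightarrow> \<psi> y = 0"
proof
  let ?\<psi> = "\<lambda>y. flat_fun 1 (r\<^sup>2 + (-1) * ((y + (- a)) \<bullet> (y + (- a))))"
  show "smooth_on UNIV ?\<psi>"
    unfolding smooth_on_def
    by (intro allI Ck_on_compose[OF _ subset_UNIV Ck_on_flat_fun] Ck_on_add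
        bounded_bilinear.Ck_on[OF bounded_bilinear_inner]
        bounded_bilinear.Ck_on[OF bounded_bilinear_mult] Ck_on_const
        Ck_on_bounded_linear[OF bounded_linear_ident]) auto
  show "?\<psi> a \<noteq> 0"
    using assms by (simp add: flat_fun_def)
  show "?\<psi> y = 0" if "y \<notin> ball a r" for y
  proof -
    have "r \<le> norm (y - a)"
      using that by (simp add: dist_norm norm_minus_commute)
    then have "r\<^sup>2 \<le> (y - a) \<bullet> (y - a)"
      using assms by (metis less_imp_le power_mono power2_norm_eq_inner)
    then show ?thesis by (simp add: flat_fun_def)
  qed
qed

section \<open>Autonomous differential equations\<close>

text \<open>Banach's fixed point theorem for the integral equation, in the complete space of bounded
  continuous functions on the whole line. For this \<open>F\<close> is composed with the
  nearest-point map of the ball and time is clamped to [-a, a]; for |t| < a the solution stays where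
  neither change is felt.\<close>

lemma picard_lindeloef_local:
  fixes F :: "'a::euclidean_space \<Rightarrow> 'a"
  assumes r: "r > 0" and K: "K \<ge> 0"
    and lip: "\<And>x y. x \<in> cball p r \<Longrightarrow> y \<in> cball p r \<Longrightarrow> norm (F x - F y) \<le> K * norm (x - y)"
  obtains a y where "a > 0" "y 0 = p" "\<And>t. \<bar>t\<bar> < a \<Longrightarrow> y t \<in> cball p r"
    "\<And>t. \<bar>t\<bar> < a \<Longrightarrow> (y has_vector_derivative F (y t)) (at t)"
proof -
  define Fb where "Fb x = F (closest_point (cball p r) x)" for x
  have cp: "closest_point (cball p r) x \<in> cball p r" for x
    using r by (intro closest_point_in_set) auto
  have Fb_lip: "norm (Fb x - Fb y) \<le> K * norm (x - y)" for x y
  proof -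
    have "norm (closest_point (cball p r) x - closest_point (cball p r) y) \<le> norm (x - y)"
      using closest_point_lipschitz[of "cball p r" x y] r by (simp add: dist_norm)
    then show ?thesis
      using lip[OF cp cp, of x y] K unfolding Fb_def
      by (smt (verit) mult_left_mono)
  qed
  define M where "M = norm (F p) + K * r"
  have M0: "M \<ge> 0" using r K by (simp add: M_def)
  have Fb_bound: "norm (Fb x) \<le> M" for x
  proof -
    have "norm (Fb x - F p) \<le> K * norm (closest_point (cball p r) x - p)"
      unfolding Fb_def using r by (intro lip cp) auto
    also have "\<dots> \<le> K * r"
      using cp[of x] K by (intro mult_left_mono) (auto simp: dist_norm norm_minus_commute)
    finally show ?thesis
      unfolding M_def by (smt (verit) norm_triangle_sub)
  qed
  have Fb_cont: "continuous_on UNIV Fb"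
    using Fb_lip K
    by (intro lipschitz_on_continuous_on[of K] lipschitz_onI) (auto simp: dist_norm)
  \<comment> \<open>The two bounds give 4aM \<le> r, which keeps the curve in the ball, and 4aK
    \<le> 1/2, which makes the operator a contraction. The 4 arises because the integral starts at
    -a and its value at 0 is subtracted, two terms over length at most 2a each.\<close>
  define a where "a = min (r / (4 * (M + 1))) (1 / (8 * (K + 1)))"
  have a: "a > 0" using r M0 K by (simp add: a_def)
  have "4 * a * M \<le> r"
  proof -
    have "a \<le> r / (4 * (M + 1))" by (simp add: a_def)
    then have "a * (4 * (M + 1)) \<le> r"
      using M0 by (simp add: pos_le_divide_eq)
    then show ?thesis using a M0 by (simp add: algebra_simps)
  qed
  have "4 * a * K \<le> 1 / 2"
  proof -
    have "a \<le> 1 / (8 * (K + 1))" by (simp add: a_def)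
    then have "a * (8 * (K + 1)) \<le> 1"
      using K by (simp add: pos_le_divide_eq)
    then show ?thesis using a K by (simp add: algebra_simps)
  qed
  define cl where "cl t = max (- a) (min a t)" for t
  have cl: "cl t \<in> {-a..a}" for t using a by (auto simp: cl_def)
  have cl_cont: "continuous_on UNIV cl" unfolding cl_def by (intro continuous_intros)
  define I where "I u t = integral {-a..t} (\<lambda>s. Fb (apply_bcontfun u s))" for u t
  have cont: "continuous_on S (\<lambda>s. Fb (apply_bcontfun u s))"
    for u :: "real \<Rightarrow>\<^sub>C 'a" and S
    by (intro continuous_on_compose2[OF Fb_cont]) auto
  have int: "(\<lambda>s. Fb (apply_bcontfun u s)) integrable_on {s..t}" for u and s t :: real
    by (intro integrable_continuous_real cont)
  have I_cont: "continuous_on {-a..a} (I u)" for u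
    unfolding I_def using indefinite_integral_continuous_1[OF int] by blast
  have I_bound: "norm (I u t) \<le> 2 * a * M" if "t \<in> {-a..a}" for u t
  proof -
    have "norm (I u t) \<le> M * (t - (-a))"
      unfolding I_def using that Fb_bound
      by (intro integral_bound cont) auto
    also have "\<dots> \<le> M * (2 * a)"
      using that M0 by (intro mult_left_mono) auto
    finally show ?thesis by (simp add: mult.commute)
  qed
  have I_diff: "norm (I u t - I w t) \<le> 2 * a * K * dist u w" if "t \<in> {-a..a}" for u w t
  proof -
    have "norm (I u t - I w t) =
        norm (integral {-a..t} (\<lambda>s. Fb (apply_bcontfun u s) - Fb (apply_bcontfun w s)))"
      unfolding I_def by (simp add: Henstock_Kurzweil_Integration.integral_diff int)
    also have "\<dots> \<le> K * dist u w * (t - (-a))"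
    proof (rule integral_bound)
      show "norm (Fb (apply_bcontfun u s) - Fb (apply_bcontfun w s)) \<le> K * dist u w" for s
        using Fb_lip[of "apply_bcontfun u s" "apply_bcontfun w s"] dist_bounded[of u s w] K
        by (smt (verit) dist_norm mult_left_mono)
    qed (use that in \<open>auto intro!: continuous_on_diff cont\<close>)
    also have "\<dots> \<le> K * dist u w * (2 * a)"
      using that K by (intro mult_left_mono) auto
    finally show ?thesis by (simp add: mult.commute mult.left_commute)
  qed
  define T where "T u = Bcontfun (\<lambda>t. p + (I u (cl t) - I u 0))" for u
  have T: "apply_bcontfun (T u) t = p + (I u (cl t) - I u 0)" for u t
  proof -
    have "(\<lambda>t. p + (I u (cl t) - I u 0)) \<in> bcontfun"
    proof (rule bcontfun_normI)
      show "continuous_on UNIV (\<lambda>t. p + (I u (cl t) - I u 0))"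
        by (intro continuous_intros continuous_on_compose2[OF I_cont cl_cont]) (use cl in auto)
      show "norm (p + (I u (cl t) - I u 0)) \<le> norm p + 4 * a * M" for t
        using I_bound[OF cl, of u t] I_bound[of 0 u] a
          norm_triangle_ineq[of p "I u (cl t) - I u 0"] norm_triangle_ineq4[of "I u (cl t)" "I u 0"]
        by simp
    qed
    then show ?thesis by (simp add: T_def Bcontfun_inverse)
  qed
  have "\<exists>!u. T u = u"
  proof (rule banach_fix_type[of "1 / 2"])
    show "\<forall>u w. dist (T u) (T w) \<le> 1 / 2 * dist u w"
    proof (intro allI dist_bound)
      fix u w :: "real \<Rightarrow>\<^sub>C 'a" and t
      have "dist (apply_bcontfun (T u) t) (apply_bcontfun (T w) t)
          = norm ((I u (cl t) - I w (cl t)) - (I u 0 - I w 0))"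
        by (simp add: T dist_norm algebra_simps)
      also have "\<dots> \<le> 4 * a * K * dist u w"
        using I_diff[OF cl, of u t w] I_diff[of 0 u w] a
          norm_triangle_ineq4[of "I u (cl t) - I w (cl t)" "I u 0 - I w 0"] by simp
      also have "\<dots> \<le> 1 / 2 * dist u w"
        by (intro mult_right_mono \<open>4 * a * K \<le> 1 / 2\<close>) auto
      finally show "dist (apply_bcontfun (T u) t) (apply_bcontfun (T w) t) \<le> 1 / 2 * dist u w" .
    qed
  qed auto
  then obtain u where u: "T u = u" by blast
  let ?y = "apply_bcontfun u"
  have y: "?y t = p + (I u t - I u 0)" if "\<bar>t\<bar> \<le> a" for t
  proof -
    have "cl t = t" using that by (auto simp: cl_def)
    then show ?thesis using T[of u t] u by simp
  qed
  have y_cball: "?y t \<in> cball p r" if "\<bar>t\<bar> < a" for t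
  proof -
    have "norm (I u t - I u 0) \<le> 4 * a * M"
      using I_bound[of t u] I_bound[of 0 u] that a norm_triangle_ineq4[of "I u t" "I u 0"]
      by (simp add: abs_less_iff)
    then show ?thesis
      using y[of t] that \<open>4 * a * M \<le> r\<close> by (simp add: dist_norm norm_minus_commute)
  qed
  have "(?y has_vector_derivative F (?y t)) (at t)" if "\<bar>t\<bar> < a" for t
  proof -
    have "(I u has_vector_derivative Fb (?y t)) (at t within {-a..a})"
      unfolding I_def by (rule integral_has_vector_derivative[OF cont]) (use that in auto)
    then have "(I u has_vector_derivative Fb (?y t)) (at t)"
      using that by (simp add: at_within_Icc_at)
    then have "((\<lambda>t. p + (I u t - I u 0)) has_vector_derivative Fb (?y t)) (at t)"
      by (auto intro!: derivative_eq_intros)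
    then have "(?y has_vector_derivative Fb (?y t)) (at t)"
      by (rule has_vector_derivative_transform_within_open[of _ _ _ "{-a<..<a}"])
         (use that y in auto)
    moreover have "Fb (?y t) = F (?y t)"
      using y_cball[OF that] by (simp add: Fb_def closest_point_self)
    ultimately show ?thesis by simp
  qed
  with a y_cball y[of 0] show ?thesis
    using that[of a ?y] by simp
qed

text \<open>Bootstrapping: if y is C^k, so is its derivative \<open>F (y t)\<close>, and y is
  C^(k+1).\<close>

lemma ode_smooth:
  assumes "smooth_on D F" "\<And>t. \<bar>t\<bar> < a \<Longrightarrow> y t \<in> D"
    "\<And>t. \<bar>t\<bar> < a \<Longrightarrow> (y has_vector_derivative F (y t)) (at t)"
  shows "smooth_on {-a<..<a} (y :: real \<Rightarrow> 'a::euclidean_space)"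
  unfolding smooth_on_def
proof
  fix k
  show "Ck_on k {-a<..<a} y"
  proof (induction k)
    case 0
    have "isCont y t" if "t \<in> {-a<..<a}" for t
      using that assms(3)[of t] has_vector_derivative_continuous by (auto simp: abs_less_iff)
    then show ?case by (simp add: continuous_at_imp_continuous_on)
  next
    case (Suc k)
    show ?case
    proof (rule Ck_on_SucI)
      show "(y has_derivative (\<lambda>v. v *\<^sub>R F (y t))) (at t)" if "t \<in> {-a<..<a}" for t
        using that assms(3)[of t] by (simp add: has_vector_derivative_def abs_less_iff)
      have "Ck_on k {-a<..<a} (\<lambda>t. F (y t))"
        by (rule Ck_on_compose[OF _ _ _ Suc, of D])
           (use assms(1,2) in \<open>auto simp: smooth_on_def abs_less_iff\<close>)
      then show "Ck_on k {-a<..<a} (\<lambda>t. v *\<^sub>R F (y t))" for v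
        by (intro bounded_bilinear.Ck_on[OF bounded_bilinear_scaleR]) auto
    qed auto
  qed
qed

text \<open>At a point where |y - z| is maximal, the mean value inequality from 0 bounds this
  maximum by K a times itself, and K a < 1.\<close>

lemma ode_unique:
  fixes y z :: "real \<Rightarrow> 'a::euclidean_space"
  assumes a: "a > 0" "K * a < 1" "K \<ge> 0"
    and lip: "\<And>x x'. x \<in> B \<Longrightarrow> x' \<in> B \<Longrightarrow> norm (F x - F x') \<le> K * norm (x - x')"
    and y: "\<And>t. \<bar>t\<bar> \<le> a \<Longrightarrow> y t \<in> B" "\<And>t. \<bar>t\<bar> \<le> a \<Longrightarrow> (y has_vector_derivative F (y t)) (at t)"
    and z: "\<And>t. \<bar>t\<bar> \<le> a \<Longrightarrow> z t \<in> B" "\<And>t. \<bar>t\<bar> \<le> a \<Longrightarrow> (z has_vector_derivative F (z t)) (at t)"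
    and "y 0 = z 0" "\<bar>t\<bar> \<le> a"
  shows "y t = z t"
proof -
  let ?D = "\<lambda>t. y t - z t"
  have D: "(?D has_derivative (\<lambda>h. h *\<^sub>R (F (y t) - F (z t)))) (at t within {-a..a})"
    if "t \<in> {-a..a}" for t
  proof -
    have "(?D has_vector_derivative F (y t) - F (z t)) (at t)"
      using that by (intro has_vector_derivative_diff y z) auto
    then show ?thesis
      by (simp add: has_vector_derivative_def has_derivative_at_withinI)
  qed
  have cont: "continuous_on {-a..a} (\<lambda>t. norm (?D t))"
    by (intro continuous_on_norm has_derivative_continuous_on[OF D])
  have "\<exists>m\<in>{-a..a}. \<forall>t\<in>{-a..a}. norm (?D t) \<le> norm (?D m)"
    by (rule continuous_attains_sup[OF _ _ cont]) (use a in auto)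
  then obtain m where m: "m \<in> {-a..a}" "\<And>t. t \<in> {-a..a} \<Longrightarrow> norm (?D t) \<le> norm (?D m)"
    by blast
  have "norm (?D m - ?D 0) \<le> K * norm (?D m) * norm (m - 0)"
  proof (rule differentiable_bound[OF _ D])
    show "onorm (\<lambda>h. h *\<^sub>R (F (y t) - F (z t))) \<le> K * norm (?D m)" if "t \<in> {-a..a}" for t
    proof (rule onorm_le)
      fix h :: real
      have "norm (F (y t) - F (z t)) \<le> K * norm (?D t)"
        using that by (intro lip y z) auto
      also have "\<dots> \<le> K * norm (?D m)"
        using m(2)[OF that] a(3) by (rule mult_left_mono)
      finally show "norm (h *\<^sub>R (F (y t) - F (z t))) \<le> K * norm (?D m) * norm h"
        by (simp add: mult.commute mult_left_mono)
    qed
  qed (use m a in auto)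
  also have "\<dots> \<le> K * norm (?D m) * a"
    using m(1) a(3) by (intro mult_left_mono) auto
  finally have "norm (?D m) * (1 - K * a) \<le> 0"
    using \<open>y 0 = z 0\<close> by (simp add: algebra_simps)
  then have "norm (?D m) \<le> 0"
    using a(2) by (simp add: mult_le_0_iff)
  moreover have "norm (?D t) \<le> norm (?D m)"
    using \<open>\<bar>t\<bar> \<le> a\<close> by (intro m(2)) auto
  ultimately show ?thesis by simp
qed

section \<open>Extending local homomorphisms\<close>

abbreviation dbl :: "nat \<Rightarrow> 'a::group_add \<Rightarrow> 'a" where
  "dbl n \<equiv> (\<lambda>x. x + x) ^^ n"

lemma dbl_add_commuting: "x + y = y + x \<Longrightarrow> dbl n (x + y) = dbl n x + dbl n (y :: 'a::group_add)"
proof (induction n arbitrary: x y)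
  case (Suc n)
  have "(x + x) + (y + y) = (y + y) + (x + x)"
    using Suc.prems by (metis add.assoc)
  moreover have "(x + y) + (x + y) = (x + x) + (y + y)"
    using Suc.prems by (metis add.assoc)
  ultimately show ?case
    using Suc.IH[of "x + x" "y + y"] by (simp add: funpow_Suc_right del: funpow.simps)
qed simp

lemma add_hom_dbl:
  assumes "\<And>s t :: real. h (s + t) = h s + (h t :: 'a::group_add)"
  shows "h t = dbl n (h (t / 2 ^ n))"
proof (induction n)
  case (Suc n)
  have "h (t / 2 ^ n) = h (t / 2 ^ Suc n) + h (t / 2 ^ Suc n)"
    by (subst assms[symmetric]) simp
  then show ?case using Suc by (simp add: funpow_Suc_right del: funpow.simps)
qed simp

text \<open>The value \<open>h t\<close> is the 2^n-th power of \<open>g (t / 2 ^ n)\<close> for any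
  n with |t| / 2^n < b; raising n changes nothing, because \<open>g\<close> turns each halving into
  a square.\<close>

lemma extend_local_hom:
  fixes g :: "real \<Rightarrow> 'a::group_add"
  assumes "b > 0"
    and g: "\<And>s t. \<bar>s\<bar> < b \<Longrightarrow> \<bar>t\<bar> < b \<Longrightarrow> \<bar>s + t\<bar> < b \<Longrightarrow> g (s + t) = g s + g t"
  obtains h where "\<And>s t. h (s + t) = h s + h t" "\<And>t. \<bar>t\<bar> < b \<Longrightarrow> h t = g t"
proof -
  have ex: "\<exists>n. \<bar>t\<bar> / 2 ^ n < b" for t :: real
    using real_arch_pow[of 2 "\<bar>t\<bar> / b"] \<open>b > 0\<close> by (auto simp: field_simps)
  have mono: "\<bar>t\<bar> / 2 ^ m < b" if "\<bar>t\<bar> / 2 ^ n < b" "n \<le> m" for t :: real and n m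
    using that by (smt (verit) frac_le power_increasing zero_less_power abs_ge_zero)
  have step: "dbl m (g (t / 2 ^ m)) = dbl n (g (t / 2 ^ n))" if "\<bar>t\<bar> / 2 ^ n < b" "n \<le> m" for t n m
    using that(2)
  proof (induction m rule: dec_induct)
    case (step m)
    have "\<bar>t / 2 ^ m\<bar> < b" "\<bar>t / 2 ^ Suc m\<bar> < b"
      using mono[OF that(1), of m] mono[OF that(1), of "Suc m"] step.hyps by auto
    then have "g (t / 2 ^ m) = g (t / 2 ^ Suc m) + g (t / 2 ^ Suc m)"
      by (subst g[symmetric]) auto
    then show ?case using step.IH by (simp add: funpow_Suc_right del: funpow.simps)
  qed simp
  define h where "h t = dbl (SOME n. \<bar>t\<bar> / 2 ^ n < b) (g (t / 2 ^ (SOME n. \<bar>t\<bar> / 2 ^ n < b)))" for t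
  have h: "h t = dbl n (g (t / 2 ^ n))" if "\<bar>t\<bar> / 2 ^ n < b" for t n
  proof -
    define m where "m = (SOME n. \<bar>t\<bar> / 2 ^ n < b)"
    have m: "\<bar>t\<bar> / 2 ^ m < b" unfolding m_def using ex by (rule someI_ex)
    have "h t = dbl m (g (t / 2 ^ m))" by (simp add: h_def m_def)
    also have "\<dots> = dbl n (g (t / 2 ^ n))"
      using step[OF that, of m] step[OF m, of n] by (cases "n \<le> m") auto
    finally show ?thesis .
  qed
  show ?thesis
  proof
    show "h t = g t" if "\<bar>t\<bar> < b" for t using h[of t 0] that by simp
    show "h (s + t) = h s + h t" for s t
    proof -
      obtain i j k where "\<bar>s\<bar> / 2 ^ i < b" "\<bar>t\<bar> / 2 ^ j < b" "\<bar>s + t\<bar> / 2 ^ k < b"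
        using ex by blast
      then have n: "\<bar>s\<bar> / 2 ^ (i + j + k) < b" "\<bar>t\<bar> / 2 ^ (i + j + k) < b" "\<bar>s + t\<bar> / 2 ^ (i + j + k) < b"
        by (auto intro: mono)
      let ?n = "i + j + k"
      \<comment> \<open>Both orders are taken: as s + t = t + s, the two values of \<open>g\<close>
        commute, which is what makes the 2^n-th power of their product the product of the
        powers.\<close>
      have "\<bar>s / 2 ^ ?n + t / 2 ^ ?n\<bar> < b" "\<bar>t / 2 ^ ?n + s / 2 ^ ?n\<bar> < b"
        using n(3) by (simp_all flip: add_divide_distrib add: add.commute[of t])
      then have "g (s / 2 ^ ?n) + g (t / 2 ^ ?n) = g ((s + t) / 2 ^ ?n)"
        "g (t / 2 ^ ?n) + g (s / 2 ^ ?n) = g ((s + t) / 2 ^ ?n)"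
        using n(1,2) g[of "s / 2 ^ ?n" "t / 2 ^ ?n"] g[of "t / 2 ^ ?n" "s / 2 ^ ?n"]
        by (simp_all add: add_divide_distrib add.commute)
      then show ?thesis
        using h[OF n(1)] h[OF n(2)] h[OF n(3)] dbl_add_commuting[of "g (s / 2 ^ ?n)" "g (t / 2 ^ ?n)" ?n]
        by simp
    qed
  qed
qed

section \<open>Lie groups in a chart at the identity\<close>

lemma has_vector_derivative_shift:
  assumes "(f has_vector_derivative v) (at (s + t))"
  shows "((\<lambda>x. f (s + x)) has_vector_derivative v) (at t)"
proof -
  have "((\<lambda>x. s + x) has_derivative (\<lambda>h. h)) (at t)"
    by (auto intro!: derivative_eq_intros)
  from has_derivative_compose[OF this, of f] show ?thesis
    using assms by (simp add: has_vector_derivative_def)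
qed

locale lie_grp =
  fixes \<A> :: "('g::{t2_space, second_countable_topology, group_add}, 'e::euclidean_space) atlas"
  assumes lie: "lie_group \<A>"
begin

lemma chart_open: "(U, c) \<in> \<A> \<Longrightarrow> open U" and chart_image_open: "(U, c) \<in> \<A> \<Longrightarrow> open (c ` U)"
  and chart_homeo: "(U, c) \<in> \<A> \<Longrightarrow> homeomorphism U (c ` U) c (inv_into U c)"
  using lie unfolding lie_group_def smooth_atlas_def chart_def by auto

lemma chart_inv: "(U, c) \<in> \<A> \<Longrightarrow> x \<in> U \<Longrightarrow> inv_into U c (c x) = x"
  and chart_inv': "y \<in> c ` U \<Longrightarrow> c (inv_into U c y) = y"
  and chart_inv_in: "y \<in> c ` U \<Longrightarrow> inv_into U c y \<in> U"
  using chart_homeo unfolding homeomorphism_def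
  by (auto simp: f_inv_into_f inv_into_into)

lemma chart_continuous: "(U, c) \<in> \<A> \<Longrightarrow> continuous_on U c"
  and chart_inv_continuous: "(U, c) \<in> \<A> \<Longrightarrow> continuous_on (c ` U) (inv_into U c)"
  using chart_homeo unfolding homeomorphism_def by auto

lemma chart_open_image: "(U, c) \<in> \<A> \<Longrightarrow> open T \<Longrightarrow> open (c ` (U \<inter> T))"
proof -
  assume A: "(U, c) \<in> \<A>" "open T"
  have "c ` (U \<inter> T) = c ` U \<inter> inv_into U c -` T"
    using chart_inv[OF A(1)] chart_inv'[of _ c U] chart_inv_in[of _ c U] by (auto simp: image_iff)
  then show ?thesis
    using continuous_open_preimage[OF chart_inv_continuous chart_image_open] A by metis
qed

lemma chart_cover: "\<exists>U c. (U, c) \<in> \<A> \<and> p \<in> U"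
proof -
  have "p \<in> (\<Union>C\<in>\<A>. fst C)" using lie unfolding lie_group_def smooth_atlas_def by blast
  then show ?thesis by auto
qed

lemma continuous_add: "continuous_on UNIV (\<lambda>p. fst p + snd p :: 'g)"
  using lie unfolding lie_group_def smooth_map_def by (simp add: case_prod_unfold)

lemma continuous_on_add_grp:
  fixes f g :: "'x::topological_space \<Rightarrow> 'g"
  assumes "continuous_on S f" "continuous_on S g"
  shows "continuous_on S (\<lambda>x. f x + g x)"
  using continuous_on_compose2[OF continuous_add continuous_on_Pair[OF assms]] by simp

lemma tendsto_add_grp:
  fixes a b :: 'g
  assumes "(f \<longlongrightarrow> a) F" "(g \<longlongrightarrow> b) F"
  shows "((\<lambda>x. f x + g x) \<longlongrightarrow> a + b) F"
proof -
  have "isCont (\<lambda>p. fst p + snd p :: 'g) (a, b)"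
    using continuous_add continuous_on_eq_continuous_at[of UNIV] by blast
  from isCont_tendsto_compose[OF this tendsto_Pair[OF assms]] show ?thesis by simp
qed

lemma product_domain_open:
  assumes "(U1, c1) \<in> \<A>" "(U2, c2) \<in> \<A>" "open T"
  shows "open {p. fst p \<in> c1 ` U1 \<and> snd p \<in> c2 ` U2 \<and> inv_into U1 c1 (fst p) + inv_into U2 c2 (snd p) \<in> T}"
proof -
  let ?S = "c1 ` U1 \<times> c2 ` U2"
  have S: "open ?S" using assms chart_image_open by (simp add: open_Times)
  have "continuous_on ?S (\<lambda>p. inv_into U1 c1 (fst p) + inv_into U2 c2 (snd p))"
    by (intro continuous_on_add_grp continuous_on_compose2[OF chart_inv_continuous[OF assms(1)]]
        continuous_on_compose2[OF chart_inv_continuous[OF assms(2)]] continuous_intros) auto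
  then have "open (?S \<inter> (\<lambda>p. inv_into U1 c1 (fst p) + inv_into U2 c2 (snd p)) -` T)"
    using continuous_open_preimage S assms(3) by blast
  moreover have "?S \<inter> (\<lambda>p. inv_into U1 c1 (fst p) + inv_into U2 c2 (snd p)) -` T =
    {p. fst p \<in> c1 ` U1 \<and> snd p \<in> c2 ` U2 \<and> inv_into U1 c1 (fst p) + inv_into U2 c2 (snd p) \<in> T}"
    by (auto simp: mem_Times_iff)
  ultimately show ?thesis by simp
qed

lemma product_smooth:
  assumes A: "(U1, c1) \<in> \<A>" "(U2, c2) \<in> \<A>" "(U3, c3) \<in> \<A>"
  shows "smooth_on {p. fst p \<in> c1 ` U1 \<and> snd p \<in> c2 ` U2 \<and>
      inv_into U1 c1 (fst p) + inv_into U2 c2 (snd p) \<in> U3}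
    (\<lambda>p. c3 (inv_into U1 c1 (fst p) + inv_into U2 c2 (snd p)))" (is "smooth_on ?D ?f")
proof -
  let ?c = "map_prod c1 c2" and ?U = "U1 \<times> U2"
  have "(?U, ?c) \<in> prod_atlas \<A> \<A>"
    using A unfolding prod_atlas_def by blast
  then have "smooth_on (?c ` (?U \<inter> (\<lambda>(x, y). x + y) -` U3)) (c3 \<circ> (\<lambda>(x, y). x + y) \<circ> inv_into ?U ?c)"
    using lie A(3) unfolding lie_group_def smooth_map_def by blast
  moreover have inv: "inv_into ?U ?c (y, z) = (inv_into U1 c1 y, inv_into U2 c2 z)"
    if "y \<in> c1 ` U1" "z \<in> c2 ` U2" for y z
  proof (rule inv_into_f_eq)
    show "inj_on ?c ?U"
      using chart_inv[OF A(1)] chart_inv[OF A(2)]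
      by (auto simp: inj_on_def) metis+
  qed (use that chart_inv' chart_inv_in in auto)
  moreover have "?c ` (?U \<inter> (\<lambda>(x, y). x + y) -` U3) = ?D"
  proof (intro equalityI subsetI)
    fix p assume "p \<in> ?D"
    then show "p \<in> ?c ` (?U \<inter> (\<lambda>(x, y). x + y) -` U3)"
      using chart_inv[OF A(1)] chart_inv[OF A(2)]
      by (intro image_eqI[of _ _ "(inv_into U1 c1 (fst p), inv_into U2 c2 (snd p))"])
         (auto simp: prod_eq_iff)
  qed (use chart_inv[OF A(1)] chart_inv[OF A(2)] in auto)
  ultimately have "smooth_on ?D (c3 \<circ> (\<lambda>(x, y). x + y) \<circ> inv_into ?U ?c)"
    by simp
  then show ?thesis
    by (rule smooth_on_cong[rotated 2])
       (use inv in \<open>auto intro!: product_domain_open A chart_open\<close>)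
qed

end

locale lie_chart = lie_grp \<A>
  for \<A> :: "('g::{t2_space, second_countable_topology, group_add}, 'e::euclidean_space) atlas" +
  fixes U :: "'g set" and c :: "'g \<Rightarrow> 'e"
  assumes chart0: "(U, c) \<in> \<A>" and zero_in: "0 \<in> U"
begin

definition ci :: "'e \<Rightarrow> 'g" where "ci = inv_into U c"

text \<open>The group law read in the chart; \<open>D\<close> is its domain, open and containing
  both axes through \<open>c 0\<close>.\<close>

definition mt :: "'e \<times> 'e \<Rightarrow> 'e" where "mt p = c (ci (fst p) + ci (snd p))"

definition D :: "('e \<times> 'e) set" where
  "D = {p. fst p \<in> c ` U \<and> snd p \<in> c ` U \<and> ci (fst p) + ci (snd p) \<in> U}"

lemma U_open: "open U" and cU_open: "open (c ` U)"
  using chart0 chart_open chart_image_open by auto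

lemma ci_c [simp]: "x \<in> U \<Longrightarrow> ci (c x) = x"
  and c_ci [simp]: "y \<in> c ` U \<Longrightarrow> c (ci y) = y"
  and ci_in: "y \<in> c ` U \<Longrightarrow> ci y \<in> U"
  using chart_inv[OF chart0] chart_inv' chart_inv_in by (auto simp: ci_def)

lemma ci_c0 [simp]: "ci (c 0) = 0" by (simp add: zero_in)

lemma c_inj: "x \<in> U \<Longrightarrow> y \<in> U \<Longrightarrow> c x = c y \<Longrightarrow> x = y"
  by (metis ci_c)

lemma c_cont: "continuous_on U c" and ci_cont: "continuous_on (c ` U) ci"
  using chart_continuous[OF chart0] chart_inv_continuous[OF chart0] by (auto simp: ci_def)

lemma ci_isCont: "y \<in> c ` U \<Longrightarrow> isCont ci y"
  using ci_cont cU_open continuous_on_eq_continuous_at by blast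

lemma D_open: "open D"
  unfolding D_def ci_def using product_domain_open[OF chart0 chart0 U_open] .

lemma mt_smooth: "smooth_on D mt"
  unfolding D_def ci_def mt_def using product_smooth[OF chart0 chart0 chart0] by simp

lemma mt_c: "x \<in> U \<Longrightarrow> y \<in> U \<Longrightarrow> mt (c x, c y) = c (x + y)"
  by (simp add: mt_def)

lemma mt_in: "p \<in> D \<Longrightarrow> mt p \<in> c ` U"
  by (auto simp: mt_def D_def)

lemma ci_mt: "p \<in> D \<Longrightarrow> ci (mt p) = ci (fst p) + ci (snd p)"
  by (auto simp: mt_def D_def)

lemma in_D_0: "y \<in> c ` U \<Longrightarrow> (y, c 0) \<in> D" "y \<in> c ` U \<Longrightarrow> (c 0, y) \<in> D"
  using zero_in by (auto simp: D_def)

lemma mt_0: "y \<in> c ` U \<Longrightarrow> mt (y, c 0) = y" "y \<in> c ` U \<Longrightarrow> mt (c 0, y) = y"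
  by (auto simp: mt_def)

section \<open>The derivative of the group law and velocities of curves at the identity\<close>

abbreviation Dmt :: "'e \<times> 'e \<Rightarrow> 'e \<times> 'e \<Rightarrow> 'e" where
  "Dmt p \<equiv> frechet_derivative mt (at p)"

lemma Dmt: "p \<in> D \<Longrightarrow> (mt has_derivative Dmt p) (at p)"
  using mt_smooth by (rule smooth_on_has_derivative)

text \<open>Along each axis \<open>mt\<close> is the identity because the other factor is neutral;
  linearity adds the two partial derivatives.\<close>

lemma Dmt_0: "Dmt (c 0, c 0) = (\<lambda>(h, k). h + k)"
proof -
  have o: "c 0 \<in> c ` U" using zero_in by blast
  let ?L = "Dmt (c 0, c 0)"
  have L: "(mt has_derivative ?L) (at (c 0, c 0))" using in_D_0(1)[OF o] by (rule Dmt)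
  then interpret L: bounded_linear ?L by (rule has_derivative_bounded_linear)
  have "((\<lambda>y. mt (y, c 0)) has_derivative (\<lambda>h. ?L (h, 0))) (at (c 0))"
    by (rule has_derivative_compose[of "\<lambda>y. (y, c 0)" _ _ _ mt, OF _ L])
       (intro has_derivative_Pair has_derivative_ident has_derivative_const)
  moreover have "((\<lambda>y. mt (y, c 0)) has_derivative (\<lambda>h. h)) (at (c 0))"
    by (rule has_derivative_transform_within_open[OF has_derivative_ident cU_open o])
       (simp add: mt_0)
  ultimately have 1: "?L (h, 0) = h" for h
    using has_derivative_unique by metis
  have "((\<lambda>y. mt (c 0, y)) has_derivative (\<lambda>h. ?L (0, h))) (at (c 0))"
    by (rule has_derivative_compose[of "\<lambda>y. (c 0, y)" _ _ _ mt, OF _ L])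
       (intro has_derivative_Pair has_derivative_ident has_derivative_const)
  moreover have "((\<lambda>y. mt (c 0, y)) has_derivative (\<lambda>h. h)) (at (c 0))"
    by (rule has_derivative_transform_within_open[OF has_derivative_ident cU_open o])
       (simp add: mt_0)
  ultimately have 2: "?L (0, h) = h" for h
    using has_derivative_unique by metis
  have "?L (h, k) = ?L (h, 0) + ?L (0, k)" for h k
    by (simp flip: L.add)
  then show ?thesis using 1 2 by auto
qed

text \<open>
  The values of \<open>c\<close> outside \<open>U\<close> are arbitrary, so differentiability of \<open>c \<circ> f\<close> does not imply the
  limit condition.
\<close>

definition tang :: "('x::real_normed_vector \<Rightarrow> 'g) \<Rightarrow> ('x \<Rightarrow> 'e) \<Rightarrow> 'x \<Rightarrow> 'x set \<Rightarrow> bool" where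
  "tang f f' x S \<longleftrightarrow> f x = 0 \<and> x \<in> S \<and> (f \<longlongrightarrow> 0) (at x within S) \<and>
     ((\<lambda>y. c (f y)) has_derivative f') (at x within S)"

lemma tang_eventually: "tang f f' x S \<Longrightarrow> \<forall>\<^sub>F y in at x within S. f y \<in> U"
  unfolding tang_def using U_open zero_in topological_tendstoD by blast

lemma tang_0: "x \<in> S \<Longrightarrow> tang (\<lambda>_. 0) (\<lambda>_. 0) x S"
  by (simp add: tang_def)

text \<open>Velocities at the identity add under the product, by \<open>Dmt_0\<close>. The
  additivity of \<open>hdiff\<close>, that of the exponential map on V, and the derivative of
  products of rays all come from here.\<close>

lemma tang_add:
  assumes "tang f f' x S" "tang g g' x S"
  shows "tang (\<lambda>y. f y + g y) (\<lambda>h. f' h + g' h) x S"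
proof -
  have lim: "((\<lambda>y. f y + g y) \<longlongrightarrow> 0 + 0) (at x within S)"
    using assms by (intro tendsto_add_grp) (auto simp: tang_def)
  have o: "c 0 \<in> c ` U" using zero_in by blast
  have p: "((\<lambda>y. (c (f y), c (g y))) has_derivative (\<lambda>h. (f' h, g' h))) (at x within S)"
    using assms by (intro has_derivative_Pair) (auto simp: tang_def)
  have "(mt has_derivative (\<lambda>(h, k). h + k)) (at (c (f x), c (g x)))"
    using Dmt[OF in_D_0(1)[OF o]] assms by (simp add: Dmt_0 tang_def)
  from has_derivative_compose[OF p this]
  have "((\<lambda>y. mt (c (f y), c (g y))) has_derivative (\<lambda>h. f' h + g' h)) (at x within S)"
    by simp
  then have "((\<lambda>y. c (f y + g y)) has_derivative (\<lambda>h. f' h + g' h)) (at x within S)"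
  proof (rule has_derivative_transform_eventually)
    show "\<forall>\<^sub>F y in at x within S. mt (c (f y), c (g y)) = c (f y + g y)"
      using tang_eventually[OF assms(1)] tang_eventually[OF assms(2)]
      by eventually_elim (rule mt_c)
  qed (use assms zero_in in \<open>auto simp: tang_def mt_c\<close>)
  then show ?thesis using assms lim by (simp add: tang_def)
qed

lemma tang_compose:
  assumes "tang f f' y UNIV" "(\<sigma> has_derivative \<sigma>') (at x within S)" "\<sigma> x = y" "x \<in> S"
  shows "tang (\<lambda>z. f (\<sigma> z)) (\<lambda>h. f' (\<sigma>' h)) x S"
proof -
  have "isCont f y"
    using assms(1) by (simp add: tang_def isCont_def)
  moreover have "(\<sigma> \<longlongrightarrow> y) (at x within S)"
    using has_derivative_continuous[OF assms(2)] assms(3) by (simp add: continuous_within)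
  ultimately have "((\<lambda>z. f (\<sigma> z)) \<longlongrightarrow> f y) (at x within S)"
    by (rule isCont_tendsto_compose)
  then show ?thesis
    using assms has_derivative_compose[OF assms(2), of "\<lambda>y. c (f y)" f']
    by (simp add: tang_def)
qed

lemma tang_mono: "tang f f' x T \<Longrightarrow> S \<subseteq> T \<Longrightarrow> x \<in> S \<Longrightarrow> tang f f' x S"
  unfolding tang_def by (auto intro: tendsto_within_subset has_derivative_subset)

lemma tang_cong:
  assumes "tang f f' x S" "\<And>y. y \<in> S \<Longrightarrow> f y = g y"
  shows "tang g f' x S"
proof -
  have ev: "\<forall>\<^sub>F y in at x within S. f y = g y"
    using assms(2) by (simp add: eventually_at_filter)
  have "x \<in> S" "f x = g x" using assms by (auto simp: tang_def)
  moreover have "(g \<longlongrightarrow> 0) (at x within S)"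
    using assms(1) ev by (auto simp: tang_def elim: Lim_transform_eventually)
  moreover have "((\<lambda>y. c (g y)) has_derivative f') (at x within S)"
    by (rule has_derivative_transform_eventually[of "\<lambda>y. c (f y)"])
       (use assms ev in \<open>auto simp: tang_def elim: eventually_mono\<close>)
  ultimately show ?thesis using assms by (simp add: tang_def)
qed

abbreviation vtang :: "(real \<Rightarrow> 'g) \<Rightarrow> 'e \<Rightarrow> real set \<Rightarrow> bool" where
  "vtang f u \<equiv> tang f (\<lambda>h. h *\<^sub>R u) 0"

text \<open>Stated one-sidedly because the curves \<open>\<delta> r x\<close> are available only for
  r > 0.\<close>

lemma vtang_unique:
  assumes "vtang f u {0..}" "vtang f w {0..}"
  shows "u = w"
proof -
  have "(\<lambda>h. h *\<^sub>R u) = (\<lambda>h. h *\<^sub>R w)"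
  proof (rule frechet_derivative_unique_within)
    show "((\<lambda>y. c (f y)) has_derivative (\<lambda>h. h *\<^sub>R u)) (at 0 within {0..})"
      "((\<lambda>y. c (f y)) has_derivative (\<lambda>h. h *\<^sub>R w)) (at 0 within {0..})"
      using assms by (auto simp: tang_def)
    show "\<exists>d. 0 < \<bar>d\<bar> \<and> \<bar>d\<bar> < e \<and> 0 + d *\<^sub>R i \<in> {0..}" if "i \<in> Basis" "e > 0" for i e :: real
      using that by (intro exI[of _ "e / 2"]) auto
  qed
  from fun_cong[OF this, of 1] show ?thesis by simp
qed

lemma vtang_lim:
  assumes "vtang f u {0..}"
  shows "((\<lambda>r. (1 / r) *\<^sub>R (c (f r) - c 0)) \<longlongrightarrow> u) (at_right 0)"
proof -
  have f: "((\<lambda>r. c (f r)) has_derivative (\<lambda>h. h *\<^sub>R u)) (at 0 within {0<..})" "f 0 = 0"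
    using assms by (auto simp: tang_def intro: has_derivative_subset)
  then have "((\<lambda>r. (c (f r) - c 0 - r *\<^sub>R u) /\<^sub>R norm r + u) \<longlongrightarrow> 0 + u) (at_right 0)"
    by (intro tendsto_add tendsto_const) (simp add: has_derivative_at_within)
  moreover have "\<forall>\<^sub>F r in at_right 0. (c (f r) - c 0 - r *\<^sub>R u) /\<^sub>R norm r + u = (1 / r) *\<^sub>R (c (f r) - c 0)"
    by (auto simp: eventually_at_filter algebra_simps divide_inverse)
  ultimately show ?thesis
    using Lim_transform_eventually by force
qed

section \<open>One-parameter subgroups\<close>

text \<open>In the chart, \<open>invfield u\<close> is the left-invariant vector field with value \<open>u\<close> at the identity.\<close>

definition invfield :: "'e \<Rightarrow> 'e \<Rightarrow> 'e" where
  "invfield u y = Dmt (y, c 0) (0, u)"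

lemma invfield_smooth: "smooth_on (c ` U) (invfield u)"
  unfolding invfield_def
proof (rule smooth_on_compose[OF cU_open _ smooth_on_frechet_derivative[OF mt_smooth], of "\<lambda>y. (y, c 0)"])
  show "smooth_on (c ` U) (\<lambda>y. (y, c 0))"
    by (intro smooth_on_Pair cU_open smooth_on_bounded_linear[OF bounded_linear_ident] smooth_on_const)
qed (use in_D_0 in blast)

lemma invfield_lipschitz_near:
  assumes "p \<in> c ` U"
  obtains r K where "r > 0" "K \<ge> 0" "cball p r \<subseteq> c ` U"
    "\<And>y z. y \<in> cball p r \<Longrightarrow> z \<in> cball p r \<Longrightarrow>
      norm (invfield u y - invfield u z) \<le> K * norm (y - z)"
  using Ck_on_1_lipschitz_near[OF cU_open _ assms, of "invfield u"] invfield_smooth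
  unfolding smooth_on_def by metis

lemma Dmt_snd_compose:
  assumes "p \<in> c ` U" "(f has_vector_derivative v) (at t)" "f t = y" "(p, y) \<in> D"
  shows "((\<lambda>s. mt (p, f s)) has_vector_derivative Dmt (p, y) (0, v)) (at t)"
proof -
  have "((\<lambda>s. (p, f s)) has_derivative (\<lambda>h. (0, h *\<^sub>R v))) (at t)"
    using assms(2) by (intro has_derivative_Pair) (auto simp: has_vector_derivative_def)
  moreover have "(mt has_derivative Dmt (p, y)) (at (p, f t))"
    using Dmt[OF assms(4)] assms(3) by simp
  ultimately have "((\<lambda>s. mt (p, f s)) has_derivative (\<lambda>h. Dmt (p, y) (0, h *\<^sub>R v))) (at t)"
    by (rule has_derivative_compose)
  moreover have "Dmt (p, y) (0, h *\<^sub>R v) = h *\<^sub>R Dmt (p, y) (0, v)" for h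
    using linear_scale[OF has_derivative_linear[OF Dmt[OF assms(4)]], of h "(0, v)"] by simp
  ultimately show ?thesis by (simp add: has_vector_derivative_def)
qed

text \<open>The chain rule applied to the associativity \<open>mt (x, mt (y, h)) = mt (mt (x, y), h)\<close>.\<close>

lemma invfield_left_invariant:
  assumes "(x, y) \<in> D"
  shows "Dmt (x, y) (0, invfield u y) = invfield u (mt (x, y))"
proof -
  have xy: "x \<in> c ` U" "y \<in> c ` U" "mt (x, y) \<in> c ` U"
    using assms mt_in by (auto simp: D_def)
  let ?l = "\<lambda>s::real. c 0 + s *\<^sub>R u"
  have l: "(?l has_vector_derivative u) (at 0)"
    by (auto intro!: derivative_eq_intros)
  have 1: "((\<lambda>s. mt (y, ?l s)) has_vector_derivative invfield u y) (at 0)"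
    unfolding invfield_def using xy in_D_0 by (intro Dmt_snd_compose[OF _ l]) auto
  have 2: "((\<lambda>s. mt (x, mt (y, ?l s))) has_vector_derivative Dmt (x, y) (0, invfield u y)) (at 0)"
    using xy assms by (intro Dmt_snd_compose[OF _ 1]) (auto simp: mt_0)
  have 3: "((\<lambda>s. mt (mt (x, y), ?l s)) has_vector_derivative invfield u (mt (x, y))) (at 0)"
    unfolding invfield_def using xy in_D_0 by (intro Dmt_snd_compose[OF _ l]) auto
  have c1: "((\<lambda>s. (y, ?l s)) \<longlongrightarrow> (y, ?l 0)) (at 0)"
    by (intro tendsto_intros)
  have c2: "((\<lambda>s. (x, mt (y, ?l s))) \<longlongrightarrow> (x, mt (y, ?l 0))) (at 0)"
    using has_vector_derivative_continuous[OF 1]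
    by (intro tendsto_intros) (simp add: isCont_def)
  have "\<forall>\<^sub>F s in at 0. (y, ?l s) \<in> D"
    by (rule topological_tendstoD[OF c1 D_open]) (use xy in_D_0 in simp)
  moreover have "\<forall>\<^sub>F s in at 0. (x, mt (y, ?l s)) \<in> D"
    by (rule topological_tendstoD[OF c2 D_open]) (use xy assms mt_0 in simp)
  ultimately have ev: "\<forall>\<^sub>F s in at 0. mt (x, mt (y, ?l s)) = mt (mt (x, y), ?l s)"
  proof eventually_elim
    case (elim s)
    have "mt (x, mt (y, ?l s)) = c (ci x + (ci y + ci (?l s)))"
      using ci_mt[OF elim(1)] by (simp add: mt_def)
    also have "\<dots> = mt (mt (x, y), ?l s)"
      using ci_mt[OF assms] by (simp add: mt_def add.assoc)
    finally show ?case .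
  qed
  have "((\<lambda>s. mt (mt (x, y), ?l s)) has_vector_derivative Dmt (x, y) (0, invfield u y)) (at 0)"
    unfolding has_vector_derivative_def
    by (rule has_derivative_transform_eventually[OF 2[unfolded has_vector_derivative_def] ev])
       (use xy in \<open>auto simp: mt_0\<close>)
  then show ?thesis
    using 3 vector_derivative_unique_at by blast
qed

text \<open>Differentiate \<open>\<gamma> (t + h) = \<gamma> t + \<gamma> h\<close> in h at 0: the
  first factor is fixed, and the partial derivative of \<open>mt\<close> in the second is
  \<open>invfield\<close>.\<close>

lemma one_parameter_ode:
  assumes hom: "\<And>s t. \<gamma> (s + t) = \<gamma> s + \<gamma> t" and "vtang \<gamma> u UNIV" "\<gamma> t \<in> U"
  shows "((\<lambda>t. c (\<gamma> t)) has_vector_derivative invfield u (c (\<gamma> t))) (at t)"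
proof -
  have g: "\<gamma> 0 = 0" "((\<lambda>t. c (\<gamma> t)) has_vector_derivative u) (at 0)"
    using assms(2) by (auto simp: tang_def has_vector_derivative_def)
  have ct: "c (\<gamma> t) \<in> c ` U" using assms(3) by blast
  have 1: "((\<lambda>h. mt (c (\<gamma> t), c (\<gamma> h))) has_vector_derivative invfield u (c (\<gamma> t))) (at 0)"
    unfolding invfield_def using g ct in_D_0 by (intro Dmt_snd_compose) auto
  have "\<forall>\<^sub>F h in at 0. \<gamma> h \<in> U" using tang_eventually[OF assms(2)] by simp
  then have 2: "\<forall>\<^sub>F h in at 0. mt (c (\<gamma> t), c (\<gamma> h)) = c (\<gamma> (t + h))"
    by eventually_elim (simp add: mt_c assms(3) hom)
  have "((\<lambda>h. c (\<gamma> (t + h))) has_vector_derivative invfield u (c (\<gamma> t))) (at 0)"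
    unfolding has_vector_derivative_def
    by (rule has_derivative_transform_eventually[OF 1[unfolded has_vector_derivative_def] 2])
       (use g ct in \<open>auto simp: mt_0\<close>)
  then show ?thesis
    using has_vector_derivative_shift[of "\<lambda>h. c (\<gamma> (t + h))" _ "- t" t] by simp
qed

text \<open>Both curves solve the same differential equation, hence agree for small t; repeated
  doubling spreads this to all t.\<close>

lemma one_parameter_unique:
  assumes hom: "\<And>s t. \<gamma> (s + t) = \<gamma> s + \<gamma> t" "\<And>s t. \<eta> (s + t) = \<eta> s + \<eta> t"
    and tan: "vtang \<gamma> u UNIV" "vtang \<eta> u UNIV"
  shows "\<gamma> = \<eta>"
proof
  fix t
  have o: "c 0 \<in> c ` U" using zero_in by blast
  obtain r K where rK: "r > 0" "K \<ge> 0" "cball (c 0) r \<subseteq> c ` U"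
    and lip: "\<And>y z. y \<in> cball (c 0) r \<Longrightarrow> z \<in> cball (c 0) r \<Longrightarrow>
      norm (invfield u y - invfield u z) \<le> K * norm (y - z)"
    using invfield_lipschitz_near[OF o, of u] by metis
  let ?N = "ci ` ball (c 0) r"
  have near: "\<exists>d>0. \<forall>t. \<bar>t\<bar> < d \<longrightarrow> g t \<in> U \<and> c (g t) \<in> ball (c 0) r" if "vtang g u UNIV" for g
  proof -
    have "isCont (\<lambda>t. c (g t)) 0" "g 0 = 0"
      using that has_derivative_continuous by (auto simp: tang_def)
    then have "\<forall>\<^sub>F t in at 0. c (g t) \<in> ball (c 0) r"
      using rK(1) by (intro topological_tendstoD[of _ "c (g 0)"]) (auto simp: isCont_def)
    with tang_eventually[OF that] have "\<forall>\<^sub>F t in at 0. g t \<in> U \<and> c (g t) \<in> ball (c 0) r"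
      by eventually_elim auto
    then obtain d where "d > 0" "\<And>t. t \<noteq> 0 \<Longrightarrow> dist t 0 < d \<Longrightarrow> g t \<in> U \<and> c (g t) \<in> ball (c 0) r"
      unfolding eventually_at by auto
    then have "g t \<in> U \<and> c (g t) \<in> ball (c 0) r" if "\<bar>t\<bar> < d" for t
      using \<open>g 0 = 0\<close> zero_in rK(1) that by (cases "t = 0") (auto simp: dist_norm)
    with \<open>d > 0\<close> show ?thesis by blast
  qed
  obtain d1 d2 where d: "d1 > 0" "d2 > 0"
    "\<And>t. \<bar>t\<bar> < d1 \<Longrightarrow> \<gamma> t \<in> U \<and> c (\<gamma> t) \<in> ball (c 0) r"
    "\<And>t. \<bar>t\<bar> < d2 \<Longrightarrow> \<eta> t \<in> U \<and> c (\<eta> t) \<in> ball (c 0) r"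
    using near[OF tan(1)] near[OF tan(2)] by metis
  define a where "a = min (min d1 d2 / 2) (1 / (K + 1))"
  have a0: "a > 0" "a < d1" "a < d2"
    using d(1,2) rK(2) by (auto simp: a_def min_def)
  have "a \<le> 1 / (K + 1)" by (simp add: a_def)
  then have "a * (K + 1) \<le> 1"
    using rK(2) by (simp add: pos_le_divide_eq)
  with a0 have a: "a > 0" "K * a < 1" "a < d1" "a < d2"
    by (auto simp: algebra_simps)
  have eq: "\<gamma> t = \<eta> t" if "\<bar>t\<bar> \<le> a" for t
  proof -
    have "c (\<gamma> t) = c (\<eta> t)"
    proof (rule ode_unique[OF a(1,2) rK(2) lip, where y = "\<lambda>t. c (\<gamma> t)" and z = "\<lambda>t. c (\<eta> t)"])
      fix t assume "\<bar>t\<bar> \<le> a"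
      then have *: "\<gamma> t \<in> U \<and> c (\<gamma> t) \<in> ball (c 0) r" "\<eta> t \<in> U \<and> c (\<eta> t) \<in> ball (c 0) r"
        using d a by auto
      show "((\<lambda>t. c (\<gamma> t)) has_vector_derivative invfield u (c (\<gamma> t))) (at t)"
        "((\<lambda>t. c (\<eta> t)) has_vector_derivative invfield u (c (\<eta> t))) (at t)"
        using * hom tan by (auto intro!: one_parameter_ode)
      show "c (\<gamma> t) \<in> cball (c 0) r" "c (\<eta> t) \<in> cball (c 0) r"
        using * by auto
    qed (use that tan in \<open>auto simp: tang_def\<close>)
    then show ?thesis
      using d(3)[OF le_less_trans[OF that a(3)]] d(4)[OF le_less_trans[OF that a(4)]] c_inj by blast
  qed
  obtain n where "\<bar>t\<bar> / a < 2 ^ n"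
    using real_arch_pow[of 2 "\<bar>t\<bar> / a"] by auto
  then have "\<bar>t / 2 ^ n\<bar> \<le> a"
    using a(1) by (simp add: field_simps)
  then show "\<gamma> t = \<eta> t"
    using add_hom_dbl[OF hom(1), of t n] add_hom_dbl[OF hom(2), of t n] eq by simp
qed

text \<open>Near any t0 the curve is the left translate by \<open>\<gamma> t0\<close> of its piece
  around 0, so continuity and smoothness are carried along by the group law, into any chart of the
  atlas.\<close>

lemma one_parameter_smooth:
  assumes hom: "\<And>s t. \<gamma> (s + t) = \<gamma> s + \<gamma> t" and a: "a > 0"
    and U: "\<And>t. \<bar>t\<bar> < a \<Longrightarrow> \<gamma> t \<in> U" and smooth: "smooth_on {-a<..<a} (\<lambda>t. c (\<gamma> t))"
  shows "one_parameter_subgroup \<A> \<gamma>"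
proof -
  have shift: "\<gamma> t = \<gamma> t0 + \<gamma> (t - t0)" for t t0
    by (simp flip: hom)
  have "continuous_on {-a<..<a} (\<lambda>t. ci (c (\<gamma> t)))"
    by (rule continuous_on_compose2[OF ci_cont smooth_on_continuous_on[OF smooth]]) (use U in auto)
  then have cont0: "continuous_on {-a<..<a} \<gamma>"
    by (rule continuous_on_eq) (use U in auto)
  have "isCont \<gamma> t0" for t0
  proof -
    have "isCont \<gamma> 0"
      using cont0 a by (simp add: continuous_on_eq_continuous_at)
    then have "((\<lambda>t. \<gamma> (t - t0)) \<longlongrightarrow> \<gamma> 0) (at t0)"
      by (rule isCont_tendsto_compose) (auto intro!: tendsto_eq_intros)
    then have "((\<lambda>t. \<gamma> t0 + \<gamma> (t - t0)) \<longlongrightarrow> \<gamma> t0 + \<gamma> 0) (at t0)"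
      by (intro tendsto_add_grp tendsto_const)
    then show ?thesis
      by (simp add: isCont_def flip: hom)
  qed
  then have cont: "continuous_on UNIV \<gamma>" by (simp add: continuous_at_imp_continuous_on)
  have "smooth_on (\<gamma> -` V) (\<lambda>t. k (\<gamma> t))" if V: "(V, k) \<in> \<A>" for V k
  proof (rule smooth_on_local)
    fix t0 assume t0: "t0 \<in> \<gamma> -` V"
    let ?T = "{t0 - a<..<t0 + a} \<inter> \<gamma> -` V"
    have T: "open ?T"
      using chart_open[OF V] cont by (intro open_Int open_vimage) auto
    let ?P = "{p. fst p \<in> k ` V \<and> snd p \<in> c ` U \<and> inv_into V k (fst p) + inv_into U c (snd p) \<in> V}"
    have sh: "smooth_on ?T (\<lambda>t. c (\<gamma> (t - t0)))"
    proof (rule smooth_on_compose[OF T _ smooth])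
      show "smooth_on ?T (\<lambda>t. t - t0)"
        using Ck_on_add[OF T Ck_on_bounded_linear[OF bounded_linear_ident] Ck_on_const[of _ _ "- t0"]]
        by (simp add: smooth_on_def)
    qed auto
    have "smooth_on ?T (\<lambda>t. k (inv_into V k (fst (k (\<gamma> t0), c (\<gamma> (t - t0)))) +
        inv_into U c (snd (k (\<gamma> t0), c (\<gamma> (t - t0))))))"
    proof (rule smooth_on_compose[OF T _ product_smooth[OF V chart0 V]])
      show "(\<lambda>t. (k (\<gamma> t0), c (\<gamma> (t - t0)))) ` ?T \<subseteq> ?P"
        using t0 U chart_inv[OF V] chart_inv[OF chart0] by (auto simp flip: hom simp: abs_less_iff)
    qed (intro smooth_on_Pair T smooth_on_const sh)
    then have "smooth_on ?T (\<lambda>t. k (\<gamma> t))"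
      by (rule smooth_on_cong[OF T, rotated])
         (use t0 U chart_inv[OF V] chart_inv[OF chart0] in \<open>auto simp flip: hom simp: abs_less_iff\<close>)
    then show "\<exists>T. open T \<and> t0 \<in> T \<and> smooth_on T (\<lambda>t. k (\<gamma> t))"
      using T t0 a by (intro exI[of _ ?T]) auto
  qed
  moreover have "inv_into UNIV id = (id :: real \<Rightarrow> real)"
    by (rule ext) (simp add: inv_into_f_eq)
  ultimately have "smooth_map eucl_atlas \<A> \<gamma>"
    using cont by (auto simp: smooth_map_def eucl_atlas_def o_def)
  then show ?thesis by (simp add: one_parameter_subgroup_def hom)
qed

text \<open>The integral curve y of \<open>invfield u\<close> through \<open>c 0\<close> is a local
  homomorphism: for fixed s, the translate of y by y(s) and the shifted curve y(s + t) solve the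
  same equation, by left invariance, with the same initial value.\<close>

lemma one_parameter_exists: "\<exists>\<gamma>. one_parameter_subgroup \<A> \<gamma> \<and> vtang \<gamma> u UNIV"
proof -
  have o: "c 0 \<in> c ` U" using zero_in by blast
  obtain r K where rK: "r > 0" "K \<ge> 0" "cball (c 0) r \<subseteq> c ` U"
    and lip: "\<And>y z. y \<in> cball (c 0) r \<Longrightarrow> z \<in> cball (c 0) r \<Longrightarrow>
      norm (invfield u y - invfield u z) \<le> K * norm (y - z)"
    using invfield_lipschitz_near[OF o, of u] by metis
  obtain a y where a: "a > 0" and y0: "y 0 = c 0"
    and y: "\<And>t. \<bar>t\<bar> < a \<Longrightarrow> y t \<in> cball (c 0) r"
    and dy: "\<And>t. \<bar>t\<bar> < a \<Longrightarrow> (y has_vector_derivative invfield u (y t)) (at t)"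
    using picard_lindeloef_local[OF rK(1,2) lip] by metis
  have yU: "y t \<in> c ` U" if "\<bar>t\<bar> < a" for t using y[OF that] rK(3) by blast
  have y_smooth: "smooth_on {-a<..<a} y"
    by (rule ode_smooth[OF invfield_smooth yU dy])
  define \<gamma>0 where "\<gamma>0 t = ci (y t)" for t
  have \<gamma>0: "\<gamma>0 t \<in> U" "c (\<gamma>0 t) = y t" if "\<bar>t\<bar> < a" for t
    using yU[OF that] by (auto simp: \<gamma>0_def ci_in)
  have D00: "(c 0, c 0) \<in> D" using in_D_0 o by blast
  have "isCont mt (c 0, c 0)"
    using Dmt[OF D00] has_derivative_continuous by blast
  moreover have "mt (c 0, c 0) = c 0" using mt_0 o by blast
  ultimately have "\<forall>\<^sub>F p in at (c 0, c 0). p \<in> D \<and> mt p \<in> ball (c 0) r"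
    using topological_tendstoD[of mt "c 0" "at (c 0, c 0)" "ball (c 0) r"] rK(1)
      eventually_at_in_open'[OF D_open D00]
    by (auto simp: isCont_def eventually_conj_iff)
  then obtain d where d: "d > 0" "\<And>p. p \<noteq> (c 0, c 0) \<Longrightarrow> dist p (c 0, c 0) < d \<Longrightarrow> p \<in> D \<and> mt p \<in> ball (c 0) r"
    unfolding eventually_at by auto
  then have d': "p \<in> D \<and> mt p \<in> ball (c 0) r" if "dist p (c 0, c 0) < d" for p
    using that D00 \<open>mt (c 0, c 0) = c 0\<close> rK(1) by (cases "p = (c 0, c 0)") auto
  have "isCont y 0"
    using dy[of 0] a has_vector_derivative_continuous by auto
  then obtain b' where b': "b' > 0" "\<And>t. \<bar>t\<bar> < b' \<Longrightarrow> dist (y t) (c 0) < d / 2"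
    unfolding continuous_at_eps_delta using y0 d(1)
    by (metis dist_real_def diff_zero half_gt_zero)
  \<comment> \<open>Small enough for s + \<tau> to stay in the interval of existence, for y s and y
    \<tau> to have their product in the ball where \<open>invfield u\<close> is Lipschitz, and for K
    b < 1 in \<open>ode_unique\<close>.\<close>
  define b where "b = min (min (a / 2) (b' / 2)) (1 / (K + 1)) / 2"
  have b1: "0 < b" "2 * b < a" "b < b'"
    using a b'(1) rK(2) by (auto simp: b_def min_def)
  have b2: "K * b < 1"
  proof -
    have "b \<le> (1 / (K + 1)) / 2" unfolding b_def by (intro divide_right_mono) auto
    also have "\<dots> < 1 / (K + 1)" using rK(2) by (simp add: divide_strict_left_mono)
    finally have "b < 1 / (K + 1)" .
    then have "b * (K + 1) < 1" using rK(2) by (simp add: pos_less_divide_eq)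
    then show ?thesis using b1 by (simp add: algebra_simps)
  qed
  have loc: "\<gamma>0 (s + t) = \<gamma>0 s + \<gamma>0 t" if "\<bar>s\<bar> < b" "\<bar>t\<bar> < b" for s t
  proof -
    have dd: "(y s, y \<tau>) \<in> D \<and> mt (y s, y \<tau>) \<in> ball (c 0) r" if "\<bar>\<tau>\<bar> \<le> b" for \<tau>
    proof (rule d')
      have "dist (y s, y \<tau>) (c 0, c 0) \<le> dist (y s) (c 0) + dist (y \<tau>) (c 0)"
        by (simp add: dist_Pair_Pair sqrt_sum_squares_le_sum)
      also have "\<dots> < d"
        using b'(2)[of s] b'(2)[of \<tau>] \<open>\<bar>s\<bar> < b\<close> that b1 by simp
      finally show "dist (y s, y \<tau>) (c 0, c 0) < d" .
    qed
    have "mt (y s, y t) = y (s + t)"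
    proof (rule ode_unique[OF b1(1) b2 rK(2) lip, where y = "\<lambda>\<tau>. mt (y s, y \<tau>)" and z = "\<lambda>\<tau>. y (s + \<tau>)"])
      fix \<tau> assume \<tau>: "\<bar>\<tau>\<bar> \<le> b"
      show "mt (y s, y \<tau>) \<in> cball (c 0) r" using dd[OF \<tau>] by auto
      show "y (s + \<tau>) \<in> cball (c 0) r" using \<tau> that b1 by (intro y) auto
      have "((\<lambda>\<tau>. mt (y s, y \<tau>)) has_vector_derivative Dmt (y s, y \<tau>) (0, invfield u (y \<tau>))) (at \<tau>)"
        using dd[OF \<tau>] \<tau> that b1 by (intro Dmt_snd_compose dy yU) auto
      then show "((\<lambda>\<tau>. mt (y s, y \<tau>)) has_vector_derivative invfield u (mt (y s, y \<tau>))) (at \<tau>)"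
        using invfield_left_invariant dd[OF \<tau>] by simp
      have "(y has_vector_derivative invfield u (y (s + \<tau>))) (at (s + \<tau>))"
        using \<tau> that b1 by (intro dy) auto
      then show "((\<lambda>\<tau>. y (s + \<tau>)) has_vector_derivative invfield u (y (s + \<tau>))) (at \<tau>)"
        by (rule has_vector_derivative_shift)
    next
      show "mt (y s, y 0) = y (s + 0)" using y0 yU[of s] that b1 by (simp add: mt_0)
      show "\<bar>t\<bar> \<le> b" using that by simp
    qed
    then show ?thesis
      using dd[of t] that ci_mt[of "(y s, y t)"] by (simp add: \<gamma>0_def)
  qed
  obtain \<gamma> where hom: "\<And>s t. \<gamma> (s + t) = \<gamma> s + \<gamma> t" and ext: "\<And>t. \<bar>t\<bar> < b \<Longrightarrow> \<gamma> t = \<gamma>0 t"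
    using extend_local_hom[OF b1(1), of \<gamma>0] loc by metis
  have c\<gamma>: "\<gamma> t \<in> U" "c (\<gamma> t) = y t" if "\<bar>t\<bar> < b" for t
    using ext[OF that] \<gamma>0[of t] that b1 by auto
  have sm: "smooth_on {-b<..<b} (\<lambda>t. c (\<gamma> t))"
    by (rule smooth_on_cong[of _ y]) (use c\<gamma> b1 in \<open>auto intro: smooth_on_subset[OF y_smooth] simp: abs_less_iff\<close>)
  have one: "one_parameter_subgroup \<A> \<gamma>"
    using one_parameter_smooth[OF hom b1(1) c\<gamma>(1) sm] .
  then have "continuous_on UNIV \<gamma>" by (simp add: one_parameter_subgroup_def smooth_map_def)
  then have "isCont \<gamma> 0" by (simp add: continuous_on_eq_continuous_at)
  moreover have "\<gamma> 0 = 0" using hom[of 0 0] by (metis add.right_neutral add_left_cancel)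
  moreover have "((\<lambda>t. c (\<gamma> t)) has_vector_derivative u) (at 0)"
  proof -
    have "invfield u (c 0) = u" by (simp add: invfield_def Dmt_0)
    then have "(y has_vector_derivative u) (at 0)" using dy[of 0] a y0 by simp
    then show ?thesis
      by (rule has_vector_derivative_transform_within_open[of _ _ _ "{-b<..<b}"])
         (use b1 c\<gamma> in \<open>auto simp: abs_less_iff\<close>)
  qed
  ultimately have "vtang \<gamma> u UNIV"
    by (simp add: tang_def isCont_def has_vector_derivative_def)
  with one show ?thesis by blast
qed

end

section \<open>Left-invariant fields and the exponential map\<close>

lemma inv_into_id [simp]: "inv_into UNIV id = (id :: 'a \<Rightarrow> 'a)"
  by (rule ext) (simp add: inv_into_f_eq)

lemma zero_of_add_hom: "(\<And>s t. \<gamma> (s + t) = \<gamma> s + \<gamma> t) \<Longrightarrow> \<gamma> 0 = 0"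
  for \<gamma> :: "real \<Rightarrow> 'a::group_add"
  by (metis add.right_neutral add_left_cancel)

context lie_chart
begin

lemma C_infinity_chart:
  assumes "f \<in> C_infinity \<A>" "(V, k) \<in> \<A>"
  shows "smooth_on (k ` V) (\<lambda>y. f (inv_into V k y))"
  using assms by (auto simp: C_infinity_def smooth_map_def eucl_atlas_def o_def)

text \<open>The left-invariant field with velocity u at the identity. \<open>LF\<close> turns out to
  be a linear bijection of the model space onto \<open>lie_algebra\<close>, so vectors of the model
  space stand for fields from here on.\<close>

definition LF :: "'e \<Rightarrow> 'g field" where
  "LF u = (\<lambda>f p. if f \<in> C_infinity \<A> then frechet_derivative (\<lambda>y. f (p + ci y)) (at (c 0)) u else 0)"

text \<open>Membership in \<open>C_infinity\<close> gives derivatives of f only through charts, so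
  \<open>p + ci y\<close> is passed through a chart around p before f is applied.\<close>

lemma C_infinity_has_derivative:
  assumes f: "f \<in> C_infinity \<A>"
  shows "((\<lambda>y. f (p + ci y)) has_derivative frechet_derivative (\<lambda>y. f (p + ci y)) (at (c 0))) (at (c 0))"
proof -
  obtain V k where V: "(V, k) \<in> \<A>" "p \<in> V" using chart_cover by blast
  let ?P = "{q. fst q \<in> k ` V \<and> snd q \<in> c ` U \<and> inv_into V k (fst q) + inv_into U c (snd q) \<in> V}"
  have P: "(k p, c 0) \<in> ?P"
    using V zero_in chart_inv[OF V(1)] chart_inv[OF chart0] by auto
  have prod: "((\<lambda>q. k (inv_into V k (fst q) + inv_into U c (snd q))) has_derivative
      frechet_derivative (\<lambda>q. k (inv_into V k (fst q) + inv_into U c (snd q))) (at (k p, c 0)))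
      (at (k p, c 0))" (is "(?m has_derivative ?m') _")
    using smooth_on_has_derivative[OF product_smooth[OF V(1) chart0 V(1)] P] .
  have pair: "((\<lambda>y. (k p, y)) has_derivative (\<lambda>h. (0, h))) (at (c 0))"
    by (intro has_derivative_Pair has_derivative_const has_derivative_ident)
  have 1: "((\<lambda>y. ?m (k p, y)) has_derivative (\<lambda>h. ?m' (0, h))) (at (c 0))"
    by (rule has_derivative_compose[OF pair prod])
  have m0: "?m (k p, c 0) = k p"
    using V chart_inv[OF V(1)] by (simp add: zero_in flip: ci_def)
  let ?f = "\<lambda>y. f (inv_into V k y)"
  have 2: "(?f has_derivative frechet_derivative ?f (at (k p))) (at (?m (k p, c 0)))"
    unfolding m0 using V by (intro smooth_on_has_derivative[OF C_infinity_chart[OF f V(1)]]) auto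
  have "((\<lambda>y. ?f (?m (k p, y))) has_derivative (\<lambda>h. frechet_derivative ?f (at (k p)) (?m' (0, h)))) (at (c 0))"
    by (rule has_derivative_compose[OF 1 2])
  moreover have "\<forall>\<^sub>F y in at (c 0). (k p, y) \<in> ?P"
    by (rule topological_tendstoD[OF _ product_domain_open[OF V(1) chart0 chart_open[OF V(1)]] P])
       (intro tendsto_intros)
  then have "\<forall>\<^sub>F y in at (c 0). ?f (?m (k p, y)) = f (p + ci y)"
    by eventually_elim (use V chart_inv[OF V(1)] in \<open>simp add: ci_def\<close>)
  moreover have "?f (?m (k p, c 0)) = f (p + ci (c 0))"
    unfolding m0 using V chart_inv[OF V(1)] by simp
  ultimately have "((\<lambda>y. f (p + ci y)) has_derivative (\<lambda>h. frechet_derivative ?f (at (k p)) (?m' (0, h)))) (at (c 0))"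
    by (rule has_derivative_transform_eventually) simp
  then have "(\<lambda>y. f (p + ci y)) differentiable at (c 0)"
    by (rule differentiableI)
  then show ?thesis
    by (simp only: frechet_derivative_works)
qed

lemma left_field_eq:
  assumes "vtang \<gamma> u UNIV"
  shows "left_field \<A> \<gamma> = LF u"
proof (intro ext)
  fix f p
  show "left_field \<A> \<gamma> f p = LF u f p"
  proof (cases "f \<in> C_infinity \<A>")
    case True
    let ?F = "\<lambda>y. f (p + ci y)"
    let ?F' = "frechet_derivative ?F (at (c 0))"
    have g: "\<gamma> 0 = 0" "((\<lambda>t. c (\<gamma> t)) has_derivative (\<lambda>h. h *\<^sub>R u)) (at 0)"
      using assms by (auto simp: tang_def)
    have F: "(?F has_derivative ?F') (at (c (\<gamma> 0)))"
      using C_infinity_has_derivative[OF True] g by simp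
    have 1: "((\<lambda>t. ?F (c (\<gamma> t))) has_derivative (\<lambda>h. ?F' (h *\<^sub>R u))) (at 0)"
      by (rule has_derivative_compose[OF g(2) F])
    have "\<forall>\<^sub>F t in at 0. \<gamma> t \<in> U" using tang_eventually[OF assms] by simp
    then have 2: "\<forall>\<^sub>F t in at 0. ?F (c (\<gamma> t)) = f (p + \<gamma> t)"
      by eventually_elim simp
    have "((\<lambda>t. f (p + \<gamma> t)) has_derivative (\<lambda>h. ?F' (h *\<^sub>R u))) (at 0)"
      by (rule has_derivative_transform_eventually[OF 1 2]) (simp_all add: g zero_in)
    moreover have "?F' (h *\<^sub>R u) = ?F' u * h" for h
      using linear_scale[OF has_derivative_linear[OF F], of h u] by (simp add: mult.commute)
    ultimately have "((\<lambda>t. f (p + \<gamma> t)) has_real_derivative ?F' u) (at 0)"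
      by (simp add: has_field_derivative_def mult_commute_abs)
    then show ?thesis
      using True by (simp add: left_field_def LF_def DERIV_imp_deriv)
  qed (simp add: left_field_def LF_def)
qed

lemma LF_add: "LF (u + w) = LF u + LF w"
  and LF_scale: "LF (r *\<^sub>R u) = fscale r (LF u)"
  and LF_0: "LF 0 = 0"
proof -
  have lin: "linear (frechet_derivative (\<lambda>y. f (p + ci y)) (at (c 0)))" if "f \<in> C_infinity \<A>" for f p
    using has_derivative_linear[OF C_infinity_has_derivative[OF that]] .
  show "LF (u + w) = LF u + LF w"
    by (intro ext) (simp add: LF_def linear_add[OF lin])
  show "LF (r *\<^sub>R u) = fscale r (LF u)"
    by (intro ext) (simp add: LF_def fscale_def linear_scale[OF lin])
  show "LF 0 = 0"
    by (intro ext) (simp add: LF_def linear_0[OF lin])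
qed

lemma LF_sum: "LF (\<Sum>i\<in>I. u i) = (\<Sum>i\<in>I. LF (u i))"
  by (induction I rule: infinite_finite_induct) (auto simp: LF_add LF_0)

text \<open>Coordinate functions of the chart, cut off by a bump function, separate tangent vectors at \<open>0\<close>.\<close>

lemma C_infinity_extension:
  assumes "smooth_on UNIV F" "\<And>y. y \<notin> ball (c 0) r \<Longrightarrow> F y = 0" "cball (c 0) r \<subseteq> c ` U"
  shows "(\<lambda>x. if x \<in> U then F (c x) else 0) \<in> C_infinity \<A>" (is "?f \<in> _")
proof -
  \<comment> \<open>Being compact, Q is closed in the Hausdorff group. So the function is given by
    smooth data on U and is 0 on the complement of Q, two open sets that cover the group.\<close>
  define Q where "Q = ci ` cball (c 0) r"
  have "compact Q"
    unfolding Q_def using ci_cont assms(3) by (intro compact_continuous_image) (auto intro: continuous_on_subset)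
  then have Q: "closed Q" by (rule compact_imp_closed)
  have Q0: "?f x = 0" if "x \<notin> Q" for x
  proof (cases "x \<in> U")
    case True
    then have "c x \<notin> cball (c 0) r" using that ci_c[OF True] by (metis Q_def image_eqI)
    then show ?thesis using assms(2) by auto
  qed auto
  have QU: "Q \<subseteq> U" using assms(3) by (auto simp: Q_def ci_in)
  have smooth: "smooth_on (k ` V) (\<lambda>y. ?f (inv_into V k y))" if V: "(V, k) \<in> \<A>" for V k
  proof (rule smooth_on_local)
    fix y assume y: "y \<in> k ` V"
    let ?x = "inv_into V k y"
    show "\<exists>T. open T \<and> y \<in> T \<and> smooth_on T (\<lambda>y. ?f (inv_into V k y))"
    proof (cases "?x \<in> U")
      case True
      let ?T = "k ` (V \<inter> U)"
      have T: "open ?T" using chart_open_image[OF V U_open] .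
      have "smooth_compat (V, k) (U, c)"
        using lie V chart0 unfolding lie_group_def smooth_atlas_def by blast
      then have "smooth_on ?T (c \<circ> inv_into V k)"
        by (simp add: smooth_compat_def)
      then have "smooth_on ?T (\<lambda>y. F (c (inv_into V k y)))"
        using smooth_on_compose[OF T subset_UNIV assms(1)] by (simp add: o_def)
      then have "smooth_on ?T (\<lambda>y. ?f (inv_into V k y))"
        by (rule smooth_on_cong[OF T, rotated]) (use chart_inv[OF V] in auto)
      moreover have "y \<in> ?T"
        using True y chart_inv_in[OF y] chart_inv'[OF y] by (metis IntI image_eqI)
      ultimately show ?thesis using T by blast
    next
      case False
      let ?T = "k ` (V \<inter> - Q)"
      have T: "open ?T" using chart_open_image[OF V] Q by blast
      have "smooth_on ?T (\<lambda>y. ?f (inv_into V k y))"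
      proof (rule smooth_on_cong[OF T _ smooth_on_const[of _ 0]])
        fix z assume "z \<in> ?T"
        then have "inv_into V k z \<notin> Q" using chart_inv[OF V] by auto
        then show "0 = ?f (inv_into V k z)" using Q0 by simp
      qed
      moreover have "y \<in> ?T"
        using False QU y chart_inv_in[OF y] chart_inv'[OF y] by (metis ComplI IntI image_eqI subsetD)
      ultimately show ?thesis using T by blast
    qed
  qed
  have "isCont ?f x" for x
  proof -
    obtain V k where V: "(V, k) \<in> \<A>" "x \<in> V" using chart_cover by blast
    have "continuous_on V (\<lambda>x. ?f (inv_into V k (k x)))"
      by (rule continuous_on_compose2[OF smooth_on_continuous_on[OF smooth[OF V(1)]] chart_continuous[OF V(1)]]) auto
    then have "continuous_on V ?f"
      by (rule continuous_on_eq) (simp add: chart_inv[OF V(1)])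
    then show ?thesis
      using V chart_open[OF V(1)] continuous_on_eq_continuous_at by blast
  qed
  then have "continuous_on UNIV ?f" by (simp add: continuous_at_imp_continuous_on)
  with smooth show ?thesis
    by (auto simp: C_infinity_def smooth_map_def eucl_atlas_def o_def)
qed

lemma LF_inj: "LF u = LF w \<Longrightarrow> u = w"
proof -
  assume eq: "LF u = LF w"
  have "c 0 \<in> c ` U" using zero_in by blast
  then obtain r where r: "r > 0" "cball (c 0) r \<subseteq> c ` U"
    using cU_open open_contains_cball by blast
  obtain \<psi> :: "'e \<Rightarrow> real" where \<psi>: "smooth_on UNIV \<psi>" "\<psi> (c 0) \<noteq> 0" "\<And>y. y \<notin> ball (c 0) r \<Longrightarrow> \<psi> y = 0"
    using smooth_bump_exists[OF r(1)] by metis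
  have "u \<bullet> b = w \<bullet> b" for b
  proof -
    \<comment> \<open>The linear factor vanishes at \<open>c 0\<close>, so the derivative of the
      bump drops out of the product rule there.\<close>
    let ?F = "\<lambda>y. \<psi> y * ((y + - c 0) \<bullet> b)"
    have F: "smooth_on UNIV ?F"
      using \<psi>(1) unfolding smooth_on_def
      by (intro allI bounded_bilinear.Ck_on[OF bounded_bilinear_mult] bounded_bilinear.Ck_on[OF bounded_bilinear_inner]
          Ck_on_add Ck_on_const Ck_on_bounded_linear[OF bounded_linear_ident]) auto
    let ?f = "\<lambda>x. if x \<in> U then ?F (c x) else 0"
    have f: "?f \<in> C_infinity \<A>"
      by (rule C_infinity_extension[OF F _ r(2)]) (use \<psi>(3) in simp)
    have \<psi>': "(\<psi> has_derivative frechet_derivative \<psi> (at (c 0))) (at (c 0))"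
      by (rule smooth_on_has_derivative[OF \<psi>(1)]) simp
    have "((\<lambda>y. (y + - c 0) \<bullet> b) has_derivative (\<lambda>h. h \<bullet> b)) (at (c 0))"
      by (auto intro!: derivative_eq_intros)
    from has_derivative_mult[OF \<psi>' this]
    have "(?F has_derivative (\<lambda>h. \<psi> (c 0) * (h \<bullet> b))) (at (c 0))"
      by simp
    then have "((\<lambda>y. ?f (0 + ci y)) has_derivative (\<lambda>h. \<psi> (c 0) * (h \<bullet> b))) (at (c 0))"
      by (rule has_derivative_transform_within_open[OF _ cU_open])
         (use zero_in ci_in in auto)
    then have "LF v ?f 0 = \<psi> (c 0) * (v \<bullet> b)" for v
      unfolding LF_def using f by (metis (no_types, lifting) frechet_derivative_at)
    then have "\<psi> (c 0) * (u \<bullet> b) = \<psi> (c 0) * (w \<bullet> b)"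
      using eq by metis
    then show ?thesis using \<psi>(2) by simp
  qed
  then show ?thesis by (rule euclidean_eqI)
qed

lemma smooth_curve_vtang:
  assumes "smooth_map eucl_atlas \<A> \<gamma>" "\<gamma> 0 = 0"
  obtains u where "vtang \<gamma> u UNIV"
proof -
  have cont: "continuous_on UNIV \<gamma>" using assms(1) by (simp add: smooth_map_def)
  have "smooth_on (\<gamma> -` U) (\<lambda>t. c (\<gamma> t))"
    using assms(1) chart0 by (auto simp: smooth_map_def eucl_atlas_def o_def)
  then have d: "((\<lambda>t. c (\<gamma> t)) has_derivative frechet_derivative (\<lambda>t. c (\<gamma> t)) (at 0)) (at 0)"
    by (rule smooth_on_has_derivative) (simp add: assms(2) zero_in)
  let ?D = "frechet_derivative (\<lambda>t. c (\<gamma> t)) (at 0)"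
  have "?D h = h *\<^sub>R ?D 1" for h
    using linear_scale[OF has_derivative_linear[OF d], of h 1] by simp
  then have "?D = (\<lambda>h. h *\<^sub>R ?D 1)" by blast
  with d have "((\<lambda>t. c (\<gamma> t)) has_derivative (\<lambda>h. h *\<^sub>R ?D 1)) (at 0)" by metis
  moreover have "isCont \<gamma> 0" using cont by (simp add: continuous_on_eq_continuous_at)
  ultimately have "vtang \<gamma> (?D 1) UNIV"
    using assms(2) by (simp add: tang_def isCont_def)
  then show ?thesis using that by blast
qed

lemma one_parameterD:
  assumes "one_parameter_subgroup \<A> \<gamma>"
  shows "\<gamma> (s + t) = \<gamma> s + \<gamma> t" "\<gamma> 0 = 0" "smooth_map eucl_atlas \<A> \<gamma>" "continuous_on UNIV \<gamma>"
proof -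
  show "\<gamma> (s + t) = \<gamma> s + \<gamma> t" for s t
    using assms by (simp add: one_parameter_subgroup_def)
  then show "\<gamma> 0 = 0" by (rule zero_of_add_hom)
  show "smooth_map eucl_atlas \<A> \<gamma>"
    using assms by (simp add: one_parameter_subgroup_def)
  then show "continuous_on UNIV \<gamma>" by (simp add: smooth_map_def)
qed

lemma lie_algebra_eq: "lie_algebra \<A> = range LF"
proof (intro equalityI subsetI)
  fix X assume "X \<in> lie_algebra \<A>"
  then obtain \<gamma> where "X = left_field \<A> \<gamma>" "smooth_map eucl_atlas \<A> \<gamma>" "\<gamma> 0 = 0"
    by (auto simp: lie_algebra_def)
  then show "X \<in> range LF"
    using smooth_curve_vtang left_field_eq by (metis rangeI)
next
  fix X assume "X \<in> range LF"
  then obtain u where "X = LF u" by blast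
  moreover obtain \<gamma> where "one_parameter_subgroup \<A> \<gamma>" "vtang \<gamma> u UNIV"
    using one_parameter_exists by blast
  ultimately show "X \<in> lie_algebra \<A>"
    using left_field_eq one_parameterD(2,3) unfolding lie_algebra_def by (metis (mono_tags, lifting) mem_Collect_eq)
qed

definition E :: "'e \<Rightarrow> 'g" where "E u = lie_exp \<A> (LF u)"

text \<open>The description in \<open>lie_exp\<close> determines a point: a competitor with the same
  field has the same velocity by \<open>LF_inj\<close>, and the velocity determines the
  one-parameter subgroup.\<close>

lemma E_eq:
  assumes "one_parameter_subgroup \<A> \<gamma>" "vtang \<gamma> u UNIV"
  shows "E u = \<gamma> 1"
  unfolding E_def lie_exp_def
proof (rule the_equality)
  show "\<exists>\<gamma>'. one_parameter_subgroup \<A> \<gamma>' \<and> left_field \<A> \<gamma>' = LF u \<and> \<gamma> 1 = \<gamma>' 1"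
    using assms left_field_eq by blast
next
  fix p assume "\<exists>\<eta>. one_parameter_subgroup \<A> \<eta> \<and> left_field \<A> \<eta> = LF u \<and> p = \<eta> 1"
  then obtain \<eta> where \<eta>: "one_parameter_subgroup \<A> \<eta>" "left_field \<A> \<eta> = LF u" "p = \<eta> 1"
    by blast
  obtain w where w: "vtang \<eta> w UNIV"
    using smooth_curve_vtang one_parameterD[OF \<eta>(1)] by blast
  then have "w = u" using \<eta>(2) left_field_eq LF_inj by metis
  then have "\<eta> = \<gamma>"
    using one_parameter_unique[OF _ _ _ assms(2)] w one_parameterD(1)[OF \<eta>(1)]
      one_parameterD(1)[OF assms(1)] by metis
  with \<eta>(3) show "p = \<gamma> 1" by simp
qed

lemma E_one_parameter:
  assumes "one_parameter_subgroup \<A> \<gamma>" "vtang \<gamma> u UNIV"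
  shows "E (t *\<^sub>R u) = \<gamma> t"
proof -
  have tan: "vtang (\<lambda>s. \<gamma> (s * t)) (t *\<^sub>R u) UNIV"
  proof -
    have "((\<lambda>s. s * t) has_derivative (\<lambda>h. h * t)) (at 0 within UNIV)"
      by (auto intro!: derivative_eq_intros)
    from tang_compose[OF assms(2) this] show ?thesis by simp
  qed
  have hom: "\<gamma> ((r + s) * t) = \<gamma> (r * t) + \<gamma> (s * t)" for r s
    by (simp add: distrib_right one_parameterD(1)[OF assms(1)])
  obtain \<eta> where \<eta>: "one_parameter_subgroup \<A> \<eta>" "vtang \<eta> (t *\<^sub>R u) UNIV"
    using one_parameter_exists by blast
  have "\<eta> = (\<lambda>s. \<gamma> (s * t))"
    by (rule one_parameter_unique[OF one_parameterD(1)[OF \<eta>(1)] hom \<eta>(2) tan])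
  then show ?thesis using E_eq[OF \<eta>] by simp
qed

lemma E_add: "E ((s + t) *\<^sub>R u) = E (s *\<^sub>R u) + E (t *\<^sub>R u)"
  and E_vtang: "vtang (\<lambda>t. E (t *\<^sub>R u)) u UNIV"
  and E_continuous: "continuous_on UNIV (\<lambda>t. E (t *\<^sub>R u))"
proof -
  obtain \<gamma> where \<gamma>: "one_parameter_subgroup \<A> \<gamma>" "vtang \<gamma> u UNIV"
    using one_parameter_exists by blast
  have "(\<lambda>t. E (t *\<^sub>R u)) = \<gamma>" using E_one_parameter[OF \<gamma>] by blast
  then show "E ((s + t) *\<^sub>R u) = E (s *\<^sub>R u) + E (t *\<^sub>R u)" "vtang (\<lambda>t. E (t *\<^sub>R u)) u UNIV"
    "continuous_on UNIV (\<lambda>t. E (t *\<^sub>R u))"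
    using \<gamma> one_parameterD[OF \<gamma>(1)] by (auto simp: fun_eq_iff)
qed

lemma E_0 [simp]: "E 0 = 0"
  using E_add[of 0 0 0] by (metis add.right_neutral add_left_cancel scaleR_zero_right)

lemma E_uminus: "E (- u) = - E u"
proof -
  have "E (- u) + E u = 0" using E_add[of "-1" 1 u] by simp
  then show ?thesis by (simp add: eq_neg_iff_add_eq_0)
qed

text \<open>Curves that agree on a positive ray have the same velocity at 0. For horizontal vectors
  dilations turn a single equality of exponentials into equality along the ray.\<close>

lemma E_inj_ray:
  assumes "\<And>r. r > 0 \<Longrightarrow> E (r *\<^sub>R u) = E (r *\<^sub>R w)"
  shows "u = w"
proof (rule vtang_unique)
  show "vtang (\<lambda>t. E (t *\<^sub>R u)) u {0..}" by (rule tang_mono[OF E_vtang]) auto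
  have "vtang (\<lambda>t. E (t *\<^sub>R w)) w {0..}" by (rule tang_mono[OF E_vtang]) auto
  then show "vtang (\<lambda>t. E (t *\<^sub>R u)) w {0..}"
    by (rule tang_cong) (metis assms atLeast_iff order_less_le scaleR_zero_left)
qed

lemma E_additive_ray:
  assumes "\<And>r. r > 0 \<Longrightarrow> E (r *\<^sub>R u) + E (r *\<^sub>R v) = E (r *\<^sub>R w)"
  shows "w = u + v"
proof (rule vtang_unique)
  show "vtang (\<lambda>t. E (t *\<^sub>R w)) w {0..}" by (rule tang_mono[OF E_vtang]) auto
  have "vtang (\<lambda>t. E (t *\<^sub>R u) + E (t *\<^sub>R v)) (u + v) {0..}"
    using tang_add[OF tang_mono[OF E_vtang] tang_mono[OF E_vtang], of "{0..}" u v]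
    by (simp add: scaleR_add_right)
  then show "vtang (\<lambda>t. E (t *\<^sub>R w)) (u + v) {0..}"
    by (rule tang_cong) (metis E_0 add.right_neutral assms atLeast_iff order_less_le scaleR_zero_left)
qed

end

section \<open>Homogeneous distances\<close>

locale homogeneous_group = lie_chart \<A> U c
  for \<A> :: "('g::{metric_space, second_countable_topology, group_add}, 'e::euclidean_space) atlas"
    and U :: "'g set" and c :: "'g \<Rightarrow> 'e" +
  fixes s :: nat and L :: "nat \<Rightarrow> 'g field set" and \<delta> :: "real \<Rightarrow> 'g \<Rightarrow> 'g"
  assumes decomposition: "direct_sum_decomposition s L (lie_algebra \<A>)"
    and dilations: "carnot_dilations \<A> s L \<delta>"
    and distance: "homogeneous_distance \<delta>"
begin

lemma dist_add_left: "dist (p + x) (p + y) = dist x (y :: 'g)"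
  using distance by (simp add: homogeneous_distance_def)

lemma dist_eq_gnorm: "dist x y = gnorm (- x + y :: 'g)"
  using dist_add_left[of "- x" x y] by (simp add: gnorm_def)

lemma gnorm_0 [simp]: "gnorm (0 :: 'g) = 0"
  by (simp add: gnorm_def)

lemma gnorm_nonneg [simp]: "0 \<le> gnorm (x :: 'g)"
  by (simp add: gnorm_def)

lemma gnorm_eq_0: "gnorm (x :: 'g) = 0 \<longleftrightarrow> x = 0"
  by (auto simp: gnorm_def)

lemma gnorm_minus [simp]: "gnorm (- x :: 'g) = gnorm x"
  using dist_eq_gnorm[of x 0] by (simp add: gnorm_def dist_commute)

lemma gnorm_triangle: "gnorm (x + y :: 'g) \<le> gnorm x + gnorm y"
  using dist_triangle[of 0 "x + y" x] dist_add_left[of x 0 y] by (simp add: gnorm_def)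

lemma gnorm_diff: "gnorm (x - y :: 'g) \<le> gnorm x + gnorm y"
  using gnorm_triangle[of x "- y"] by simp

lemma dil_bij: "r > 0 \<Longrightarrow> bij (\<delta> r)" and dil_add: "r > 0 \<Longrightarrow> \<delta> r (x + y) = \<delta> r x + \<delta> r y"
  using dilations by (auto simp: carnot_dilations_def)

lemma dil_0 [simp]: "r > 0 \<Longrightarrow> \<delta> r 0 = 0"
  using dil_add[of r 0 0] by (metis add.right_neutral add_left_cancel)

lemma gnorm_dil: "r > 0 \<Longrightarrow> gnorm (\<delta> r x) = r * gnorm x"
  using distance dil_0[of r] unfolding homogeneous_distance_def gnorm_def by metis

lemma layer_zero: "j \<in> {1..s} \<Longrightarrow> 0 \<in> L j"
proof -
  interpret vector_space fscale by (rule vector_space_fscale)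
  show "j \<in> {1..s} \<Longrightarrow> 0 \<in> L j"
    using decomposition unfolding direct_sum_decomposition_def by (blast intro: subspace_0)
qed

lemma dil_E:
  assumes r: "r > 0" and j: "j \<in> {1..s}" and u: "LF u \<in> L j"
  shows "\<delta> r (E u) = E (r ^ j *\<^sub>R u)"
proof -
  \<comment> \<open>\<open>carnot_dilations\<close> speaks of sums with one term in every layer; all
    terms but the j-th are taken to be 0.\<close>
  define Y where "Y i = (if i = j then LF u else 0)" for i
  have Y: "\<forall>i\<in>{1..s}. Y i \<in> L i" using u layer_zero by (auto simp: Y_def)
  have 1: "(\<Sum>i=1..s. Y i) = LF u" using j by (simp add: Y_def)
  have "fscale (r ^ i) (Y i) = (if i = j then fscale (r ^ i) (LF u) else 0)" for i
    by (auto simp: Y_def fscale_def fun_eq_iff)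
  then have 2: "(\<Sum>i=1..s. fscale (r ^ i) (Y i)) = fscale (r ^ j) (LF u)" using j by simp
  have "\<delta> r (lie_exp \<A> (\<Sum>i=1..s. Y i)) = lie_exp \<A> (\<Sum>i=1..s. fscale (r ^ i) (Y i))"
    using dilations r Y unfolding carnot_dilations_def by blast
  then show ?thesis unfolding 1 2 by (simp add: E_def LF_scale)
qed

subsection \<open>Coordinates of the second kind\<close>

lemma layer_components: "\<exists>B. (\<forall>j\<in>{1..s}. LF (B j) \<in> L j) \<and> u = (\<Sum>j=1..s. B j)"
proof -
  have "LF u \<in> lie_algebra \<A>" by (simp add: lie_algebra_eq)
  then obtain Y where Y: "\<forall>j\<in>{1..s}. Y j \<in> L j" "LF u = (\<Sum>j=1..s. Y j)"
    using decomposition unfolding direct_sum_decomposition_def by blast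
  have "\<exists>w. Y j = LF w" if "j \<in> {1..s}" for j
    using Y(1) that decomposition unfolding direct_sum_decomposition_def lie_algebra_eq by blast
  then obtain B where B: "\<And>j. j \<in> {1..s} \<Longrightarrow> Y j = LF (B j)" by metis
  then have "LF u = LF (\<Sum>j=1..s. B j)" using Y(2) by (simp add: LF_sum)
  then show ?thesis using LF_inj B Y(1) by metis
qed

definition component :: "'e \<Rightarrow> nat \<Rightarrow> 'e" where
  "component u = (SOME B. (\<forall>j\<in>{1..s}. LF (B j) \<in> L j) \<and> u = (\<Sum>j=1..s. B j))"

lemma component: "j \<in> {1..s} \<Longrightarrow> LF (component u j) \<in> L j" "u = (\<Sum>j=1..s. component u j)"
  using someI_ex[OF layer_components, of u] unfolding component_def by blast+

text \<open>
  The homogeneous vectors \<open>component b j\<close> with \<open>(b, j)\<close> in \<open>idx\<close> span but need not be independent: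
  the coordinates only have to be onto.
\<close>

definition idx :: "('e \<times> nat) list" where
  "idx = (SOME xs. set xs = Basis \<times> {1..s} \<and> distinct xs)"

lemma idx: "set idx = Basis \<times> {1..s}" "distinct idx"
proof -
  have "finite ((Basis :: 'e set) \<times> {1..s})" by simp
  then have "\<exists>xs. set xs = (Basis :: 'e set) \<times> {1..s} \<and> distinct xs"
    by (rule finite_distinct_list)
  from someI_ex[OF this] show "set idx = Basis \<times> {1..s}" "distinct idx"
    by (auto simp: idx_def)
qed

definition ray :: "'e \<times> nat \<Rightarrow> real \<Rightarrow> 'g" where
  "ray i t = E (t *\<^sub>R component (fst i) (snd i))"

lemma ray_tang: "tang (ray i) (\<lambda>h. h *\<^sub>R component (fst i) (snd i)) 0 UNIV"
  unfolding ray_def by (rule E_vtang)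

lemma dil_ray:
  assumes "r > 0" "i \<in> set idx"
  shows "\<delta> r (ray i t) = ray i (r ^ snd i * t)"
proof -
  interpret vector_space fscale by (rule vector_space_fscale)
  have i: "snd i \<in> {1..s}" using assms(2) idx(1) by auto
  have "subspace (L (snd i))"
    using decomposition i unfolding direct_sum_decomposition_def by blast
  then have "LF (t *\<^sub>R component (fst i) (snd i)) \<in> L (snd i)"
    using component(1)[OF i] by (simp add: LF_scale subspace_scale)
  from dil_E[OF assms(1) i this] show ?thesis by (simp add: ray_def)
qed

lemma dil_sum_list: "r > 0 \<Longrightarrow> \<delta> r (\<Sum>i\<leftarrow>xs. f i) = (\<Sum>i\<leftarrow>xs. \<delta> r (f i))"
  by (induction xs) (auto simp: dil_add)

lemma tang_sum_list:
  assumes "x \<in> S" "\<And>i. i \<in> set xs \<Longrightarrow> tang (f i) (f' i) x S"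
  shows "tang (\<lambda>y. \<Sum>i\<leftarrow>xs. f i y) (\<lambda>h. \<Sum>i\<leftarrow>xs. f' i h) x S"
  using assms(2)
proof (induction xs)
  case Nil
  then show ?case by (simp add: tang_0[OF assms(1)])
next
  case (Cons i xs)
  then show ?case using tang_add[OF Cons.prems[of i] Cons.IH] by simp
qed

text \<open>The product G of the rays has the identity as derivative at 0, because the components of
  each basis vector add up to it. G is continuous but its derivative is known at 0 only, which calls
  for \<open>sussmann_open_mapping\<close> instead of the inverse function theorem. Restriction to
  the unit ball gives the bound on \<tau>.\<close>

lemma ray_sum_onto:
  obtains \<rho> where "\<rho> > 0"
    "\<And>x. gnorm x < \<rho> \<Longrightarrow> \<exists>\<tau>. (\<forall>i\<in>set idx. \<bar>\<tau> i\<bar> \<le> 1) \<and> x = (\<Sum>i\<leftarrow>idx. ray i (\<tau> i))"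
proof -
  define G where "G y = (\<Sum>i\<leftarrow>idx. ray i (y \<bullet> fst i))" for y :: 'e
  have "tang (\<lambda>y. ray i (y \<bullet> fst i)) (\<lambda>h. (h \<bullet> fst i) *\<^sub>R component (fst i) (snd i)) 0 UNIV" for i
    by (rule tang_compose[OF ray_tang]) (auto intro!: derivative_eq_intros)
  then have "tang G (\<lambda>h. \<Sum>i\<leftarrow>idx. (h \<bullet> fst i) *\<^sub>R component (fst i) (snd i)) 0 UNIV"
    unfolding G_def by (intro tang_sum_list) auto
  moreover have "(\<Sum>i\<leftarrow>idx. (h \<bullet> fst i) *\<^sub>R component (fst i) (snd i)) = h" for h
  proof -
    have "(\<Sum>i\<leftarrow>idx. (h \<bullet> fst i) *\<^sub>R component (fst i) (snd i)) =
        (\<Sum>i\<in>Basis \<times> {1..s}. (h \<bullet> fst i) *\<^sub>R component (fst i) (snd i))"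
      using idx by (simp add: sum_list_distinct_conv_sum_set)
    also have "\<dots> = (\<Sum>b\<in>Basis. \<Sum>j=1..s. (h \<bullet> b) *\<^sub>R component b j)"
      by (simp add: sum.cartesian_product case_prod_unfold)
    also have "\<dots> = (\<Sum>b\<in>Basis. (h \<bullet> b) *\<^sub>R b)"
      by (intro sum.cong refl) (metis component(2) scaleR_sum_right)
    finally show ?thesis by (simp add: euclidean_representation)
  qed
  ultimately have G: "tang G (\<lambda>h. h) 0 UNIV" by simp
  have "continuous_on UNIV (\<lambda>y. \<Sum>i\<leftarrow>xs. ray i (y \<bullet> fst i))" for xs
  proof (induction xs)
    case (Cons i xs)
    have "continuous_on UNIV (\<lambda>y. ray i (y \<bullet> fst i))"
      unfolding ray_def by (intro continuous_on_compose2[OF E_continuous] continuous_intros) auto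
    then show ?case using Cons by (simp add: continuous_on_add_grp)
  qed simp
  then have G_cont: "continuous_on UNIV G" by (simp add: G_def)
  let ?S = "G -` U"
  have S: "open ?S" using G_cont U_open by (simp add: open_vimage)
  have G0: "G 0 = 0" using G by (simp add: tang_def)
  have cG: "continuous_on ?S (c \<circ> G)"
    by (intro continuous_on_compose continuous_on_subset[OF G_cont] continuous_on_subset[OF c_cont]) auto
  have der: "((c \<circ> G) has_derivative (\<lambda>h. h)) (at 0)"
    using G by (simp add: tang_def o_def)
  have 0: "0 \<in> ?S" using G0 zero_in by simp
  let ?T = "ball 0 1 \<inter> ?S"
  have "(c \<circ> G) 0 \<in> interior ((c \<circ> G) ` ?T)"
    by (rule sussmann_open_mapping[OF S cG 0 der bounded_linear_ident])
       (use S 0 in \<open>auto simp: fun_eq_iff interior_open\<close>)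
  then have cI: "c 0 \<in> interior ((c \<circ> G) ` ?T)" using G0 by simp
  have "open (U \<inter> c -` interior ((c \<circ> G) ` ?T))"
    by (rule continuous_open_preimage[OF c_cont U_open]) simp
  moreover have "0 \<in> U \<inter> c -` interior ((c \<circ> G) ` ?T)" using zero_in cI by simp
  ultimately obtain \<rho> where \<rho>: "\<rho> > 0" "ball 0 \<rho> \<subseteq> U \<inter> c -` interior ((c \<circ> G) ` ?T)"
    using open_contains_ball by blast
  show ?thesis
  proof (rule that[OF \<rho>(1)])
    fix x :: 'g assume "gnorm x < \<rho>"
    then have x: "x \<in> U" "c x \<in> (c \<circ> G) ` ?T"
      using \<rho>(2) interior_subset by (fastforce simp: gnorm_def)+
    then obtain y where y: "y \<in> ?T" "c x = c (G y)" by auto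
    then have "x = G y" using c_inj x(1) by blast
    moreover have "\<bar>y \<bullet> fst i\<bar> \<le> 1" if "i \<in> set idx" for i
      using y(1) that idx(1) Basis_le_norm[of "fst i" y] by auto
    ultimately show "\<exists>\<tau>. (\<forall>i\<in>set idx. \<bar>\<tau> i\<bar> \<le> 1) \<and> x = (\<Sum>i\<leftarrow>idx. ray i (\<tau> i))"
      unfolding G_def by (intro exI[of _ "\<lambda>i. y \<bullet> fst i"]) simp
  qed
qed

lemma dil_preimage:
  assumes "r > 0"
  obtains y where "x = \<delta> r y" "gnorm y = gnorm x / r"
proof -
  obtain y where "x = \<delta> r y" using bij_is_surj[OF dil_bij[OF assms]] by (metis surjD)
  then show ?thesis using that gnorm_dil[OF assms, of y] assms by simp
qed

lemma ray_sum_surj: "\<exists>\<tau>. x = (\<Sum>i\<leftarrow>idx. ray i (\<tau> i))"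
proof -
  obtain \<rho> where \<rho>: "\<rho> > 0"
    "\<And>x. gnorm x < \<rho> \<Longrightarrow> \<exists>\<tau>. (\<forall>i\<in>set idx. \<bar>\<tau> i\<bar> \<le> 1) \<and> x = (\<Sum>i\<leftarrow>idx. ray i (\<tau> i))"
    using ray_sum_onto by metis
  define r where "r = gnorm x / \<rho> + 1"
  have r: "r > 0" using \<rho>(1) by (simp add: r_def add_nonneg_pos)
  obtain y where y: "x = \<delta> r y" "gnorm y = gnorm x / r" using dil_preimage[OF r] .
  have "gnorm x < \<rho> * r" using \<rho>(1) by (simp add: r_def distrib_left)
  then have "gnorm y < \<rho>" using y(2) r by (simp add: pos_divide_less_eq)
  then obtain \<tau> where "y = (\<Sum>i\<leftarrow>idx. ray i (\<tau> i))" using \<rho>(2) by blast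
  then have "x = (\<Sum>i\<leftarrow>idx. ray i (r ^ snd i * \<tau> i))"
    using y(1) by (simp add: dil_sum_list[OF r] dil_ray[OF r] cong: map_cong)
  then show ?thesis by (rule exI[of _ "\<lambda>i. r ^ snd i * \<tau> i"])
qed

subsection \<open>The horizontal differential of dilations\<close>

text \<open>The value 0 at r = 0 makes this a curve issuing from the identity, so that its one-sided
  velocity can be taken.\<close>

definition dil0 :: "'g \<Rightarrow> real \<Rightarrow> 'g" where
  "dil0 x r = (if r > 0 then \<delta> r x else 0)"

lemma dil0_add: "dil0 (x + y) r = dil0 x r + dil0 y r"
  by (simp add: dil0_def dil_add)

text \<open>In coordinates of the second kind \<open>\<delta> r x\<close> is a product of rays at
  the times r^j \<tau>, where j is the degree. Each is differentiable at r = 0, and only degree 1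
  leaves a velocity, which \<open>\<sigma>\<close> records.\<close>

lemma dil0_vtang_exists: "\<exists>u. vtang (dil0 x) u {0..}"
proof -
  obtain \<tau> where \<tau>: "x = (\<Sum>i\<leftarrow>idx. ray i (\<tau> i))" using ray_sum_surj by blast
  define \<sigma> where "\<sigma> i = (if snd i = 1 then \<tau> i else 0)" for i
  have "tang (\<lambda>r. ray i (r ^ snd i * \<tau> i)) (\<lambda>h. (h * \<sigma> i) *\<^sub>R component (fst i) (snd i)) 0 {0..}"
    if "i \<in> set idx" for i
  proof (rule tang_compose[OF ray_tang])
    have "snd i \<ge> 1" using that idx(1) by auto
    then obtain n where n: "snd i = Suc n" by (cases "snd i") auto
    have "((\<lambda>r. r ^ snd i * \<tau> i) has_real_derivative real (snd i) * 0 ^ n * \<tau> i) (at 0 within {0..})"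
      by (auto intro!: derivative_eq_intros simp: n)
    moreover have "real (snd i) * 0 ^ n * \<tau> i = \<sigma> i" by (cases n) (auto simp: \<sigma>_def n)
    ultimately show "((\<lambda>r. r ^ snd i * \<tau> i) has_derivative (\<lambda>h. h * \<sigma> i)) (at 0 within {0..})"
      by (simp add: has_field_derivative_def mult_commute_abs)
    show "(0::real) ^ snd i * \<tau> i = 0" using n by simp
  qed simp
  then have "tang (\<lambda>r. \<Sum>i\<leftarrow>idx. ray i (r ^ snd i * \<tau> i))
      (\<lambda>h. \<Sum>i\<leftarrow>idx. (h * \<sigma> i) *\<^sub>R component (fst i) (snd i)) 0 {0..}"
    by (intro tang_sum_list) auto
  moreover have "(\<Sum>i\<leftarrow>xs. (h * \<sigma> i) *\<^sub>R component (fst i) (snd i)) =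
      h *\<^sub>R (\<Sum>i\<leftarrow>xs. \<sigma> i *\<^sub>R component (fst i) (snd i))" for h xs
    by (induction xs) (auto simp: scaleR_add_right)
  ultimately have "vtang (\<lambda>r. \<Sum>i\<leftarrow>idx. ray i (r ^ snd i * \<tau> i))
      (\<Sum>i\<leftarrow>idx. \<sigma> i *\<^sub>R component (fst i) (snd i)) {0..}" by simp
  then have "vtang (dil0 x) (\<Sum>i\<leftarrow>idx. \<sigma> i *\<^sub>R component (fst i) (snd i)) {0..}"
  proof (rule tang_cong)
    fix r :: real assume "r \<in> {0..}"
    show "(\<Sum>i\<leftarrow>idx. ray i (r ^ snd i * \<tau> i)) = dil0 x r"
    proof (cases "r > 0")
      case True
      then show ?thesis
        using dil_ray[OF True] by (simp add: dil0_def \<tau> dil_sum_list cong: map_cong)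
    next
      case False
      have "ray i (r ^ snd i * \<tau> i) = 0" if "i \<in> set idx" for i
      proof -
        have "snd i \<ge> 1" using that idx(1) by auto
        then show ?thesis using False \<open>r \<in> {0..}\<close> by (simp add: ray_def power_0_left)
      qed
      then have "(\<Sum>i\<leftarrow>idx. ray i (r ^ snd i * \<tau> i)) = (\<Sum>i\<leftarrow>idx. 0)"
        by (simp cong: map_cong)
      then show ?thesis using False by (simp add: dil0_def)
    qed
  qed
  then show ?thesis by blast
qed

text \<open>
  The velocity of \<open>r \<mapsto> \<delta> r x\<close> at \<open>0\<close>, that is, the component of \<open>x\<close> in the first layer.
\<close>

definition hdiff :: "'g \<Rightarrow> 'e" where
  "hdiff x = (SOME u. vtang (dil0 x) u {0..})"

lemma hdiff: "vtang (dil0 x) (hdiff x) {0..}"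
  unfolding hdiff_def using dil0_vtang_exists by (rule someI_ex)

lemma hdiff_add: "hdiff (x + y) = hdiff x + hdiff y"
proof (rule vtang_unique[OF hdiff])
  show "vtang (dil0 (x + y)) (hdiff x + hdiff y) {0..}"
  proof (rule tang_cong)
    show "vtang (\<lambda>r. dil0 x r + dil0 y r) (hdiff x + hdiff y) {0..}"
      using tang_add[OF hdiff hdiff, of x y] by (simp add: scaleR_add_right)
  qed (simp add: dil0_add)
qed

lemma hdiff_E:
  assumes "1 \<le> s" "LF u \<in> L 1"
  shows "hdiff (E u) = u"
proof (rule vtang_unique[OF hdiff])
  have "vtang (\<lambda>t. E (t *\<^sub>R u)) u {0..}" by (rule tang_mono[OF E_vtang]) auto
  then show "vtang (dil0 (E u)) u {0..}"
    by (rule tang_cong) (use dil_E[of _ 1 u] assms in \<open>auto simp: dil0_def\<close>)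
qed

subsection \<open>Lipschitz estimates in the chart\<close>

definition near0 :: "real \<Rightarrow> 'g \<Rightarrow> bool" where
  "near0 r x \<longleftrightarrow> x \<in> U \<and> norm (c x - c 0) \<le> r"

text \<open>A predicate, so that several estimates can share the same r and K. The product is
  required to stay in U because \<open>c\<close> is arbitrary elsewhere.\<close>

definition product_lipschitz :: "real \<Rightarrow> real \<Rightarrow> bool" where
  "product_lipschitz r K \<longleftrightarrow> (\<forall>x y x' y'. near0 r x \<longrightarrow> near0 r y \<longrightarrow> near0 r x' \<longrightarrow> near0 r y' \<longrightarrow>
     x + y \<in> U \<and> norm (c (x + y) - c (x' + y')) \<le> K * (norm (c x - c x') + norm (c y - c y')))"

lemma product_lipschitzD:
  assumes "product_lipschitz r K" "near0 r x" "near0 r y"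
  shows "x + y \<in> U" "near0 r x' \<Longrightarrow> near0 r y' \<Longrightarrow>
    norm (c (x + y) - c (x' + y')) \<le> K * (norm (c x - c x') + norm (c y - c y'))"
  using assms unfolding product_lipschitz_def by blast+

lemma near0_0: "0 \<le> r \<Longrightarrow> near0 r 0"
  by (simp add: near0_def zero_in)

lemma product_lipschitz_near: obtains r K where "r > 0" "K \<ge> 0" "product_lipschitz r K"
proof -
  have "(c 0, c 0) \<in> D" using in_D_0 zero_in by blast
  moreover have "Ck_on 1 D mt" using mt_smooth unfolding smooth_on_def by blast
  ultimately obtain r K where r: "r > 0" and K: "K \<ge> 0" and sub: "cball (c 0, c 0) r \<subseteq> D"
    and lip: "\<And>p q. p \<in> cball (c 0, c 0) r \<Longrightarrow> q \<in> cball (c 0, c 0) r \<Longrightarrow>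
      norm (mt p - mt q) \<le> K * norm (p - q)"
    using Ck_on_1_lipschitz_near[OF D_open] by metis
  have in_ball: "(c x, c y) \<in> cball (c 0, c 0) r" if "near0 (r / 2) x" "near0 (r / 2) y" for x y
  proof -
    have "norm ((c x, c y) - (c 0, c 0)) \<le> r"
      using that norm_Pair_le[of "c x - c 0" "c y - c 0"] by (simp add: near0_def)
    then show ?thesis by (metis dist_norm dist_commute mem_cball)
  qed
  have "product_lipschitz (r / 2) K"
    unfolding product_lipschitz_def
  proof (intro allI impI conjI)
    fix x y x' y'
    assume *: "near0 (r / 2) x" "near0 (r / 2) y" "near0 (r / 2) x'" "near0 (r / 2) y'"
    then have "(c x, c y) \<in> D" using in_ball sub by blast
    then show "x + y \<in> U" using * by (simp add: D_def near0_def)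
    have "norm (c (x + y) - c (x' + y')) = norm (mt (c x, c y) - mt (c x', c y'))"
      using * by (simp add: mt_c near0_def)
    also have "\<dots> \<le> K * norm ((c x, c y) - (c x', c y'))"
      using * in_ball by (intro lip) auto
    also have "\<dots> \<le> K * (norm (c x - c x') + norm (c y - c y'))"
      using K norm_Pair_le[of "c x - c x'" "c y - c y'"] by (intro mult_left_mono) auto
    finally show "norm (c (x + y) - c (x' + y')) \<le> K * (norm (c x - c x') + norm (c y - c y'))" .
  qed
  with r K show ?thesis using that[of "r / 2" K] by simp
qed

lemma ray_lipschitz_near:
  obtains d K where "d > 0" "K \<ge> 0"
    "\<And>t. \<bar>t\<bar> \<le> d \<Longrightarrow> ray i t \<in> U \<and> norm (c (ray i t) - c 0) \<le> K * \<bar>t\<bar>"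
proof -
  let ?b = "component (fst i) (snd i)"
  have r0: "ray i 0 = 0" and der: "((\<lambda>t. c (ray i t)) has_derivative (\<lambda>h. h *\<^sub>R ?b)) (at 0)"
    using ray_tang[of i] by (auto simp: tang_def)
  obtain d1 where d1: "d1 > 0"
    "\<And>t. norm (t - 0) < d1 \<Longrightarrow> norm (c (ray i t) - c (ray i 0) - (t - 0) *\<^sub>R ?b) \<le> 1 * norm (t - 0)"
    using der unfolding has_derivative_at_alt by (metis zero_less_one)
  have "\<forall>\<^sub>F t in at 0. ray i t \<in> U" using tang_eventually[OF ray_tang] by simp
  then obtain d2 where d2: "d2 > 0" "\<And>t. t \<noteq> 0 \<Longrightarrow> dist t 0 < d2 \<Longrightarrow> ray i t \<in> U"
    unfolding eventually_at by auto
  show ?thesis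
  proof (rule that[of "min d1 d2 / 2" "1 + norm ?b"])
    fix t assume t: "\<bar>t\<bar> \<le> min d1 d2 / 2"
    then have "ray i t \<in> U" using d2 d1(1) r0 zero_in by (cases "t = 0") auto
    moreover have "norm (c (ray i t) - c 0 - t *\<^sub>R ?b) \<le> \<bar>t\<bar>"
      using d1 d2(1) t r0 by (simp add: min_def split: if_splits)
    then have "norm (c (ray i t) - c 0) \<le> (1 + norm ?b) * \<bar>t\<bar>"
      using norm_triangle_sub[of "c (ray i t) - c 0" "t *\<^sub>R ?b"] by (simp add: algebra_simps)
    ultimately show "ray i t \<in> U \<and> norm (c (ray i t) - c 0) \<le> (1 + norm ?b) * \<bar>t\<bar>" by blast
  qed (use d1 d2 in auto)
qed

text \<open>Induction on the factors, with one application of the Lipschitz estimate for the group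
  law per factor. Each one changes \<eta> and K, so both are quantified inside.\<close>

lemma ray_sum_lipschitz_near:
  assumes "set xs \<subseteq> set idx"
  shows "\<exists>\<eta>>0. \<exists>K\<ge>0. \<forall>l \<tau>. 0 \<le> l \<and> l \<le> \<eta> \<and> (\<forall>i\<in>set xs. \<bar>\<tau> i\<bar> \<le> 1) \<longrightarrow>
    (\<Sum>i\<leftarrow>xs. ray i (l ^ snd i * \<tau> i)) \<in> U \<and>
    norm (c (\<Sum>i\<leftarrow>xs. ray i (l ^ snd i * \<tau> i)) - c 0) \<le> K * l"
  using assms
proof (induction xs)
  case Nil
  then show ?case using zero_in by (intro exI[of _ 1] conjI exI[of _ 0]) auto
next
  case (Cons i xs)
  obtain \<eta> K where \<eta>: "\<eta> > 0" "K \<ge> 0" and IH: "\<And>l \<tau>. 0 \<le> l \<Longrightarrow> l \<le> \<eta> \<Longrightarrow> (\<forall>i\<in>set xs. \<bar>\<tau> i\<bar> \<le> 1) \<Longrightarrow>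
    (\<Sum>i\<leftarrow>xs. ray i (l ^ snd i * \<tau> i)) \<in> U \<and>
    norm (c (\<Sum>i\<leftarrow>xs. ray i (l ^ snd i * \<tau> i)) - c 0) \<le> K * l"
    using Cons by auto
  obtain d K' where d: "d > 0" "K' \<ge> 0"
    "\<And>t. \<bar>t\<bar> \<le> d \<Longrightarrow> ray i t \<in> U \<and> norm (c (ray i t) - c 0) \<le> K' * \<bar>t\<bar>"
    using ray_lipschitz_near[of i] by metis
  obtain r M where r: "r > 0" "M \<ge> 0" and prod: "product_lipschitz r M"
    by (rule product_lipschitz_near)
  \<comment> \<open>The bound 1 gives l^j \<le> l, the bound d is for the new ray, and the last term
    keeps both factors within \<open>near0 r\<close>; the + 1 keeps its divisor positive.\<close>
  define \<eta>' where "\<eta>' = min (min \<eta> (min d 1)) (r / (K + K' + 1))"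
  have \<eta>': "\<eta>' > 0" using \<eta> d r by (simp add: \<eta>'_def)
  have small: "(K + K' + 1) * l \<le> r" if "0 \<le> l" "l \<le> \<eta>'" for l
  proof -
    have "l \<le> r / (K + K' + 1)" using that by (simp add: \<eta>'_def)
    then show ?thesis using \<eta> d by (simp add: pos_le_divide_eq mult.commute)
  qed
  have "(\<Sum>i\<leftarrow>i # xs. ray i (l ^ snd i * \<tau> i)) \<in> U \<and>
    norm (c (\<Sum>i\<leftarrow>i # xs. ray i (l ^ snd i * \<tau> i)) - c 0) \<le> (M * (K' + K)) * l"
    if l: "0 \<le> l" "l \<le> \<eta>'" and \<tau>: "\<forall>i\<in>set (i # xs). \<bar>\<tau> i\<bar> \<le> 1" for l \<tau>
  proof -
    let ?x = "ray i (l ^ snd i * \<tau> i)" and ?y = "\<Sum>i\<leftarrow>xs. ray i (l ^ snd i * \<tau> i)"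
    have "snd i \<ge> 1" using Cons.prems idx(1) by auto
    then have "l ^ snd i \<le> l"
      using l power_decreasing[of 1 "snd i" l] by (simp add: \<eta>'_def)
    then have "\<bar>l ^ snd i * \<tau> i\<bar> \<le> l"
      using l(1) \<tau> mult_mono[of "l ^ snd i" l "\<bar>\<tau> i\<bar>" 1] by (simp add: abs_mult)
    moreover have "l \<le> d" using l by (simp add: \<eta>'_def)
    ultimately have x: "?x \<in> U" "norm (c ?x - c 0) \<le> K' * l"
      using d(3)[of "l ^ snd i * \<tau> i"] d(2) mult_left_mono[of "\<bar>l ^ snd i * \<tau> i\<bar>" l K'] by auto
    have "l \<le> \<eta>" using l by (simp add: \<eta>'_def)
    then have y: "?y \<in> U" "norm (c ?y - c 0) \<le> K * l"
      using IH[OF l(1), of \<tau>] \<tau> by auto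
    have "K' * l \<le> (K + K' + 1) * l" "K * l \<le> (K + K' + 1) * l"
      using l(1) \<eta> d by (auto intro: mult_right_mono)
    then have "norm (c ?x - c 0) \<le> r" "norm (c ?y - c 0) \<le> r"
      using small[OF l] x y by linarith+
    then have xy: "near0 r ?x" "near0 r ?y" using x(1) y(1) by (simp_all add: near0_def)
    have "norm (c (?x + ?y) - c (0 + 0)) \<le> M * (norm (c ?x - c 0) + norm (c ?y - c 0))"
      using r near0_0[of r] by (intro product_lipschitzD(2)[OF prod] xy) auto
    also have "\<dots> \<le> M * (K' * l + K * l)"
      using x y r by (intro mult_left_mono) auto
    finally show ?thesis
      using product_lipschitzD(1)[OF prod xy] by (simp add: algebra_simps)
  qed
  then show ?case
    using \<eta>' \<eta>(2) d(2) r(2) by (intro exI[of _ \<eta>'] exI[of _ "M * (K' + K)"] conjI) auto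
qed

text \<open>
  In coordinates of the second kind \<open>\<delta> l\<close> multiplies a coordinate of degree \<open>j \<ge> 1\<close> by
  \<open>l ^ j \<le> l\<close>, so the homogeneous norm dominates the Euclidean norm of the chart near \<open>0\<close>.
\<close>

lemma chart_le_gnorm:
  obtains \<rho> K where "\<rho> > 0" "K \<ge> 0"
    "\<And>x. gnorm x \<le> \<rho> \<Longrightarrow> x \<in> U \<and> norm (c x - c 0) \<le> K * gnorm x"
proof -
  obtain \<rho> where \<rho>: "\<rho> > 0"
    "\<And>x. gnorm x < \<rho> \<Longrightarrow> \<exists>\<tau>. (\<forall>i\<in>set idx. \<bar>\<tau> i\<bar> \<le> 1) \<and> x = (\<Sum>i\<leftarrow>idx. ray i (\<tau> i))"
    using ray_sum_onto by metis
  from ray_sum_lipschitz_near[OF subset_refl]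
  obtain \<eta> K where \<eta>: "\<eta> > 0" "K \<ge> 0" and est:
    "\<forall>l \<tau>. 0 \<le> l \<and> l \<le> \<eta> \<and> (\<forall>i\<in>set idx. \<bar>\<tau> i\<bar> \<le> 1) \<longrightarrow>
    (\<Sum>i\<leftarrow>idx. ray i (l ^ snd i * \<tau> i)) \<in> U \<and>
    norm (c (\<Sum>i\<leftarrow>idx. ray i (l ^ snd i * \<tau> i)) - c 0) \<le> K * l"
    by blast
  show ?thesis
  proof (rule that[of "\<rho> * \<eta> / 2" "K * (2 / \<rho>)"])
    fix x :: 'g assume x: "gnorm x \<le> \<rho> * \<eta> / 2"
    show "x \<in> U \<and> norm (c x - c 0) \<le> K * (2 / \<rho>) * gnorm x"
    proof (cases "x = 0")
      case False
      \<comment> \<open>The factor 2 gives the rescaled point the norm \<rho> / 2, strictly below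
        \<rho>.\<close>
      define l where "l = 2 * gnorm x / \<rho>"
      have gx: "gnorm x > 0" using False gnorm_eq_0 gnorm_nonneg by (metis less_eq_real_def)
      have l: "l > 0" using gx \<rho>(1) by (simp add: l_def)
      have l\<eta>: "l \<le> \<eta>" using x \<rho>(1) by (simp add: l_def pos_divide_le_eq mult.commute)
      obtain y where y: "x = \<delta> l y" "gnorm y = gnorm x / l" using dil_preimage[OF l] .
      have "gnorm y < \<rho>" using y(2) \<rho>(1) gx by (simp add: l_def)
      then obtain \<tau> where \<tau>: "\<forall>i\<in>set idx. \<bar>\<tau> i\<bar> \<le> 1" "y = (\<Sum>i\<leftarrow>idx. ray i (\<tau> i))"
        using \<rho>(2) by blast
      have "x = (\<Sum>i\<leftarrow>idx. ray i (l ^ snd i * \<tau> i))"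
        using y(1) \<tau>(2) by (simp add: dil_sum_list[OF l] dil_ray[OF l] cong: map_cong)
      then have "x \<in> U \<and> norm (c x - c 0) \<le> K * l"
        using est[rule_format, of l \<tau>] l l\<eta> \<tau>(1) by (simp only: less_imp_le simp_thms)
      then show ?thesis by (simp add: l_def mult.commute mult.left_commute)
    qed (simp add: zero_in)
  qed (use \<rho> \<eta> in auto)
qed

lemma gnorm_small_if_chart_small:
  assumes "\<epsilon> > 0"
  obtains r where "r > 0" "\<And>x. x \<in> U \<Longrightarrow> norm (c x - c 0) < r \<Longrightarrow> gnorm x < \<epsilon>"
proof -
  have "open (c ` (U \<inter> ball 0 \<epsilon>))" using chart_open_image[OF chart0] by simp
  moreover have "c 0 \<in> c ` (U \<inter> ball 0 \<epsilon>)" using zero_in assms by auto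
  ultimately obtain r where r: "r > 0" "ball (c 0) r \<subseteq> c ` (U \<inter> ball 0 \<epsilon>)"
    using open_contains_ball by blast
  show ?thesis
  proof (rule that[OF r(1)])
    fix x assume x: "x \<in> U" "norm (c x - c 0) < r"
    then have "c x \<in> c ` (U \<inter> ball 0 \<epsilon>)"
      using r(2) by (auto simp: dist_norm norm_minus_commute)
    then obtain x' where "x' \<in> U" "x' \<in> ball 0 \<epsilon>" "c x = c x'" by blast
    then have "x \<in> ball 0 \<epsilon>" using x(1) c_inj by metis
    then show "gnorm x < \<epsilon>" by (simp add: gnorm_def)
  qed
qed

end

section \<open>Splittings with a horizontal factor\<close>

locale horizontal_splitting = homogeneous_group \<A> U c s L \<delta>
  for \<A> :: "('g::{metric_space, second_countable_topology, group_add}, 'e::euclidean_space) atlas"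
    and U :: "'g set" and c :: "'g \<Rightarrow> 'e"
    and s :: nat and L :: "nat \<Rightarrow> 'g field set" and \<delta> :: "real \<Rightarrow> 'g \<Rightarrow> 'g" +
  fixes W V :: "'g set" and X :: "'k::finite \<Rightarrow> 'g field"
  assumes step_ge_1: "1 \<le> s"
    and homogeneous_W: "homogeneous_subgroup \<A> \<delta> W"
    and homogeneous_V: "homogeneous_subgroup \<A> \<delta> V"
    and complementary: "complementary W V"
    and horizontal_V: "horizontal \<A> L V"
    and basis: "field_basis X (subgroup_lie_algebra \<A> V)"
begin

lemma W_0: "0 \<in> W" and W_add: "x \<in> W \<Longrightarrow> y \<in> W \<Longrightarrow> x + y \<in> W" and W_minus: "x \<in> W \<Longrightarrow> - x \<in> W"
  and W_dil: "r > 0 \<Longrightarrow> x \<in> W \<Longrightarrow> \<delta> r x \<in> W"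
  using homogeneous_W by (auto simp: homogeneous_subgroup_def lie_subgroup_def add_subgroup_def image_subset_iff)

lemma V_0: "0 \<in> V" and V_add: "x \<in> V \<Longrightarrow> y \<in> V \<Longrightarrow> x + y \<in> V" and V_minus: "x \<in> V \<Longrightarrow> - x \<in> V"
  and V_dil: "r > 0 \<Longrightarrow> x \<in> V \<Longrightarrow> \<delta> r x \<in> V"
  using homogeneous_V by (auto simp: homogeneous_subgroup_def lie_subgroup_def add_subgroup_def image_subset_iff)

lemma WV_0: "x \<in> W \<Longrightarrow> x \<in> V \<Longrightarrow> x = 0"
  using complementary by (auto simp: complementary_def)

lemma splitting_unique:
  assumes "w \<in> W" "v \<in> V" "w' \<in> W" "v' \<in> V" "w + v = w' + v'"
  shows "w = w'" "v = v'"
proof -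
  have eq: "- w' + w = v' - v"
    using assms(5) by (metis add.assoc add_diff_cancel minus_add_cancel)
  have "- w' + w \<in> W" using assms by (simp add: W_add W_minus)
  moreover have "- w' + w \<in> V" unfolding eq using V_add[OF assms(4) V_minus[OF assms(2)]] by simp
  ultimately have "- w' + w = 0" by (rule WV_0)
  then show "w = w'" by (metis add.right_neutral add_minus_cancel)
  then show "v = v'" using assms(5) by simp
qed

abbreviation pW :: "'g \<Rightarrow> 'g" where "pW \<equiv> proj_W W V"
abbreviation pV :: "'g \<Rightarrow> 'g" where "pV \<equiv> proj_V W V"

lemma proj_eq:
  assumes "w \<in> W" "v \<in> V"
  shows "pW (w + v) = w" "pV (w + v) = v"
proof -
  show "pW (w + v) = w"
    unfolding proj_W_def
  proof (rule the_equality)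
    fix w' assume "w' \<in> W \<and> (\<exists>v'\<in>V. w + v = w' + v')"
    then show "w' = w" using splitting_unique(1)[OF assms] by metis
  qed (use assms in blast)
  show "pV (w + v) = v"
    unfolding proj_V_def
  proof (rule the_equality)
    fix v' assume "v' \<in> V \<and> (\<exists>w'\<in>W. w + v = w' + v')"
    then show "v' = v" using splitting_unique(2)[OF assms] by metis
  qed (use assms in blast)
qed

lemma proj: "pW x \<in> W" "pV x \<in> V" "x = pW x + pV x"
proof -
  have "x \<in> {w + v | w v. w \<in> W \<and> v \<in> V}"
    using complementary by (simp add: complementary_def)
  then obtain w v where "w \<in> W" "v \<in> V" "x = w + v" by blast
  then show "pW x \<in> W" "pV x \<in> V" "x = pW x + pV x" using proj_eq by auto
qed

lemma pW_eq: "pW x = x - pV x"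
  using proj(3)[of x] by (metis add_diff_cancel)

lemma proj_dil:
  assumes "r > 0"
  shows "pW (\<delta> r x) = \<delta> r (pW x)" "pV (\<delta> r x) = \<delta> r (pV x)"
proof -
  have "\<delta> r x = \<delta> r (pW x) + \<delta> r (pV x)"
    using proj(3)[of x] dil_add[OF assms] by metis
  then show "pW (\<delta> r x) = \<delta> r (pW x)" "pV (\<delta> r x) = \<delta> r (pV x)"
    using proj_eq[OF W_dil[OF assms proj(1)] V_dil[OF assms proj(2)]] by metis+
qed

subsection \<open>The horizontal factor\<close>

text \<open>The Lie algebra of V in terms of velocities, as \<open>subgroup_lie_algebra_V\<close>
  will show. Membership is tested at time 1 only; dilations and inverses supply the rest of the
  line.\<close>

definition v0 :: "'e set" where "v0 = {u. LF u \<in> L 1 \<and> E u \<in> V}"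

lemma dil_E1: "r > 0 \<Longrightarrow> u \<in> v0 \<Longrightarrow> \<delta> r (E u) = E (r *\<^sub>R u)"
  using dil_E[of r 1 u] step_ge_1 by (simp add: v0_def)

lemma V_eq: "V = E ` v0"
proof (intro equalityI subsetI)
  fix v assume v: "v \<in> V"
  then obtain Y where Y: "Y \<in> L 1" "v = lie_exp \<A> Y"
    using horizontal_V by (auto simp: horizontal_def)
  have "Y \<in> lie_algebra \<A>"
    using Y(1) decomposition step_ge_1 unfolding direct_sum_decomposition_def by fastforce
  then obtain u where "Y = LF u" using lie_algebra_eq by auto
  then show "v \<in> E ` v0" using v Y by (auto simp: v0_def E_def)
qed (auto simp: v0_def)

lemma L1_subspace: "module.subspace fscale (L 1)"
  using decomposition step_ge_1 unfolding direct_sum_decomposition_def by auto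

lemma v0_scale: assumes "u \<in> v0" shows "r *\<^sub>R u \<in> v0"
proof -
  interpret vector_space fscale by (rule vector_space_fscale)
  have L: "LF (r *\<^sub>R u) \<in> L 1" for r
    using assms L1_subspace by (simp add: v0_def LF_scale subspace_scale)
  have pos: "E (r *\<^sub>R u) \<in> V" if "r > 0" for r
    using that assms V_dil dil_E1 by (metis (mono_tags, lifting) mem_Collect_eq v0_def)
  have "E (r *\<^sub>R u) \<in> V"
  proof (cases r "0 :: real" rule: linorder_cases)
    case less
    then have "E ((- r) *\<^sub>R u) \<in> V" by (intro pos) simp
    then show ?thesis using V_minus E_uminus[of "(- r) *\<^sub>R u"] by fastforce
  qed (use pos V_0 in auto)
  with L show ?thesis by (simp add: v0_def)
qed

text \<open>
  If \<open>E u + E w = E z\<close> with all three vectors horizontal, then dilating and differentiating at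
  \<open>0\<close> gives \<open>z = u + w\<close>.  Hence the exponential map is additive on \<open>v0\<close>, and \<open>V\<close> is Abelian.
\<close>

lemma v0_add:
  assumes "u \<in> v0" "w \<in> v0"
  shows "u + w \<in> v0" "E (u + w) = E u + E w"
proof -
  have "E u + E w \<in> V" using assms V_add by (simp add: v0_def)
  then obtain z where z: "z \<in> v0" "E u + E w = E z" using V_eq by auto
  have "E (r *\<^sub>R u) + E (r *\<^sub>R w) = E (r *\<^sub>R z)" if "r > 0" for r
    using that assms z dil_E1 dil_add[OF that, of "E u" "E w"] by simp
  then have "z = u + w" by (rule E_additive_ray)
  with z show "u + w \<in> v0" "E (u + w) = E u + E w" by auto
qed

lemma v0_inj: "u \<in> v0 \<Longrightarrow> w \<in> v0 \<Longrightarrow> E u = E w \<Longrightarrow> u = w"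
  by (rule E_inj_ray) (metis dil_E1)

lemma v0_0: "0 \<in> v0"
proof -
  have "0 \<in> V" by (rule V_0)
  then obtain u where "u \<in> v0" using V_eq by auto
  from v0_scale[OF this, of 0] show ?thesis by simp
qed

lemma v0_dyadic: "u \<in> v0 \<Longrightarrow> E (2 ^ n *\<^sub>R u) = dbl n (E u)"
proof (induction n arbitrary: u)
  case (Suc n)
  have "E (2 ^ n *\<^sub>R (u + u)) = dbl n (E (u + u))"
    using Suc v0_add(1) by blast
  then show ?case using v0_add(2)[OF Suc.prems Suc.prems]
    by (simp add: funpow_Suc_right scaleR_2[symmetric] mult.commute del: funpow.simps)
qed simp

text \<open>The point is that a field whose whole one-parameter subgroup lies in V is horizontal.
  Each \<open>E (t *\<^sub>R u)\<close> is the exponential of some horizontal \<open>l t\<close>,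
  and doubling forces l(1) = 2^n l(2^-n). So the curves of u and of l(1) agree at all times 2^-n,
  and so do their velocities at 0.\<close>

lemma subgroup_lie_algebra_V: "LF u \<in> subgroup_lie_algebra \<A> V \<longleftrightarrow> u \<in> v0"
proof -
  have eq: "LF u \<in> subgroup_lie_algebra \<A> V \<longleftrightarrow> (\<forall>t. E (t *\<^sub>R u) \<in> V)"
    by (simp add: subgroup_lie_algebra_def lie_algebra_eq E_def LF_scale)
  show ?thesis
  proof
    assume "u \<in> v0"
    then show "LF u \<in> subgroup_lie_algebra \<A> V"
      unfolding eq using v0_scale by (auto simp: v0_def)
  next
    assume "LF u \<in> subgroup_lie_algebra \<A> V"
    then have "\<forall>t. \<exists>w. w \<in> v0 \<and> E (t *\<^sub>R u) = E w"
      unfolding eq using V_eq by blast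
    then obtain l where l: "\<And>t. l t \<in> v0" "\<And>t. E (t *\<^sub>R u) = E (l t)" by metis
    have dyad: "E ((1 / 2 ^ n) *\<^sub>R u) = E ((1 / 2 ^ n) *\<^sub>R l 1)" for n
    proof -
      have "E (l 1) = dbl n (E ((1 / 2 ^ n) *\<^sub>R u))"
        using add_hom_dbl[of "\<lambda>t. E (t *\<^sub>R u)" 1 n] E_add l(2)[of 1] by simp
      also have "\<dots> = E (2 ^ n *\<^sub>R l (1 / 2 ^ n))"
        using v0_dyadic[OF l(1)] l(2) by simp
      finally have "l 1 = 2 ^ n *\<^sub>R l (1 / 2 ^ n)"
        using v0_inj l(1) v0_scale by blast
      then have "(1 / 2 ^ n) *\<^sub>R l 1 = l (1 / 2 ^ n)" by simp
      then show ?thesis using l(2) by simp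
    qed
    have lim: "((\<lambda>n. (1 / (1 / 2 ^ n)) *\<^sub>R (c (E ((1 / 2 ^ n) *\<^sub>R w)) - c 0)) \<longlonglongrightarrow> w)" for w
    proof -
      have "((\<lambda>r. (1 / r) *\<^sub>R (c (E (r *\<^sub>R w)) - c 0)) \<longlongrightarrow> w) (at_right 0)"
        by (rule vtang_lim[OF tang_mono[OF E_vtang]]) auto
      moreover have "filterlim (\<lambda>n. 1 / 2 ^ n :: real) (at_right 0) sequentially"
        by (intro tendsto_imp_filterlim_at_right)
           (use LIMSEQ_inverse_realpow_zero[of 2] in \<open>auto simp: inverse_eq_divide\<close>)
      ultimately show ?thesis by (rule filterlim_compose)
    qed
    have "u = l 1" using LIMSEQ_unique[OF lim[of u]] lim[of "l 1"] dyad by simp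
    then show "u \<in> v0" using l(1) by simp
  qed
qed

section \<open>Linear coordinates on the horizontal factor\<close>

definition xi :: "'k \<Rightarrow> 'e" where "xi i = (SOME u. X i = LF u)"

lemma span_X: "module.span fscale (range X) = LF ` v0" and inj_X: "inj X"
  and indep_X: "\<not> module.dependent fscale (range X)"
proof -
  have "subgroup_lie_algebra \<A> V \<subseteq> range LF"
    using lie_algebra_eq by (auto simp: subgroup_lie_algebra_def)
  then have "subgroup_lie_algebra \<A> V = LF ` v0"
    using subgroup_lie_algebra_V by blast
  then show "module.span fscale (range X) = LF ` v0" "inj X" "\<not> module.dependent fscale (range X)"
    using basis by (auto simp: field_basis_def)
qed

lemma xi: "X i = LF (xi i)" "xi i \<in> v0"
proof -
  interpret vector_space fscale by (rule vector_space_fscale)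
  have "X i \<in> LF ` v0" unfolding span_X[symmetric] by (rule span_base) simp
  then obtain u where u: "u \<in> v0" "X i = LF u" by blast
  then show "X i = LF (xi i)" unfolding xi_def by (metis (mono_tags) someI)
  then show "xi i \<in> v0" using u LF_inj by metis
qed

definition J :: "real ^ 'k \<Rightarrow> 'e" where "J a = (\<Sum>i\<in>UNIV. (a $ i) *\<^sub>R xi i)"

lemma J_linear: "J (a + b) = J a + J b" "J (r *\<^sub>R a) = r *\<^sub>R J a" "J 0 = 0"
  by (simp_all add: J_def scaleR_add_left sum.distrib scaleR_sum_right)

lemma LF_J: "LF (J a) = (\<Sum>i\<in>UNIV. fscale (a $ i) (X i))"
  by (simp add: J_def LF_sum LF_scale xi)

lemma J_inj: "J a = 0 \<Longrightarrow> a = 0"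
proof -
  interpret vector_space fscale by (rule vector_space_fscale)
  assume "J a = 0"
  then have sum0: "(\<Sum>i\<in>UNIV. fscale (a $ i) (X i)) = 0"
    using LF_J[of a] LF_0 by simp
  let ?u = "\<lambda>x. a $ (inv X x)"
  have "(\<Sum>x\<in>range X. fscale (?u x) x) = 0"
    using sum0 by (simp add: sum.reindex[OF inj_X] inv_f_f[OF inj_X])
  then have "\<forall>x\<in>range X. ?u x = 0"
    using indep_X dependent_finite[of "range X"] by force
  then have "?u (X i) = 0" for i by blast
  then have "a $ i = 0" for i by (simp add: inv_f_f[OF inj_X])
  then show "a = 0" by (simp add: vec_eq_iff)
qed

lemma range_J: "range J = v0"
proof -
  interpret vector_space fscale by (rule vector_space_fscale)
  have "LF ` range J = LF ` v0"
  proof -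
    have "module.span fscale (range X) = range (\<lambda>u. \<Sum>x\<in>range X. fscale (u x) x)"
      by (rule span_finite) simp
    also have "\<dots> = range (\<lambda>a :: real ^ 'k. \<Sum>i\<in>UNIV. fscale (a $ i) (X i))"
    proof (intro equalityI image_subsetI)
      fix u :: "'g field \<Rightarrow> real"
      show "(\<Sum>x\<in>range X. fscale (u x) x) \<in> range (\<lambda>a :: real ^ 'k. \<Sum>i\<in>UNIV. fscale (a $ i) (X i))"
        by (rule image_eqI[of _ _ "\<chi> i. u (X i)"]) (simp_all add: sum.reindex[OF inj_X])
    next
      fix a :: "real ^ 'k"
      show "(\<Sum>i\<in>UNIV. fscale (a $ i) (X i)) \<in> range (\<lambda>u. \<Sum>x\<in>range X. fscale (u x) x)"
        by (rule image_eqI[of _ _ "\<lambda>x. a $ inv X x"])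
           (simp_all add: sum.reindex[OF inj_X] inv_f_f[OF inj_X])
    qed
    also have "\<dots> = LF ` range J" by (simp add: LF_J image_image)
    finally show ?thesis using span_X by simp
  qed
  then show ?thesis using LF_inj by (metis inj_image_eq_iff injI)
qed

lemma J_in: "J a \<in> v0" using range_J by blast

definition EJ :: "real ^ 'k \<Rightarrow> 'g" where "EJ a = E (J a)"

lemma EJ_add: "EJ (a + b) = EJ a + EJ b"
  by (simp add: EJ_def J_linear v0_add J_in)

lemma EJ_0 [simp]: "EJ 0 = 0" by (simp add: EJ_def J_linear)

lemma EJ_minus: "EJ (- a) = - EJ a"
  using EJ_add[of "- a" a] by (simp add: eq_neg_iff_add_eq_0)

lemma EJ_inj: "EJ a = EJ b \<Longrightarrow> a = b"
proof -
  assume "EJ a = EJ b"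
  then have "EJ (a - b) = 0" using EJ_add[of a "- b"] EJ_minus[of b] by simp
  then have "J (a - b) = 0" using v0_inj[OF J_in v0_0] by (simp add: EJ_def)
  then have "a - b = 0" by (rule J_inj)
  then show ?thesis by simp
qed

lemma EJ_in: "EJ a \<in> V" using J_in by (simp add: EJ_def v0_def)

lemma V_eq_EJ: "V = range EJ"
proof -
  have "E ` range J = range EJ" by (simp add: EJ_def image_image)
  with range_J have "E ` v0 = range EJ" by (rule subst)
  with V_eq show ?thesis by (rule trans)
qed

lemma EJ_dil: "r > 0 \<Longrightarrow> \<delta> r (EJ a) = EJ (r *\<^sub>R a)"
  by (simp add: EJ_def J_linear dil_E1 J_in)

abbreviation ec :: "'g \<Rightarrow> real ^ 'k" where "ec \<equiv> exp_coords \<A> X"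

lemma ec_EJ [simp]: "ec (EJ a) = a"
proof -
  have "ec v = (THE a. v = EJ a)" for v
    by (simp add: exp_coords_def EJ_def E_def LF_J)
  then show ?thesis using EJ_inj by (simp add: the_equality)
qed

lemma EJ_ec: "v \<in> V \<Longrightarrow> EJ (ec v) = v"
  using V_eq_EJ by auto

lemma ec_add: "v \<in> V \<Longrightarrow> w \<in> V \<Longrightarrow> ec (v + w) = ec v + ec w"
  by (metis EJ_add EJ_ec ec_EJ)

lemma ec_dil: "r > 0 \<Longrightarrow> v \<in> V \<Longrightarrow> ec (\<delta> r v) = r *\<^sub>R ec v"
  by (metis EJ_dil EJ_ec ec_EJ)

lemma gnorm_EJ_scale: "gnorm (EJ (r *\<^sub>R a)) = \<bar>r\<bar> * gnorm (EJ a)"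
proof (cases r "0 :: real" rule: linorder_cases)
  case less
  then have "gnorm (EJ ((- r) *\<^sub>R a)) = (- r) * gnorm (EJ a)"
    by (subst EJ_dil[symmetric]) (auto simp: gnorm_dil)
  then show ?thesis using less EJ_minus[of "(- r) *\<^sub>R a"] by simp
next
  case greater
  then show ?thesis by (subst EJ_dil[symmetric]) (auto simp: gnorm_dil)
qed simp

text \<open>In these coordinates the homogeneous norm is an ordinary norm on V: subadditive as
  \<open>EJ\<close> is a homomorphism, absolutely homogeneous as V is horizontal. Coordinate vectors
  bound it from above, and compactness of the sphere bounds it from below in
  \<open>gnorm_EJ_ge\<close>.\<close>

lemma gnorm_EJ_le: obtains C where "C > 0" "\<And>a. gnorm (EJ a) \<le> C * norm a"
proof -
  define C where "C = (\<Sum>i\<in>UNIV. gnorm (EJ (axis i 1))) + 1"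
  have sum_le: "gnorm (EJ (\<Sum>i\<in>I. f i)) \<le> (\<Sum>i\<in>I. gnorm (EJ (f i)))" for f and I :: "'k set"
  proof (induction I rule: infinite_finite_induct)
    case (insert i I)
    then show ?case
      using gnorm_triangle[of "EJ (f i)" "EJ (sum f I)"] by (simp add: EJ_add)
  qed auto
  have "gnorm (EJ a) \<le> C * norm a" for a
  proof -
    have "gnorm (EJ a) = gnorm (EJ (\<Sum>i\<in>UNIV. (a $ i) *\<^sub>R axis i 1))"
      by (simp add: basis_expansion flip: scalar_mult_eq_scaleR)
    also have "\<dots> \<le> (\<Sum>i\<in>UNIV. \<bar>a $ i\<bar> * gnorm (EJ (axis i 1)))"
      using sum_le[of "\<lambda>i. (a $ i) *\<^sub>R axis i 1" UNIV] by (simp add: gnorm_EJ_scale)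
    also have "\<dots> \<le> (\<Sum>i\<in>UNIV. norm a * gnorm (EJ (axis i 1)))"
      by (intro sum_mono mult_right_mono component_le_norm_cart) auto
    also have "\<dots> \<le> C * norm a"
      by (simp add: C_def algebra_simps flip: sum_distrib_left)
    finally show ?thesis .
  qed
  moreover have "C > 0" unfolding C_def by (intro add_nonneg_pos sum_nonneg) auto
  ultimately show ?thesis using that by blast
qed

lemma EJ_continuous: "continuous_on S EJ"
proof -
  obtain C where C: "C > 0" "\<And>a. gnorm (EJ a) \<le> C * norm a" using gnorm_EJ_le by metis
  have "dist (EJ a) (EJ b) \<le> C * dist a b" for a b
  proof -
    have "dist (EJ a) (EJ b) = gnorm (EJ (b - a))"
      using EJ_add[of "- a" b] by (simp add: dist_eq_gnorm EJ_minus)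
    then show ?thesis using C(2)[of "b - a"] by (simp add: dist_norm norm_minus_commute)
  qed
  then show ?thesis
    using C(1) by (intro lipschitz_on_continuous_on[of C] lipschitz_onI) auto
qed

lemma gnorm_EJ_ge: obtains k where "k > 0" "\<And>a. k * norm a \<le> gnorm (EJ a)"
proof -
  let ?S = "sphere (0 :: real ^ 'k) 1"
  have "?S \<noteq> {}" by simp
  moreover have "continuous_on ?S (\<lambda>a. gnorm (EJ a))"
    unfolding gnorm_def by (intro continuous_intros EJ_continuous)
  ultimately obtain m where m: "m \<in> ?S" "\<And>a. a \<in> ?S \<Longrightarrow> gnorm (EJ m) \<le> gnorm (EJ a)"
    using continuous_attains_inf[of ?S] compact_sphere by blast
  have "EJ m \<noteq> 0" using m(1) EJ_inj[of m 0] by auto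
  then have pos: "gnorm (EJ m) > 0" using gnorm_eq_0[of "EJ m"] gnorm_nonneg[of "EJ m"] by linarith
  have "gnorm (EJ m) * norm a \<le> gnorm (EJ a)" for a
  proof (cases "a = 0")
    case False
    then have "gnorm (EJ m) \<le> gnorm (EJ ((1 / norm a) *\<^sub>R a))" by (intro m(2)) auto
    then show ?thesis using False by (simp add: gnorm_EJ_scale field_simps)
  qed simp
  with pos show ?thesis using that by blast
qed

subsection \<open>The complementary factor\<close>

text \<open>A subgroup that is closed near 0 is closed. Near 0 it is a slice by a subspace in a
  submanifold chart; a point of the closure is brought there by the inverse of a nearby element of W
  and then moved back.\<close>

lemma W_closed: "closed W"
proof -
  have "embedded_submanifold \<A> W"
    using homogeneous_W by (simp add: homogeneous_subgroup_def lie_subgroup_def)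
  then obtain S :: "'e set" where S: "subspace S" and "\<forall>p\<in>W. \<exists>T k. chart (T, k) \<and>
      (\<forall>C\<in>\<A>. smooth_compat (T, k) C) \<and> p \<in> T \<and> k ` (T \<inter> W) = k ` T \<inter> S"
    unfolding embedded_submanifold_def by (elim exE conjE)
  from this(2)[rule_format, OF W_0]
  obtain T k where T: "chart (T, k)" "0 \<in> T" "k ` (T \<inter> W) = k ` T \<inter> S"
    by (elim exE conjE)
  have Tk: "open T" "homeomorphism T (k ` T) k (inv_into T k)" using T(1) by (auto simp: chart_def)
  have kc: "continuous_on T k" using Tk(2) by (simp add: homeomorphism_def)
  have ki: "inv_into T k (k x) = x" if "x \<in> T" for x
    using Tk(2) that by (simp add: homeomorphism_def)
  have local: "z \<in> W" if z: "z \<in> closure W" "z \<in> T" for z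
  proof -
    obtain w where w: "\<forall>n. w n \<in> W" "w \<longlonglongrightarrow> z" using z(1) closure_sequential by blast
    have "\<forall>\<^sub>F n in sequentially. w n \<in> T"
      using topological_tendstoD[OF w(2) Tk(1) z(2)] .
    then have "\<forall>\<^sub>F n in sequentially. k (w n) \<in> S"
      by eventually_elim (use w(1) T(3) in blast)
    moreover have "isCont k z"
      using kc Tk(1) z(2) continuous_on_eq_continuous_at by blast
    then have "(\<lambda>n. k (w n)) \<longlonglongrightarrow> k z" using w(2) by (rule isCont_tendsto_compose)
    ultimately have "k z \<in> S"
      using closed_subspace[OF S] Lim_in_closed_set[of S "\<lambda>n. k (w n)" sequentially "k z"] by simp
    then have "k z \<in> k ` (T \<inter> W)" using z(2) T(3) by blast
    then obtain y where y: "y \<in> T" "y \<in> W" "k z = k y" by blast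
    then have "z = y" using ki[OF y(1)] ki[OF z(2)] by simp
    then show ?thesis using y(2) by simp
  qed
  have "x \<in> W" if x: "x \<in> closure W" for x
  proof -
    have approx: "\<exists>y\<in>W. dist y x < d" if "d > 0" for d
      using x that closure_approachable[of x W] by simp
    obtain e where e: "e > 0" "ball 0 e \<subseteq> T" using Tk(1) T(2) open_contains_ball by blast
    obtain w where w: "w \<in> W" "dist w x < e" using approx[OF e(1)] by blast
    then have "gnorm (- w + x) < e" using dist_eq_gnorm[of w x] by simp
    then have "- w + x \<in> ball 0 e" by (simp add: gnorm_def)
    then have "- w + x \<in> T" using e(2) by blast
    moreover have "- w + x \<in> closure W"
    proof (rule iffD2[OF closure_approachable], intro allI impI)
      fix d :: real assume "d > 0"
      then obtain y where y: "y \<in> W" "dist y x < d" using approx by blast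
      have "- w + y \<in> W" using w(1) y(1) by (intro W_add W_minus)
      moreover have "dist (- w + y) (- w + x) < d" using y(2) by (simp add: dist_add_left)
      ultimately show "\<exists>y\<in>W. dist y (- w + x) < d" by blast
    qed
    ultimately have "- w + x \<in> W" by (intro local)
    then have "w + (- w + x) \<in> W" by (rule W_add[OF w(1)])
    then show ?thesis by (simp flip: add.assoc)
  qed
  then have "closure W \<subseteq> W" by blast
  then show ?thesis using closure_subset_eq by blast
qed

text \<open>By homogeneity the V-component may be taken on the unit sphere. This is a compact set
  that avoids the closed set W, as W and V meet only in 0, so its distance to W is positive.\<close>

lemma gnorm_pV_le: obtains C where "C > 0" "\<And>x. gnorm (pV x) \<le> C * gnorm x"
proof -
  let ?K = "EJ ` sphere 0 1"
  have K: "compact ?K" by (intro compact_continuous_image EJ_continuous compact_sphere)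
  have "\<exists>d>0. \<forall>x\<in>?K. d \<le> infdist x W"
  proof -
    have "continuous_on ?K (\<lambda>x. infdist x W)" by (intro continuous_intros)
    moreover have "?K \<noteq> {}" by simp
    ultimately obtain m where m: "m \<in> ?K" "\<forall>x\<in>?K. infdist m W \<le> infdist x W"
      using continuous_attains_inf[OF K] by blast
    then obtain a where a: "a \<in> sphere 0 1" "m = EJ a" by blast
    then have "m \<noteq> 0" using EJ_inj[of a 0] by auto
    then have "m \<notin> W" using WV_0 EJ_in a(2) by blast
    then have "infdist m W > 0"
      using W_closed W_0 in_closed_iff_infdist_zero infdist_nonneg
      by (metis empty_iff less_eq_real_def)
    then show ?thesis using m(2) by blast
  qed
  then obtain d where d: "d > 0" "\<And>x. x \<in> ?K \<Longrightarrow> d \<le> infdist x W" by blast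
  obtain C where C: "C > 0" "\<And>a. gnorm (EJ a) \<le> C * norm a" using gnorm_EJ_le by metis
  have "gnorm (pV x) \<le> C / d * gnorm x" for x
  proof -
    obtain a where a: "pV x = EJ a" using proj(2)[of x] V_eq_EJ by auto
    show ?thesis
    proof (cases "a = 0")
      case False
      let ?r = "1 / norm a"
      have r: "?r > 0" using False by simp
      have "d \<le> infdist (EJ (?r *\<^sub>R a)) W" using False by (intro d(2)) auto
      \<comment> \<open>The norm of a product is the distance of its second factor from the inverse
        of its first; here that inverse is a point of W and the product is the rescaled x.\<close>
      also have "\<dots> \<le> dist (EJ (?r *\<^sub>R a)) (- \<delta> ?r (pW x))"
        using r by (intro infdist_le W_minus W_dil proj(1))
      also have "\<dots> = gnorm (\<delta> ?r (pW x) + EJ (?r *\<^sub>R a))"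
        by (subst dist_commute) (simp add: dist_eq_gnorm)
      also have "\<dots> = gnorm (\<delta> ?r x)"
        using proj(3)[of x] a r by (metis EJ_dil dil_add)
      also have "\<dots> = gnorm x / norm a" using gnorm_dil[OF r, of x] by simp
      finally have "norm a \<le> gnorm x / d" using False d(1) by (simp add: field_simps)
      then have "C * norm a \<le> C * (gnorm x / d)" using C(1) by (intro mult_left_mono) auto
      then show ?thesis using a C(2)[of a] by simp
    qed (use a C d in simp)
  qed
  moreover have "C / d > 0" using C d by simp
  ultimately show ?thesis using that by blast
qed

section \<open>Powers of elements near the identity\<close>

primrec nmul :: "nat \<Rightarrow> 'g \<Rightarrow> 'g" where
  "nmul 0 a = 0"
| "nmul (Suc n) a = nmul n a + a"

lemma nmul_Suc: "nmul (Suc n) a = a + nmul n a"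
proof (induction n)
  case (Suc n)
  have "nmul (Suc (Suc n)) a = (a + nmul n a) + a" using Suc by simp
  then show ?case by (simp add: add.assoc)
qed simp

lemma nmul_E: "nmul n (E u) = E (real n *\<^sub>R u)"
proof (induction n)
  case (Suc n)
  have "E (real (Suc n) *\<^sub>R u) = E (real n *\<^sub>R u) + E (1 *\<^sub>R u)"
    by (subst E_add[symmetric]) (simp add: add.commute)
  then show ?case using Suc by simp
qed simp

lemma nmul_W: "a \<in> W \<Longrightarrow> nmul n a \<in> W"
  by (induction n) (auto simp: W_0 W_add)

text \<open>
  Telescoping: \<open>a\<^sup>k\<close> and \<open>b\<^sup>k\<close> are joined by the products \<open>a\<^sup>i b\<^sup>k\<^sup>-\<^sup>i\<close>, and consecutive ones differ
  by at most \<open>K\<^sup>2\<close> times the distance of \<open>a\<close> and \<open>b\<close> in the chart.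
\<close>

lemma nmul_close:
  assumes K: "K \<ge> 0" and prod: "product_lipschitz r K"
    and b: "\<And>i. i \<le> N \<Longrightarrow> near0 (r / 2) (nmul i b)" and a: "near0 r a"
    and e: "real N * (K * K + K) * norm (c a - c b) \<le> r / 2"
    and k: "k \<le> N"
  shows "nmul k a \<in> U \<and> norm (c (nmul k a) - c (nmul k b)) \<le> real k * (K * K + K) * norm (c a - c b)"
  using k
proof (induction k rule: less_induct)
  case (less k)
  let ?e = "norm (c a - c b)" and ?M = "K * K + K"
  have r0: "0 \<le> r" using a norm_ge_zero order_trans unfolding near0_def by blast
  have mono: "near0 (r / 2) x \<Longrightarrow> near0 r x" for x using r0 by (simp add: near0_def)
  have add: "near0 r x" if "x \<in> U" "norm (c x - c y) \<le> r / 2" "near0 (r / 2) y" for x y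
    using that norm_triangle_ineq[of "c x - c y" "c y - c 0"] by (simp add: near0_def)
  have M0: "?M \<ge> 0" using K by simp
  \<comment> \<open>This is why the induction is strong: every joining product begins with a power
    of \<open>a\<close>, which has to be in the ball before the Lipschitz estimate applies. Powers
    of \<open>b\<close> occupy radius r / 2, and the other half is for the error.\<close>
  have ai: "near0 r (nmul i a)" if "i < k" for i
  proof -
    have IH: "nmul i a \<in> U" "norm (c (nmul i a) - c (nmul i b)) \<le> real i * ?M * ?e"
      using less.IH[OF that] less.prems that by auto
    have "real i * ?M * ?e \<le> real N * ?M * ?e"
      using that less.prems M0 by (intro mult_right_mono) auto
    then have "norm (c (nmul i a) - c (nmul i b)) \<le> r / 2" using IH(2) e by linarith
    then show ?thesis using IH(1) b[of i] that less.prems by (intro add) auto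
  qed
  show ?case
  proof (cases k)
    case 0
    then show ?thesis using zero_in by simp
  next
    case (Suc m)
    have N1: "1 \<le> N" using Suc less.prems by simp
    \<comment> \<open>The summand K in K * K + K serves this bound, which keeps a product with one
      exchanged factor inside the ball; K * K alone may be smaller than K.\<close>
    have "K * ?e \<le> ?M * ?e" using K by (intro mult_right_mono) auto
    also have "\<dots> \<le> real N * (?M * ?e)"
      using N1 M0 mult_right_mono[of 1 "real N" "?M * ?e"] by simp
    finally have Ke: "K * ?e \<le> r / 2" using e by (simp add: mult.assoc)
    have b1: "near0 r b" using mono[OF b[of 1]] N1 by simp
    define z where "z i = nmul i a + nmul (k - i) b" for i
    have "norm (c (z (Suc i)) - c (z i)) \<le> ?M * ?e" if "i < k" for i
    proof -
      let ?q = "nmul (k - Suc i) b"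
      have "k - i = Suc (k - Suc i)" using that by simp
      then have bq: "b + ?q = nmul (k - i) b" by (simp only: nmul_Suc)
      have z: "z (Suc i) = nmul i a + (a + ?q)" "z i = nmul i a + (b + ?q)"
        unfolding z_def bq by (simp_all add: add.assoc)
      have q: "near0 r ?q" using mono[OF b[of "k - Suc i"]] less.prems by simp
      have bqU: "near0 (r / 2) (b + ?q)" unfolding bq using b[of "k - i"] less.prems by simp
      have 1: "norm (c (a + ?q) - c (b + ?q)) \<le> K * ?e"
        using product_lipschitzD(2)[OF prod a q b1 q] by simp
      have aqU: "near0 r (a + ?q)"
        using product_lipschitzD(1)[OF prod a q] 1 Ke bqU by (intro add) auto
      have "norm (c (z (Suc i)) - c (z i)) \<le> K * norm (c (a + ?q) - c (b + ?q))"
        unfolding z using product_lipschitzD(2)[OF prod ai[OF that] aqU ai[OF that] mono[OF bqU]] by simp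
      also have "\<dots> \<le> K * (K * ?e)" using 1 K by (rule mult_left_mono)
      also have "\<dots> \<le> ?M * ?e" using K by (simp add: distrib_right mult.assoc)
      finally show ?thesis .
    qed
    then have "norm (\<Sum>i<k. c (z (Suc i)) - c (z i)) \<le> (\<Sum>i<k. ?M * ?e)"
      by (intro sum_norm_le) auto
    then have "norm (c (z k) - c (z 0)) \<le> real k * ?M * ?e"
      by (simp add: sum_lessThan_telescope[of "\<lambda>i. c (z i)" k] mult.assoc)
    moreover have "nmul k a \<in> U"
      using product_lipschitzD(1)[OF prod ai[of m] a] Suc by simp
    ultimately show ?thesis by (simp add: z_def)
  qed
qed

text \<open>If the velocities coincide, \<open>dil0 w h\<close> and \<open>E (h *\<^sub>R u)\<close>
  differ by o(h) in the chart. For h = \<tau> / n the n-th powers then differ by at most a multiple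
  of n o(1/n), which tends to 0, and that of the second is \<open>E (\<tau> *\<^sub>R u)\<close>.
  This point is thus a limit of elements of W; since W is closed, it lies in both W and V.\<close>

lemma hdiff_W:
  assumes w: "w \<in> W" and u: "u \<in> v0" and hd: "hdiff w = u"
  shows "u = 0"
proof -
  obtain r K where r: "r > 0" and K: "K \<ge> 0" and prod: "product_lipschitz r K"
    by (rule product_lipschitz_near)
  have tE: "vtang (\<lambda>t. E (t *\<^sub>R u)) u {0..}" by (rule tang_mono[OF E_vtang]) auto
  have tw: "vtang (dil0 w) u {0..}" using hdiff[of w] hd by simp
  have near: "\<exists>d>0. \<forall>t. 0 \<le> t \<and> t < d \<longrightarrow> near0 (r / 2) (f t)"
    if "vtang f u {0..}" for f
  proof -
    have f: "f 0 = 0" "((\<lambda>t. c (f t)) has_derivative (\<lambda>h. h *\<^sub>R u)) (at 0 within {0..})"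
      using that by (auto simp: tang_def)
    have "((\<lambda>t. c (f t)) \<longlongrightarrow> c 0) (at 0 within {0..})"
      using has_derivative_continuous[OF f(2)] f(1) by (simp add: continuous_within)
    then have "\<forall>\<^sub>F t in at 0 within {0..}. dist (c (f t)) (c 0) < r / 2"
      using r by (intro tendstoD) auto
    with tang_eventually[OF that]
    have "\<forall>\<^sub>F t in at 0 within {0..}. near0 (r / 2) (f t)"
      by eventually_elim (auto simp: dist_norm near0_def)
    then obtain d where d: "d > 0"
      "\<And>t. t \<in> {0..} \<Longrightarrow> t \<noteq> 0 \<Longrightarrow> dist t 0 < d \<Longrightarrow> near0 (r / 2) (f t)"
      unfolding eventually_at by auto
    have "near0 (r / 2) (f t)" if "0 \<le> t" "t < d" for t
      using d(2)[of t] that f(1) near0_0 r by (cases "t = 0") auto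
    with d(1) show ?thesis by blast
  qed
  obtain d1 where d1: "d1 > 0"
    "\<And>t. 0 \<le> t \<Longrightarrow> t < d1 \<Longrightarrow> near0 (r / 2) (E (t *\<^sub>R u))"
    using near[OF tE] by blast
  obtain d2 where d2: "d2 > 0"
    "\<And>t. 0 \<le> t \<Longrightarrow> t < d2 \<Longrightarrow> near0 (r / 2) (dil0 w t)"
    using near[OF tw] by blast
  \<comment> \<open>Below d1, so that all powers up to the last, which is
    \<open>E (\<tau> *\<^sub>R u)\<close>, stay in the ball.\<close>
  define \<tau> where "\<tau> = d1 / 2"
  have \<tau>: "0 < \<tau>" "\<tau> < d1" using d1(1) by (auto simp: \<tau>_def)
  define h where "h n = \<tau> / real (Suc n)" for n
  have h: "h n > 0" for n using \<tau> by (simp add: h_def)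
  have h_lim: "h \<longlonglongrightarrow> 0" unfolding h_def
    using LIMSEQ_inverse_real_of_nat[THEN tendsto_mult_left, of \<tau>] by (simp add: divide_inverse)
  then have h_right: "filterlim h (at_right 0) sequentially"
    using h by (intro tendsto_imp_filterlim_at_right) auto
  let ?a = "\<lambda>n. dil0 w (h n)" and ?b = "\<lambda>n. E (h n *\<^sub>R u)"
  have "((\<lambda>t. (1 / t) *\<^sub>R (c (dil0 w t) - c 0) - (1 / t) *\<^sub>R (c (E (t *\<^sub>R u)) - c 0)) \<longlongrightarrow> u - u) (at_right 0)"
    by (intro tendsto_diff vtang_lim tw tE)
  then have "((\<lambda>t. (1 / t) *\<^sub>R (c (dil0 w t) - c (E (t *\<^sub>R u)))) \<longlongrightarrow> 0) (at_right 0)"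
    by (simp flip: scaleR_diff_right)
  from tendsto_norm_zero[OF filterlim_compose[OF this h_right]]
  have "(\<lambda>n. norm (c (?a n) - c (?b n)) / h n) \<longlonglongrightarrow> 0"
    using h by (simp add: less_imp_le)
  from tendsto_mult_left[OF this, of "\<tau> * (K * K + K)"]
  have lim: "(\<lambda>n. \<tau> * (K * K + K) * (norm (c (?a n) - c (?b n)) / h n)) \<longlonglongrightarrow> 0"
    by simp
  have hN: "real (Suc n) * h n = \<tau>" for n by (simp add: h_def)
  have "\<tau> * (K * K + K) * (q / h n) = real (Suc n) * (K * K + K) * q" for q n
    using h[of n] by (subst hN[of n, symmetric]) simp
  with lim have err: "(\<lambda>n. real (Suc n) * (K * K + K) * norm (c (?a n) - c (?b n))) \<longlonglongrightarrow> 0"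
    by simp
  have ev: "\<forall>\<^sub>F n in sequentially. real (Suc n) * (K * K + K) * norm (c (?a n) - c (?b n)) \<le> r / 2 \<and> h n < d2"
  proof -
    have "\<forall>\<^sub>F n in sequentially. real (Suc n) * (K * K + K) * norm (c (?a n) - c (?b n)) < r / 2"
      using err r by (intro order_tendstoD) auto
    moreover have "\<forall>\<^sub>F n in sequentially. h n < d2"
      using h_lim d2(1) by (intro order_tendstoD) auto
    ultimately show ?thesis by eventually_elim auto
  qed
  have hb: "nmul i (?b n) = E ((real i * h n) *\<^sub>R u)" for i n
    by (simp add: nmul_E)
  have close: "\<forall>\<^sub>F n in sequentially. nmul (Suc n) (?a n) \<in> U \<and>
      norm (c (nmul (Suc n) (?a n)) - c (E (\<tau> *\<^sub>R u))) \<le> real (Suc n) * (K * K + K) * norm (c (?a n) - c (?b n))"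
    using ev
  proof eventually_elim
    case (elim n)
    have nb: "near0 (r / 2) (nmul i (?b n))" if "i \<le> Suc n" for i
    proof -
      have "real i * h n \<le> real (Suc n) * h n"
        using that h[of n] by (intro mult_right_mono) auto
      then have "real i * h n < d1" using \<tau> hN[of n] by linarith
      then show ?thesis unfolding hb using h[of n] by (intro d1(2)) auto
    qed
    have na: "near0 r (?a n)"
      using d2(2)[of "h n"] elim h[of n] r by (auto simp: near0_def)
    from elim have "real (Suc n) * (K * K + K) * norm (c (?a n) - c (?b n)) \<le> r / 2" by blast
    from nmul_close[OF K prod nb na this order_refl]
    have "nmul (Suc n) (?a n) \<in> U \<and> norm (c (nmul (Suc n) (?a n)) - c (nmul (Suc n) (?b n))) \<le>
        real (Suc n) * (K * K + K) * norm (c (?a n) - c (?b n))" .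
    then show ?case by (simp only: hb hN)
  qed
  have E\<tau>: "E (\<tau> *\<^sub>R u) \<in> U" using d1(2)[of \<tau>] \<tau> by (auto simp: near0_def)
  have "(\<lambda>n. c (nmul (Suc n) (?a n)) - c (E (\<tau> *\<^sub>R u))) \<longlonglongrightarrow> 0"
  proof (rule Lim_null_comparison[OF _ err])
    show "\<forall>\<^sub>F n in sequentially. norm (c (nmul (Suc n) (?a n)) - c (E (\<tau> *\<^sub>R u))) \<le>
        real (Suc n) * (K * K + K) * norm (c (?a n) - c (?b n))"
      using close by eventually_elim blast
  qed
  then have "(\<lambda>n. c (nmul (Suc n) (?a n))) \<longlonglongrightarrow> c (E (\<tau> *\<^sub>R u))"
    by (simp only: LIM_zero_iff)
  then have "(\<lambda>n. ci (c (nmul (Suc n) (?a n)))) \<longlonglongrightarrow> ci (c (E (\<tau> *\<^sub>R u)))"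
    using E\<tau> by (intro isCont_tendsto_compose[OF ci_isCont]) auto
  moreover have "\<forall>\<^sub>F n in sequentially. ci (c (nmul (Suc n) (?a n))) = nmul (Suc n) (?a n)"
    using close by eventually_elim (rule ci_c, blast)
  ultimately have lim_a: "(\<lambda>n. nmul (Suc n) (?a n)) \<longlonglongrightarrow> E (\<tau> *\<^sub>R u)"
    using E\<tau> Lim_transform_eventually by fastforce
  have "nmul (Suc n) (?a n) \<in> W" for n
    using w h[of n] by (intro nmul_W) (simp add: dil0_def W_dil)
  then have "E (\<tau> *\<^sub>R u) \<in> W"
    by (rule closed_sequentially[OF W_closed _ lim_a])
  moreover have "\<tau> *\<^sub>R u \<in> v0" using u by (rule v0_scale)
  ultimately have "E (\<tau> *\<^sub>R u) = E 0" using WV_0 by (simp add: v0_def)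
  then have "\<tau> *\<^sub>R u = 0" using v0_inj[OF \<open>\<tau> *\<^sub>R u \<in> v0\<close> v0_0] by simp
  then show ?thesis using \<tau> by simp
qed

subsection \<open>The projection onto the horizontal factor\<close>

text \<open>
  The horizontal differential is additive, injective on \<open>V\<close> and maps \<open>W\<close> into a complement of the
  image of \<open>V\<close>; so the \<open>V\<close>-component is determined by it and is additive as well.
\<close>

lemma pV_add: "pV (x + y) = pV x + pV y"
proof -
  have "pV x \<in> E ` v0" "pV y \<in> E ` v0" "pV (x + y) \<in> E ` v0"
    using proj(2) equalityD1[OF V_eq] by blast+
  then obtain u v z where uvz: "u \<in> v0" "v \<in> v0" "z \<in> v0" "pV x = E u" "pV y = E v" "pV (x + y) = E z"
    by blast
  have hE: "hdiff (E t) = t" if "t \<in> v0" for t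
    using hdiff_E that step_ge_1 by (simp add: v0_def)
  have "hdiff x = hdiff (pW x) + hdiff (pV x)" for x
    using trans[OF arg_cong[OF proj(3)[of x], of hdiff] hdiff_add] .
  then have "hdiff x = hdiff (pW x) + u" "hdiff y = hdiff (pW y) + v"
    "hdiff (x + y) = hdiff (pW (x + y)) + z"
    using uvz hE by metis+
  then have eq: "hdiff (pW x) + hdiff (pW y) - hdiff (pW (x + y)) = z - (u + v)"
    using hdiff_add[of x y] by (simp add: algebra_simps)
  have hd0: "hdiff 0 = 0" using hdiff_add[of 0 0] by simp
  have hdm: "hdiff (- t) = - hdiff t" for t
    using hdiff_add[of "- t" t] hd0 by (simp add: eq_neg_iff_add_eq_0)
  let ?w = "pW x + pW y + (- pW (x + y))"
  have "?w \<in> W" by (intro W_add W_minus proj(1))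
  moreover have "hdiff ?w = z + (-1) *\<^sub>R (u + v)"
    using eq by (simp only: hdiff_add hdm) simp
  moreover have "z + (-1) *\<^sub>R (u + v) \<in> v0"
    using uvz v0_add(1) v0_scale by blast
  ultimately have "z + (-1) *\<^sub>R (u + v) = 0" using hdiff_W by blast
  then have "z - (u + v) = 0" by (simp only: scaleR_minus1_left add_uminus_conv_diff)
  then have "z = u + v" by (simp only: right_minus_eq)
  then show ?thesis using uvz v0_add(2) by simp
qed

definition hp :: "'g \<Rightarrow> real ^ 'k" where "hp x = ec (pV x)"

lemma hp_add: "hp (x + y) = hp x + hp y"
  unfolding hp_def pV_add by (rule ec_add[OF proj(2) proj(2)])

lemma hp_0 [simp]: "hp 0 = 0"
  using hp_add[of 0 0] by simp

lemma hp_minus: "hp (- x) = - hp x"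
proof -
  have "hp (- x) + hp x = 0" by (simp flip: hp_add)
  then show ?thesis by (simp only: eq_neg_iff_add_eq_0)
qed

lemma pV_V: "v \<in> V \<Longrightarrow> pV v = v"
  using proj_eq(2)[OF W_0, of v] by simp

lemma hp_V: "v \<in> V \<Longrightarrow> hp v = ec v"
  by (simp add: hp_def pV_V)

lemma pW_add_V:
  assumes "v \<in> V"
  shows "pW (x + v) = pW x"
proof -
  have "x + v = (pW x + pV x) + v"
    using arg_cong[OF proj(3)[of x], of "\<lambda>t. t + v"] .
  also have "\<dots> = pW x + (pV x + v)" by (rule add.assoc)
  finally have "pW (x + v) = pW (pW x + (pV x + v))" by (rule arg_cong[of _ _ pW])
  also have "\<dots> = pW x" by (rule proj_eq(1)[OF proj(1) V_add[OF proj(2) assms]])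
  finally show ?thesis .
qed

lemma hp_dil: "r > 0 \<Longrightarrow> hp (\<delta> r x) = r *\<^sub>R hp x"
  unfolding hp_def by (simp only: proj_dil(2) ec_dil[OF _ proj(2)])

lemma norm_ec_bounds:
  obtains k K where "k > 0" "K > 0" "\<And>v. v \<in> V \<Longrightarrow> k * norm (ec v) \<le> gnorm v"
    "\<And>v. v \<in> V \<Longrightarrow> gnorm v \<le> K * norm (ec v)"
proof -
  obtain k where k: "k > 0" "\<And>a. k * norm a \<le> gnorm (EJ a)" by (rule gnorm_EJ_ge) blast
  obtain K where K: "K > 0" "\<And>a. gnorm (EJ a) \<le> K * norm a" by (rule gnorm_EJ_le) blast
  show ?thesis
  proof (rule that[OF k(1) K(1)])
    fix v assume "v \<in> V"
    then show "k * norm (ec v) \<le> gnorm v" "gnorm v \<le> K * norm (ec v)"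
      using k(2)[of "ec v"] K(2)[of "ec v"] by (simp_all add: EJ_ec)
  qed
qed

lemma norm_hp_le: obtains C where "C > 0" "\<And>x. norm (hp x) \<le> C * gnorm x"
proof -
  obtain C where C: "C > 0" "\<And>x. gnorm (pV x) \<le> C * gnorm x" using gnorm_pV_le by metis
  obtain k where k: "k > 0" "\<And>v. v \<in> V \<Longrightarrow> k * norm (ec v) \<le> gnorm v"
    by (rule norm_ec_bounds) blast
  have "norm (hp x) \<le> C / k * gnorm x" for x
  proof -
    have "k * norm (hp x) \<le> C * gnorm x"
      using k(2)[OF proj(2)[of x]] C(2)[of x] by (simp add: hp_def)
    then show ?thesis using k(1) by (simp add: field_simps)
  qed
  moreover have "C / k > 0" using C k by simp
  ultimately show ?thesis using that by blast
qed

end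

section \<open>Level sets of maps that are coercive along the horizontal factor\<close>

text \<open>A bound uniform in the family passes to its supremum. This and the companion for infima
  are each applied twice, for the distance and along the fibres.\<close>

lemma cSUP_diff_le:
  fixes f g :: "'i \<Rightarrow> real"
  assumes "I \<noteq> {}" "bdd_above (f ` I)" "bdd_above (g ` I)" "\<And>i. i \<in> I \<Longrightarrow> \<bar>f i - g i\<bar> \<le> e"
  shows "\<bar>(SUP i\<in>I. f i) - (SUP i\<in>I. g i)\<bar> \<le> e"
proof -
  have "(SUP i\<in>I. f i) \<le> (SUP i\<in>I. g i) + e"
  proof (rule cSUP_least[OF assms(1)])
    fix i assume i: "i \<in> I"
    then have "f i \<le> g i + e" using assms(4)[OF i] by linarith
    also have "g i \<le> (SUP i\<in>I. g i)" by (rule cSUP_upper[OF i assms(3)])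
    finally show "f i \<le> (SUP i\<in>I. g i) + e" by simp
  qed
  moreover have "(SUP i\<in>I. g i) \<le> (SUP i\<in>I. f i) + e"
  proof (rule cSUP_least[OF assms(1)])
    fix i assume i: "i \<in> I"
    then have "g i \<le> f i + e" using assms(4)[OF i] by linarith
    also have "f i \<le> (SUP i\<in>I. f i)" by (rule cSUP_upper[OF i assms(2)])
    finally show "g i \<le> (SUP i\<in>I. f i) + e" by simp
  qed
  ultimately show ?thesis by linarith
qed

lemma cINF_diff_le:
  fixes f g :: "'i \<Rightarrow> real"
  assumes "I \<noteq> {}" "bdd_below (f ` I)" "bdd_below (g ` I)" "\<And>i. i \<in> I \<Longrightarrow> \<bar>f i - g i\<bar> \<le> e"
  shows "\<bar>(INF i\<in>I. f i) - (INF i\<in>I. g i)\<bar> \<le> e"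
proof -
  have "(INF i\<in>I. f i) - e \<le> (INF i\<in>I. g i)"
  proof (rule cINF_greatest[OF assms(1)])
    fix i assume i: "i \<in> I"
    have "(INF i\<in>I. f i) \<le> f i" by (rule cINF_lower[OF assms(2) i])
    then show "(INF i\<in>I. f i) - e \<le> g i" using assms(4)[OF i] by linarith
  qed
  moreover have "(INF i\<in>I. g i) - e \<le> (INF i\<in>I. f i)"
  proof (rule cINF_greatest[OF assms(1)])
    fix i assume i: "i \<in> I"
    have "(INF i\<in>I. g i) \<le> g i" by (rule cINF_lower[OF assms(3) i])
    then show "(INF i\<in>I. g i) - e \<le> f i" using assms(4)[OF i] by linarith
  qed
  ultimately show ?thesis by linarith
qed

context horizontal_splitting
begin

section \<open>The gauge that controls the extension\<close>

lemma proj_0 [simp]: "pW 0 = 0" "pV 0 = 0"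
  using proj_eq[OF W_0 V_0] by simp_all

lemma gnorm_pV_le_hp: obtains K where "K > 0" "\<And>x. gnorm (pV x) \<le> K * norm (hp x)"
proof -
  obtain K where "K > 0" "\<And>v. v \<in> V \<Longrightarrow> gnorm v \<le> K * norm (ec v)"
    by (rule norm_ec_bounds) blast
  then show ?thesis using that proj(2) unfolding hp_def by blast
qed

text \<open>When w and u are the components of p, the long product is the W-component of p + g: that
  of g, conjugated by u, is appended to w. Its four multiplications cost a factor K each in the
  chart, and K1 * (1 + C) accounts for the chart norms of g and its V-component. The hypothesis
  keeps all partial products in range by the triangle inequality.\<close>

lemma conjugation_estimate:
  obtains \<rho> M where "\<rho> > 0" "M \<ge> 0" "\<And>x. gnorm x \<le> \<rho> \<Longrightarrow> x \<in> U"
    "\<And>w u g. gnorm w + 2 * gnorm u + gnorm g + gnorm (pV g) \<le> \<rho> \<Longrightarrow>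
      norm (c (w + (u + ((g - pV g) - u))) - c w) \<le> M * gnorm g"
proof -
  obtain \<rho>0 K1 where \<rho>0: "\<rho>0 > 0" "K1 \<ge> 0"
    "\<And>x. gnorm x \<le> \<rho>0 \<Longrightarrow> x \<in> U \<and> norm (c x - c 0) \<le> K1 * gnorm x"
    by (rule chart_le_gnorm) blast
  obtain r K where r: "r > 0" and K: "K \<ge> 0" and prod: "product_lipschitz r K"
    by (rule product_lipschitz_near)
  obtain C where C: "C > 0" "\<And>x. gnorm (pV x) \<le> C * gnorm x" by (rule gnorm_pV_le) blast
  define \<rho> where "\<rho> = min \<rho>0 (r / (K1 + 1))"
  have \<rho>: "\<rho> > 0" "\<rho> \<le> \<rho>0" using \<rho>0 r by (auto simp: \<rho>_def)
  have near: "near0 r x" if "gnorm x \<le> \<rho>" for x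
  proof -
    have x: "x \<in> U" "norm (c x - c 0) \<le> K1 * gnorm x" using \<rho>0(3)[of x] that \<rho>(2) by auto
    have "K1 * gnorm x \<le> (K1 + 1) * \<rho>"
      using that \<rho>0(2) by (intro mult_mono) auto
    also have "\<dots> \<le> (K1 + 1) * (r / (K1 + 1))"
      using \<rho>0(2) by (intro mult_left_mono) (auto simp: \<rho>_def)
    also have "\<dots> = r" using \<rho>0(2) by simp
    finally show ?thesis using x by (simp add: near0_def)
  qed
  define M where "M = K * (K * (K * (K * (K1 * (1 + C)))))"
  have M: "M \<ge> 0" using K \<rho>0(2) C(1) by (simp add: M_def)
  have "norm (c (w + (u + ((g - pV g) - u))) - c w) \<le> M * gnorm g"
    if sum: "gnorm w + 2 * gnorm u + gnorm g + gnorm (pV g) \<le> \<rho>" for w u g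
  proof -
    let ?g = "g + - pV g"
    have b1: "gnorm ?g \<le> gnorm g + gnorm (pV g)" using gnorm_triangle[of g "- pV g"] by simp
    have b2: "gnorm (?g + - u) \<le> gnorm g + gnorm (pV g) + gnorm u"
      using gnorm_triangle[of ?g "- u"] b1 by simp
    have b3: "gnorm (u + (?g + - u)) \<le> gnorm g + gnorm (pV g) + 2 * gnorm u"
      using gnorm_triangle[of u "?g + - u"] b2 by simp
    have pos: "0 \<le> gnorm w" "0 \<le> gnorm u" "0 \<le> gnorm g" "0 \<le> gnorm (pV g)" by simp_all
    have n0: "near0 r 0" using r near0_0 by simp
    have bd: "gnorm g \<le> \<rho>" "gnorm (- pV g) \<le> \<rho>" "gnorm ?g \<le> \<rho>" "gnorm u \<le> \<rho>" "gnorm (- u) \<le> \<rho>"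
      "gnorm (?g + - u) \<le> \<rho>" "gnorm (u + (?g + - u)) \<le> \<rho>" "gnorm w \<le> \<rho>"
      using sum b1 b2 b3 pos unfolding gnorm_minus by linarith+
    have ng: "near0 r g" "near0 r (- pV g)" "near0 r ?g" "near0 r u" "near0 r (- u)"
      "near0 r (?g + - u)" "near0 r (u + (?g + - u))" "near0 r w"
      by (rule near, rule bd)+
    have g1: "norm (c g - c 0) \<le> K1 * gnorm g" "norm (c (- pV g) - c 0) \<le> K1 * gnorm (pV g)"
      using \<rho>0(3)[of g] \<rho>0(3)[of "- pV g"] bd(1,2) \<rho>(2) by auto
    have "norm (c ?g - c (0 + 0)) \<le> K * (norm (c g - c 0) + norm (c (- pV g) - c 0))"
      by (rule product_lipschitzD(2)[OF prod ng(1,2) n0 n0])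
    also have "\<dots> \<le> K * (K1 * gnorm g + K1 * (C * gnorm g))"
      using g1 C(2)[of g] \<rho>0(2) mult_left_mono[OF C(2)[of g] \<rho>0(2)] by (intro mult_left_mono[OF _ K]) linarith
    finally have e1: "norm (c ?g - c 0) \<le> K * (K1 * (1 + C)) * gnorm g"
      by (simp add: algebra_simps)
    have "norm (c (?g + - u) - c (0 + - u)) \<le> K * (norm (c ?g - c 0) + norm (c (- u) - c (- u)))"
      by (rule product_lipschitzD(2)[OF prod ng(3,5) n0 ng(5)])
    also have "\<dots> \<le> K * (K * (K1 * (1 + C)) * gnorm g)" using e1 K by (simp add: mult_left_mono)
    finally have e2: "norm (c (?g + - u) - c (- u)) \<le> K * (K * (K1 * (1 + C)) * gnorm g)" by simp
    have "norm (c (u + (?g + - u)) - c (u + - u)) \<le> K * (norm (c u - c u) + norm (c (?g + - u) - c (- u)))"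
      by (rule product_lipschitzD(2)[OF prod ng(4,6) ng(4,5)])
    also have "\<dots> \<le> K * (K * (K * (K1 * (1 + C)) * gnorm g))" using e2 K by (simp add: mult_left_mono)
    finally have e3: "norm (c (u + (?g + - u)) - c 0) \<le> K * (K * (K * (K1 * (1 + C)) * gnorm g))" by simp
    have "norm (c (w + (u + (?g + - u))) - c (w + 0)) \<le> K * (norm (c w - c w) + norm (c (u + (?g + - u)) - c 0))"
      by (rule product_lipschitzD(2)[OF prod ng(8,7) ng(8) n0])
    also have "\<dots> \<le> K * (K * (K * (K * (K1 * (1 + C)) * gnorm g)))" using e3 K by (simp add: mult_left_mono)
    finally show ?thesis by (simp add: M_def mult.assoc)
  qed
  moreover have "x \<in> U" if "gnorm x \<le> \<rho>" for x using near[OF that] by (simp add: near0_def)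
  ultimately show ?thesis using that \<rho>(1) M by blast
qed

text \<open>
  A cut-off function of the \<open>W\<close>-component.  Moving \<open>p\<close> to \<open>p + g\<close> multiplies the \<open>W\<close>-component by
  a conjugate of the \<open>W\<close>-component of \<open>g\<close>.  Conjugation is not Lipschitz for the homogeneous norm
  but it is for the chart, so \<open>\<beta>\<close> is built from the chart norm.
\<close>

lemma cutoff:
  assumes R: "R > 0"
  obtains \<sigma> \<beta> K where "\<sigma> > 0" "K \<ge> 0" "\<beta> 0 = 0" "\<And>x. 0 \<le> \<beta> x" "\<And>x. \<beta> x \<le> 1"
    "\<And>x. gnorm x = \<sigma> \<Longrightarrow> \<beta> x = 1"
    "\<And>p q. norm (hp p) \<le> R * \<sigma> \<Longrightarrow> \<bar>\<beta> (pW p) - \<beta> (pW q)\<bar> \<le> K * dist p q"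
proof -
  obtain \<rho> M where \<rho>: "\<rho> > 0" and M: "M \<ge> 0" and \<rho>U: "\<And>x. gnorm x \<le> \<rho> \<Longrightarrow> x \<in> U"
    and est: "\<And>w u g. gnorm w + 2 * gnorm u + gnorm g + gnorm (pV g) \<le> \<rho> \<Longrightarrow>
      norm (c (w + (u + ((g - pV g) - u))) - c w) \<le> M * gnorm g"
    by (rule conjugation_estimate) blast
  obtain C where C: "C > 0" "\<And>x. gnorm (pV x) \<le> C * gnorm x" by (rule gnorm_pV_le) blast
  obtain Kv where Kv: "Kv > 0" "\<And>x. gnorm (pV x) \<le> Kv * norm (hp x)"
    by (rule gnorm_pV_le_hp) blast
  \<comment> \<open>Solves \<sigma> + 2 Kv R \<sigma> = \<rho> / 2: half of \<rho> is for w and for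
    conjugation by u, the other half for g and its V-component.\<close>
  define \<sigma> where "\<sigma> = \<rho> / (2 * (1 + 2 * (Kv * R)))"
  have KR: "Kv * R > 0" using Kv R by simp
  have \<sigma>: "\<sigma> > 0" using \<rho> KR by (simp add: \<sigma>_def)
  have "\<sigma> * (2 * (1 + 2 * (Kv * R))) = \<rho>"
    using KR by (simp add: \<sigma>_def)
  then have \<sigma>_sum: "\<sigma> + 2 * (Kv * (R * \<sigma>)) = \<rho> / 2"
    by (simp add: algebra_simps)
  have "0 < Kv * (R * \<sigma>)" using KR \<sigma> by (simp flip: mult.assoc)
  then have \<sigma>\<rho>: "\<sigma> \<le> \<rho>" using \<sigma>_sum \<rho> by simp
  \<comment> \<open>With this r0 the chart expression for \<beta> has reached the value 1 as soon as
    the norm is \<sigma> / 2, so the two branches of \<beta> agree well before \<sigma>.\<close>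
  obtain r0 where r0: "r0 > 0" "\<And>x. x \<in> U \<Longrightarrow> norm (c x - c 0) < r0 \<Longrightarrow> gnorm x < \<sigma> / 2"
    by (rule gnorm_small_if_chart_small[of "\<sigma> / 2"]) (use \<sigma> in auto)
  obtain r1 where r1: "r1 > 0" "\<And>x. x \<in> U \<Longrightarrow> norm (c x - c 0) < r1 \<Longrightarrow> gnorm x < \<sigma> / 4"
    by (rule gnorm_small_if_chart_small[of "\<sigma> / 4"]) (use \<sigma> in auto)
  \<comment> \<open>Steps shorter than \<tau> fall under the conjugation estimate and change the
    W-component by a factor of norm below \<sigma> / 4. For longer ones 1 / \<tau> is a sufficient
    Lipschitz constant, as \<beta> has values in [0, 1].\<close>
  define \<tau> where "\<tau> = min (\<rho> / (2 * (1 + C))) (r1 / (M + 1))"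
  have \<tau>: "\<tau> > 0" using \<rho> C(1) r1(1) M by (simp add: \<tau>_def)
  define \<beta> where "\<beta> x = (if gnorm x < \<sigma> then min 1 (norm (c x - c 0) / r0) else 1)" for x
  have \<beta>1: "\<beta> x = 1" if "\<sigma> / 2 \<le> gnorm x" for x
  proof (cases "gnorm x < \<sigma>")
    case True
    then have "x \<in> U" using \<sigma>\<rho> by (intro \<rho>U) simp
    then have "r0 \<le> norm (c x - c 0)" using r0(2)[of x] that by linarith
    then show ?thesis using r0(1) by (simp add: \<beta>_def)
  qed (simp add: \<beta>_def)
  have \<beta>_range: "0 \<le> \<beta> x" "\<beta> x \<le> 1" for x using r0(1) by (auto simp: \<beta>_def)
  have \<beta>_lip: "\<bar>\<beta> x - \<beta> y\<bar> \<le> norm (c x - c y) / r0" if "gnorm x < \<sigma>" "gnorm y < \<sigma>" for x y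
  proof -
    have "\<bar>\<beta> x - \<beta> y\<bar> \<le> \<bar>norm (c x - c 0) / r0 - norm (c y - c 0) / r0\<bar>"
      using that by (auto simp: \<beta>_def min_def)
    also have "\<dots> = \<bar>norm (c x - c 0) - norm (c y - c 0)\<bar> / r0"
      using r0(1) by (simp flip: diff_divide_distrib)
    also have "\<dots> \<le> norm (c x - c y) / r0"
      using r0(1) norm_triangle_ineq3[of "c x - c 0" "c y - c 0"] by (intro divide_right_mono) auto
    finally show ?thesis .
  qed
  define K where "K = 1 / \<tau> + M / r0"
  have K: "K \<ge> 0" using \<tau> M r0(1) by (simp add: K_def)
  have "\<bar>\<beta> (pW p) - \<beta> (pW q)\<bar> \<le> K * dist p q" if hp: "norm (hp p) \<le> R * \<sigma>" for p q
  proof -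
    define g where "g = - p + q"
    have dist: "dist p q = gnorm g" by (simp add: g_def dist_eq_gnorm)
    show ?thesis
    proof (cases "gnorm g < \<tau>")
      case False
      have "\<bar>\<beta> (pW p) - \<beta> (pW q)\<bar> \<le> 1"
        using \<beta>_range[of "pW p"] \<beta>_range[of "pW q"] by linarith
      also have "\<dots> \<le> gnorm g / \<tau>" using False \<tau> by simp
      also have "\<dots> \<le> K * gnorm g" using M r0(1) by (simp add: K_def distrib_right)
      finally show ?thesis by (simp add: dist)
    next
      case True
      define u where "u = pV p"
      define z where "z = u + ((g - pV g) - u)"
      have u: "gnorm u \<le> Kv * (R * \<sigma>)"
        unfolding u_def using Kv(1) by (intro order_trans[OF Kv(2) mult_left_mono[OF hp]]) simp
      have "\<tau> \<le> \<rho> / (2 * (1 + C))" by (simp add: \<tau>_def)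
      then have "\<tau> * (1 + C) \<le> \<rho> / 2" using C(1) by (simp add: field_simps)
      moreover have "gnorm g * (1 + C) \<le> \<tau> * (1 + C)" using True C(1) by (intro mult_right_mono) auto
      ultimately have g: "gnorm g + gnorm (pV g) \<le> \<rho> / 2"
        using C(2)[of g] by (simp add: algebra_simps)
      have sum: "gnorm w + 2 * gnorm u + gnorm g + gnorm (pV g) \<le> \<rho>" if "gnorm w \<le> \<sigma>" for w :: 'g
        using that u g \<sigma>_sum by linarith
      have Wq: "pW q = pW p + z"
      proof -
        have q: "q = p + g" by (simp add: g_def flip: add.assoc)
        have "pW q = p + g - (u + pV g)" unfolding pW_eq[of q] unfolding q pV_add u_def ..
        also have "\<dots> = (p - u) + z"
          unfolding z_def by (simp only: diff_conv_add_uminus minus_add add.assoc)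
             (simp flip: add.assoc)
        finally show ?thesis using pW_eq[of p] by (simp only: u_def)
      qed
      have z_le: "gnorm z < \<sigma> / 4"
      proof (rule r1(2))
        have "gnorm z \<le> gnorm u + (gnorm g + gnorm (pV g) + gnorm u)"
          unfolding z_def using gnorm_triangle[of u "g - pV g - u"] gnorm_diff[of "g - pV g" u] gnorm_diff[of g "pV g"]
          by linarith
        then show "z \<in> U" using sum[of 0] \<sigma> by (intro \<rho>U) simp
        have "norm (c z - c 0) \<le> M * gnorm g"
          using est[OF sum[of 0]] \<sigma> by (simp add: z_def)
        also have "\<dots> \<le> M * \<tau>" using True M by (intro mult_left_mono) auto
        also have "\<dots> \<le> M * (r1 / (M + 1))" using M by (intro mult_left_mono) (auto simp: \<tau>_def)
        also have "\<dots> < r1" using M r1(1) by (simp add: field_simps)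
        finally show "norm (c z - c 0) < r1" .
      qed
      show ?thesis
      \<comment> \<open>From 3 \<sigma> / 4 upwards a step of less than \<sigma> / 4 ends where
        \<beta> is still 1; from below it ends where \<beta> is given by the chart.\<close>
      proof (cases "3 * \<sigma> / 4 \<le> gnorm (pW p)")
        case True
        have "gnorm (pW p) \<le> gnorm (pW q) + gnorm z"
          using gnorm_diff[of "pW q" z] by (simp add: Wq)
        then have "\<sigma> / 2 \<le> gnorm (pW q)" using True z_le by simp
        moreover have "\<sigma> / 2 \<le> gnorm (pW p)" using True \<sigma> by simp
        ultimately show ?thesis using \<beta>1 K by simp
      next
        case False
        have "gnorm (pW q) \<le> gnorm (pW p) + gnorm z" unfolding Wq by (rule gnorm_triangle)
        then have lt: "gnorm (pW p) < \<sigma>" "gnorm (pW q) < \<sigma>" using False z_le \<sigma> by auto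
        have "\<bar>\<beta> (pW p) - \<beta> (pW q)\<bar> \<le> norm (c (pW q) - c (pW p)) / r0"
          using \<beta>_lip[OF lt] by (simp add: norm_minus_commute)
        also have "\<dots> \<le> M * gnorm g / r0"
          using est[OF sum, of "pW p"] lt r0(1) by (intro divide_right_mono) (auto simp: Wq z_def)
        also have "\<dots> \<le> K * gnorm g" using \<tau> by (simp add: K_def distrib_right)
        finally show ?thesis by (simp add: dist)
      qed
    qed
  qed
  then show ?thesis
    using that[of \<sigma> K \<beta>] \<sigma> K \<beta>_range \<beta>1 r0(1) by (simp add: \<beta>_def)
qed

text \<open>
  The supremum over all rescalings makes the cut-off profile
  \<open>max 0 (A * \<sigma> * \<beta> (pW p) - \<epsilon> * norm (hp p))\<close> homogeneous.
\<close>

lemma gauge: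
  assumes \<epsilon>: "\<epsilon> > 0" and C: "C > 0"
  shows "\<exists>h K. 0 \<le> K \<and> h 0 = 0 \<and> (\<forall>p q. \<bar>h p - h q\<bar> \<le> K * dist p q) \<and>
    (\<forall>p v. v \<in> V \<longrightarrow> \<bar>h (p + v) - h p\<bar> \<le> \<epsilon> * norm (ec v)) \<and>
    (\<forall>p. norm (hp p) \<le> C * gnorm (pW p) \<longrightarrow> norm (hp p) \<le> h p)"
proof -
  \<comment> \<open>At a point with |p_V| \<le> C \<sigma> and W-component of norm \<sigma> the
    profile is at least A \<sigma> - \<epsilon> C \<sigma>; this A makes the bound equal to C
    \<sigma>.\<close>
  define A where "A = C * (1 + \<epsilon>)"
  have A: "A > 0" using \<epsilon> C by (simp add: A_def)
  have "A / \<epsilon> > 0" using A \<epsilon> by simp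
  then obtain \<sigma> \<beta> K\<beta> where \<sigma>: "\<sigma> > 0" and K\<beta>: "K\<beta> \<ge> 0" and \<beta>0: "\<beta> 0 = (0::real)"
    and \<beta>_range: "\<And>x. 0 \<le> \<beta> x" "\<And>x. \<beta> x \<le> 1" and \<beta>1: "\<And>x. gnorm x = \<sigma> \<Longrightarrow> \<beta> x = 1"
    and \<beta>_lip: "\<And>p q. norm (hp p) \<le> A / \<epsilon> * \<sigma> \<Longrightarrow> \<bar>\<beta> (pW p) - \<beta> (pW q)\<bar> \<le> K\<beta> * dist p q"
    by (rule cutoff) blast
  obtain Ch where Ch: "Ch > 0" "\<And>x. norm (hp x) \<le> Ch * gnorm x" by (rule norm_hp_le) blast
  have hp_lip: "\<bar>norm (hp p) - norm (hp q)\<bar> \<le> Ch * dist p q" for p q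
  proof -
    have "\<bar>norm (hp p) - norm (hp q)\<bar> \<le> norm (hp q - hp p)"
      using norm_triangle_ineq3[of "hp q" "hp p"] by linarith
    also have "\<dots> = norm (hp (- p + q))" by (simp add: hp_add hp_minus)
    also have "\<dots> \<le> Ch * dist p q" using Ch(2) by (simp add: dist_eq_gnorm)
    finally show ?thesis .
  qed
  define h0 where "h0 p = max 0 (A * \<sigma> * \<beta> (pW p) - \<epsilon> * norm (hp p))" for p
  define K where "K = A * \<sigma> * K\<beta> + \<epsilon> * Ch"
  have K: "K \<ge> 0" using A \<sigma> K\<beta> \<epsilon> Ch(1) by (simp add: K_def)
  have h0_lip: "\<bar>h0 p - h0 q\<bar> \<le> K * dist p q" for p q
  proof -
    have main: "\<bar>h0 p - h0 q\<bar> \<le> K * dist p q" if "norm (hp p) \<le> A / \<epsilon> * \<sigma>" for p q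
    proof -
      have "\<bar>h0 p - h0 q\<bar> \<le> \<bar>A * \<sigma> * (\<beta> (pW p) - \<beta> (pW q)) - \<epsilon> * (norm (hp p) - norm (hp q))\<bar>"
        by (simp add: h0_def max_def algebra_simps)
      also have "\<dots> \<le> \<bar>A * \<sigma> * (\<beta> (pW p) - \<beta> (pW q))\<bar> + \<bar>\<epsilon> * (norm (hp p) - norm (hp q))\<bar>"
        by (rule abs_triangle_ineq4)
      also have "\<dots> = A * \<sigma> * \<bar>\<beta> (pW p) - \<beta> (pW q)\<bar> + \<epsilon> * \<bar>norm (hp p) - norm (hp q)\<bar>"
        using A \<sigma> \<epsilon> by (simp add: abs_mult)
      also have "\<dots> \<le> A * \<sigma> * (K\<beta> * dist p q) + \<epsilon> * (Ch * dist p q)"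
        using A \<sigma> \<epsilon> \<beta>_lip[OF that] hp_lip by (intro add_mono mult_left_mono) auto
      finally show ?thesis by (simp add: K_def algebra_simps)
    qed
    \<comment> \<open>The estimate for \<beta> asks only one of the two points to have a V-component
      below the threshold. Above it \<epsilon> |p_V| exceeds A \<sigma> and the profile is
      0.\<close>
    consider "norm (hp p) \<le> A / \<epsilon> * \<sigma>" | "norm (hp q) \<le> A / \<epsilon> * \<sigma>"
      | "norm (hp p) > A / \<epsilon> * \<sigma>" "norm (hp q) > A / \<epsilon> * \<sigma>" by linarith
    then show ?thesis
    proof cases
      case 2
      then show ?thesis using main[of q p] by (simp add: dist_commute abs_minus_commute)
    next
      case 3
      have "h0 x = 0" if "norm (hp x) > A / \<epsilon> * \<sigma>" for x
      proof -
        have "A * \<sigma> * \<beta> (pW x) \<le> A * \<sigma>" using A \<sigma> \<beta>_range(2)[of "pW x"] by simp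
        also have "\<dots> \<le> \<epsilon> * norm (hp x)" using that \<epsilon> by (simp add: field_simps)
        finally show ?thesis by (simp add: h0_def)
      qed
      then show ?thesis using 3 K by simp
    qed (rule main)
  qed
  have h0_0: "h0 0 = 0" by (simp add: h0_def \<beta>0)
  have h0_nonneg: "0 \<le> h0 p" for p by (simp add: h0_def)
  have h0_V: "\<bar>h0 (p + v) - h0 p\<bar> \<le> \<epsilon> * norm (ec v)" if v: "v \<in> V" for p v
  proof -
    have "\<bar>h0 (p + v) - h0 p\<bar> \<le> \<bar>\<epsilon> * (norm (hp p + ec v) - norm (hp p))\<bar>"
      unfolding h0_def pW_add_V[OF v] hp_add hp_V[OF v] right_diff_distrib by linarith
    also have "\<dots> = \<epsilon> * \<bar>norm (hp p + ec v) - norm (hp p)\<bar>" using \<epsilon> by (simp add: abs_mult)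
    also have "\<dots> \<le> \<epsilon> * norm (ec v)"
      using \<epsilon> norm_triangle_ineq3[of "hp p + ec v" "hp p"] by (intro mult_left_mono) auto
    finally show ?thesis .
  qed
  \<comment> \<open>Rescaling keeps the constants of \<open>h0\<close> for the distance and along
    the fibres, so the supremum inherits both; it is finite because
    \<open>H 0 r = 0\<close>.\<close>
  define H where "H p r = r * h0 (\<delta> (1 / r) p)" for p r
  have H_lip: "\<bar>H p r - H q r\<bar> \<le> K * dist p q" if "r > 0" for p q r
  proof -
    have "dist (\<delta> (1 / r) p) (\<delta> (1 / r) q) = 1 / r * dist p q"
      using distance that by (simp add: homogeneous_distance_def)
    then have "\<bar>h0 (\<delta> (1 / r) p) - h0 (\<delta> (1 / r) q)\<bar> \<le> K * dist p q / r"
      using h0_lip[of "\<delta> (1 / r) p" "\<delta> (1 / r) q"] by simp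
    then have "r * \<bar>h0 (\<delta> (1 / r) p) - h0 (\<delta> (1 / r) q)\<bar> \<le> K * dist p q"
      using that by (simp add: field_simps)
    then show ?thesis using that by (simp add: H_def abs_mult flip: right_diff_distrib)
  qed
  have H_0: "H 0 r = 0" if "r > 0" for r using that by (simp add: H_def h0_0)
  have bdd: "bdd_above (H p ` {0<..})" for p
  proof (rule bdd_aboveI2)
    fix r :: real assume "r \<in> {0<..}"
    then show "H p r \<le> K * dist p 0" using H_lip[of r p 0] H_0[of r] by simp
  qed
  define h where "h p = (SUP r\<in>{0<..}. H p r)" for p
  have ne: "{0::real<..} \<noteq> {}" by simp
  have "h 0 = (SUP r\<in>{0::real<..}. 0)" unfolding h_def by (rule SUP_cong) (auto simp: H_0)
  then have h0': "h 0 = 0" by simp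
  have h_lip: "\<bar>h p - h q\<bar> \<le> K * dist p q" for p q
    unfolding h_def by (rule cSUP_diff_le[OF ne bdd bdd]) (simp add: H_lip)
  have h_V: "\<bar>h (p + v) - h p\<bar> \<le> \<epsilon> * norm (ec v)" if v: "v \<in> V" for p v
    unfolding h_def
  proof (rule cSUP_diff_le[OF ne bdd bdd])
    fix r :: real assume "r \<in> {0<..}"
    then have r: "r > 0" "1 / r > 0" by auto
    have "\<bar>h0 (\<delta> (1 / r) p + \<delta> (1 / r) v) - h0 (\<delta> (1 / r) p)\<bar> \<le> \<epsilon> * norm (ec (\<delta> (1 / r) v))"
      by (rule h0_V[OF V_dil[OF r(2) v]])
    also have "\<dots> = \<epsilon> * norm (ec v) / r" using r(1) by (simp add: ec_dil[OF r(2) v])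
    finally have "r * \<bar>h0 (\<delta> (1 / r) (p + v)) - h0 (\<delta> (1 / r) p)\<bar> \<le> \<epsilon> * norm (ec v)"
      using r by (simp add: dil_add field_simps)
    then show "\<bar>H (p + v) r - H p r\<bar> \<le> \<epsilon> * norm (ec v)"
      using r by (simp add: H_def abs_mult flip: right_diff_distrib)
  qed
  have H_le: "H p r \<le> h p" if "r > 0" for p r
    unfolding h_def using that by (intro cSUP_upper bdd) auto
  have "norm (hp p) \<le> h p" if p: "norm (hp p) \<le> C * gnorm (pW p)" for p
  proof (cases "pW p = 0")
    case True
    have "0 \<le> H p 1" using h0_nonneg by (simp add: H_def)
    then have "0 \<le> h p" using H_le[of 1 p] by simp
    then show ?thesis using p True by simp
  next
    case False
    have gp: "gnorm (pW p) > 0"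
      using False gnorm_eq_0[of "pW p"] gnorm_nonneg[of "pW p"] by linarith
    \<comment> \<open>The dilation that brings the W-component to norm \<sigma>, where \<beta> is
      1.\<close>
    define r where "r = gnorm (pW p) / \<sigma>"
    have r: "r > 0" "1 / r > 0" using gp \<sigma> by (auto simp: r_def)
    let ?p = "\<delta> (1 / r) p"
    have gW: "gnorm (pW ?p) = \<sigma>"
      using gp \<sigma> by (simp add: proj_dil[OF r(2)] gnorm_dil[OF r(2)]) (simp add: r_def)
    have "norm (hp ?p) = norm (hp p) / r" using r by (simp add: hp_dil[OF r(2)])
    also have "\<dots> \<le> C * gnorm (pW p) / r" using p r by (intro divide_right_mono) auto
    also have "\<dots> = C * \<sigma>" using gp \<sigma> by (simp add: r_def)
    finally have "\<epsilon> * norm (hp ?p) \<le> \<epsilon> * (C * \<sigma>)" using \<epsilon> by (intro mult_left_mono) auto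
    then have "C * \<sigma> \<le> h0 ?p"
      by (simp add: h0_def \<beta>1[OF gW] A_def algebra_simps)
    then have "r * (C * \<sigma>) \<le> H p r" using r by (simp add: H_def)
    moreover have "r * (C * \<sigma>) = C * gnorm (pW p)" using \<sigma> by (simp add: r_def)
    ultimately show ?thesis using p H_le[OF r(1), of p] by linarith
  qed
  then show ?thesis
    by (intro exI[of _ h] exI[of _ K] conjI allI impI K h0' h_lip h_V)
qed

section \<open>The passage between cone conditions, coercive maps and graphs\<close>

lemma coercive_map_if_cone:
  assumes S: "S \<noteq> {}" and C: "C > 0"
    and cone: "\<And>x y. x \<in> S \<Longrightarrow> y \<in> S \<Longrightarrow> norm (hp (- x + y)) \<le> C * gnorm (pW (- x + y))"
  shows "\<exists>a>0. \<exists>f :: 'g \<Rightarrow> real ^ 'k. (\<exists>K. K-lipschitz_on UNIV f) \<and> S \<subseteq> {x. f x = 0} \<and>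
      (\<forall>v\<in>V. \<forall>x. (f (x + v) - f x) \<bullet> ec v \<ge> a * (norm (ec v))\<^sup>2)"
proof -
  define \<epsilon> where "\<epsilon> = 1 / (2 * real CARD('k))"
  have \<epsilon>: "\<epsilon> > 0" by (simp add: \<epsilon>_def)
  from gauge[OF \<epsilon> C] obtain h K where K: "0 \<le> K" and h_0: "h 0 = 0"
    and H: "\<forall>p q. \<bar>h p - h q\<bar> \<le> K * dist p q"
      "\<forall>p v. v \<in> V \<longrightarrow> \<bar>h (p + v) - h p\<bar> \<le> \<epsilon> * norm (ec v)"
      "\<forall>p. norm (hp p) \<le> C * gnorm (pW p) \<longrightarrow> norm (hp p) \<le> h p"
    by (elim exE conjE)
  note h_lip = H(1)[rule_format] and h_V = H(2)[rule_format] and h_ge = H(3)[rule_format]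
  define G where "G i x y = hp y $ i + h (- y + x)" for i x y
  have G_lip: "\<bar>G i x y - G i x' y\<bar> \<le> K * dist x x'" for i x x' y
    using h_lip[of "- y + x" "- y + x'"] by (simp add: G_def dist_add_left)
  \<comment> \<open>For a point y0 of S no competitor in the infimum is below
    \<open>hp y0 $ i\<close>, and y = y0 attains it since h 0 = 0. So the extension is exact on S;
    together with \<open>G_lip\<close> the bound also makes the infimum finite elsewhere.\<close>
  have G_ge: "hp y0 $ i \<le> G i y0 y" if "y0 \<in> S" "y \<in> S" for i y0 y
  proof -
    have "hp y0 $ i - hp y $ i = hp (- y + y0) $ i" by (simp add: hp_add hp_minus)
    also have "\<dots> \<le> norm (hp (- y + y0))"
      using component_le_norm_cart[of "hp (- y + y0)" i] by linarith
    also have "\<dots> \<le> h (- y + y0)" using cone that by (intro h_ge) auto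
    finally show ?thesis by (simp add: G_def)
  qed
  obtain s0 where s0: "s0 \<in> S" using S by blast
  have bdd: "bdd_below (G i x ` S)" for i x
  proof (rule bdd_belowI2)
    fix y assume "y \<in> S"
    then show "hp s0 $ i - K * dist x s0 \<le> G i x y"
      using G_ge[OF s0, of y i] G_lip[of i x y s0] by linarith
  qed
  define \<Phi> where "\<Phi> i x = (INF y\<in>S. G i x y)" for i x
  have \<Phi>_lip: "\<bar>\<Phi> i x - \<Phi> i x'\<bar> \<le> K * dist x x'" for i x x'
    unfolding \<Phi>_def by (rule cINF_diff_le[OF S bdd bdd]) (rule G_lip)
  have \<Phi>_V: "\<bar>\<Phi> i (x + v) - \<Phi> i x\<bar> \<le> \<epsilon> * norm (ec v)" if "v \<in> V" for i x v
    unfolding \<Phi>_def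
  proof (rule cINF_diff_le[OF S bdd bdd])
    fix y
    show "\<bar>G i (x + v) y - G i x y\<bar> \<le> \<epsilon> * norm (ec v)"
      using h_V[OF that, of "- y + x"] by (simp add: G_def add.assoc)
  qed
  have \<Phi>_S: "\<Phi> i y = hp y $ i" if "y \<in> S" for i y
  proof (rule antisym)
    have "\<Phi> i y \<le> G i y y" unfolding \<Phi>_def by (rule cINF_lower[OF bdd that])
    then show "\<Phi> i y \<le> hp y $ i" by (simp add: G_def h_0)
    show "hp y $ i \<le> \<Phi> i y" unfolding \<Phi>_def using G_ge[OF that] by (intro cINF_greatest[OF S])
  qed
  define F :: "'g \<Rightarrow> real ^ 'k" where "F x = (\<chi> i. \<Phi> i x)" for x
  define f where "f x = hp x - F x" for x
  have F_norm: "norm (F x - F y) \<le> real CARD('k) * e" if "\<And>i. \<bar>\<Phi> i x - \<Phi> i y\<bar> \<le> e" for x y e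
  proof -
    have "norm (F x - F y) \<le> (\<Sum>i\<in>UNIV. \<bar>(F x - F y) $ i\<bar>)" by (rule norm_le_l1_cart)
    also have "\<dots> \<le> (\<Sum>i\<in>(UNIV :: 'k set). e)" using that by (intro sum_mono) (simp add: F_def)
    finally show ?thesis by simp
  qed
  obtain Ch where Ch: "Ch > 0" "\<And>x. norm (hp x) \<le> Ch * gnorm x" by (rule norm_hp_le) blast
  have lip: "(Ch + real CARD('k) * K)-lipschitz_on UNIV f"
  proof (rule lipschitz_onI)
    fix x y
    have "norm (hp x - hp y) = norm (hp (- y + x))" by (simp add: hp_add hp_minus)
    also have "\<dots> \<le> Ch * dist x y" using Ch(2)[of "- y + x"] by (simp add: dist_eq_gnorm[of y x] dist_commute[of x y])
    finally have "norm (hp x - hp y) \<le> Ch * dist x y" .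
    moreover have "norm (F x - F y) \<le> real CARD('k) * (K * dist x y)"
      by (rule F_norm) (rule \<Phi>_lip)
    moreover have "norm (f x - f y) \<le> norm (hp x - hp y) + norm (F x - F y)"
      using norm_triangle_ineq4[of "hp x - hp y" "F x - F y"] by (simp add: f_def algebra_simps)
    ultimately show "dist (f x) (f y) \<le> (Ch + real CARD('k) * K) * dist x y"
      by (simp add: dist_norm algebra_simps)
  qed (use Ch(1) K in simp)
  have zero: "S \<subseteq> {x. f x = 0}" using \<Phi>_S by (auto simp: f_def F_def vec_eq_iff)
  have coercive: "(f (x + v) - f x) \<bullet> ec v \<ge> 1 / 2 * (norm (ec v))\<^sup>2" if v: "v \<in> V" for x v
  proof -
    let ?d = "F (x + v) - F x"
    have "norm ?d \<le> real CARD('k) * (\<epsilon> * norm (ec v))" by (rule F_norm) (rule \<Phi>_V[OF v])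
    also have "\<dots> = 1 / 2 * norm (ec v)" by (simp add: \<epsilon>_def)
    finally have "norm ?d * norm (ec v) \<le> 1 / 2 * norm (ec v) * norm (ec v)" by (intro mult_right_mono) auto
    then have "?d \<bullet> ec v \<le> 1 / 2 * (norm (ec v))\<^sup>2"
      using norm_cauchy_schwarz[of ?d "ec v"] by (simp add: power2_eq_square)
    moreover have "(f (x + v) - f x) \<bullet> ec v = (norm (ec v))\<^sup>2 - ?d \<bullet> ec v"
      by (simp add: f_def hp_add hp_V[OF v] inner_diff_left inner_add_left power2_norm_eq_inner)
    ultimately show ?thesis by simp
  qed
  show ?thesis
    by (rule exI[of _ "1 / 2"], rule conjI, simp, rule exI[of _ f]) (use lip zero coercive in blast)
qed

lemma cone_if_coercive_map:
  fixes f :: "'g \<Rightarrow> real ^ 'k"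
  assumes a: "a > 0" and lip: "K-lipschitz_on UNIV f"
    and coercive: "\<forall>v\<in>V. \<forall>x. (f (x + v) - f x) \<bullet> ec v \<ge> a * (norm (ec v))\<^sup>2"
    and xy: "f x = 0" "f y = 0"
  shows "a * norm (hp (- x + y)) \<le> K * gnorm (pW (- x + y))"
proof (cases "hp (- x + y) = 0")
  case True
  then show ?thesis using lipschitz_on_nonneg[OF lip] by simp
next
  case False
  let ?p = "- x + y"
  let ?q = "x + pW ?p"
  have y: "y = ?q + pV ?p"
  proof -
    have "?q + pV ?p = x + (pW ?p + pV ?p)" by (rule add.assoc)
    also have "\<dots> = x + ?p" by (rule arg_cong[OF proj(3)[symmetric]])
    finally show ?thesis by simp
  qed
  have "a * (norm (hp ?p))\<^sup>2 \<le> (f (?q + pV ?p) - f ?q) \<bullet> hp ?p"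
    using coercive proj(2)[of ?p] unfolding hp_def by blast
  also have "\<dots> = (f x - f ?q) \<bullet> hp ?p" using xy y by simp
  also have "\<dots> \<le> norm (f x - f ?q) * norm (hp ?p)" by (rule norm_cauchy_schwarz)
  also have "\<dots> \<le> (K * dist x ?q) * norm (hp ?p)"
    using lipschitz_onD[OF lip, of x ?q] by (intro mult_right_mono) (auto simp: dist_norm)
  also have "dist x ?q = gnorm (pW ?p)" using dist_add_left[of x 0 "pW ?p"] by (simp add: gnorm_def)
  finally have "norm (hp ?p) * (a * norm (hp ?p)) \<le> norm (hp ?p) * (K * gnorm (pW ?p))"
    by (simp add: power2_eq_square algebra_simps)
  then show ?thesis using False by simp
qed

lemma hp_eq_0: "hp x = 0 \<Longrightarrow> pV x = 0"
  using EJ_ec[OF proj(2)[of x]] by (simp add: hp_def)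

lemma zero_if_pW_hp_0: "pW x = 0 \<Longrightarrow> hp x = 0 \<Longrightarrow> x = 0"
proof -
  assume "pW x = 0" "hp x = 0"
  then have "pW x + pV x = 0" using hp_eq_0 by simp
  then show "x = 0" using proj(3)[of x] by (rule trans[rotated])
qed

lemma intrinsic_graph_if_coercive_map:
  fixes f :: "'g \<Rightarrow> real ^ 'k"
  assumes a: "a > 0" and lip: "K-lipschitz_on UNIV f" and S: "S \<subseteq> {x. f x = 0}"
    and coercive: "\<forall>v\<in>V. \<forall>x. (f (x + v) - f x) \<bullet> ec v \<ge> a * (norm (ec v))\<^sup>2"
  shows "\<exists>A \<phi>. A \<subseteq> W \<and> \<phi> ` A \<subseteq> V \<and> intrinsic_lipschitz W V A \<phi> \<and> S = intrinsic_graph A \<phi>"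
proof -
  have K: "K \<ge> 0" using lip by (rule lipschitz_on_nonneg)
  have cone: "a * norm (hp (- x + y)) \<le> K * gnorm (pW (- x + y))" if "x \<in> S" "y \<in> S" for x y
    using cone_if_coercive_map[OF a lip coercive, of x y] S that by blast
  have eq: "x = y" if "x \<in> S" "y \<in> S" "pW (- x + y) = 0" for x y
  proof -
    have "hp (- x + y) = 0" using cone[OF that(1,2)] that(3) a by (simp add: mult_le_0_iff)
    then have "- x + y = 0" using zero_if_pW_hp_0 that(3) by blast
    then show ?thesis by (metis add.right_neutral add_minus_cancel)
  qed
  \<comment> \<open>Equal W-components put \<open>- x + y\<close> into V; its W-component is then 0
    and \<open>eq\<close> applies.\<close>
  have inj: "x = y" if "x \<in> S" "y \<in> S" "pW x = pW y" for x y
  proof -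
    have "- x + y = - (pW x + pV x) + (pW y + pV y)" using proj(3)[of x] proj(3)[of y] by metis
    also have "\<dots> = - pV x + pV y" unfolding that(3) by (simp only: minus_add add.assoc minus_add_cancel)
    finally have "- x + y = 0 + (- pV x + pV y)" by simp
    moreover have "- pV x + pV y \<in> V" by (intro V_add V_minus proj(2))
    ultimately have "pW (- x + y) = 0" using proj_eq(1)[OF W_0] by metis
    then show ?thesis using eq that by blast
  qed
  define \<phi> where "\<phi> w = pV (THE x. x \<in> S \<and> pW x = w)" for w
  have \<phi>: "\<phi> (pW x) = pV x" if "x \<in> S" for x
  proof -
    have "(THE y. y \<in> S \<and> pW y = pW x) = x" using that inj by (intro the_equality) auto
    then show ?thesis by (simp add: \<phi>_def)
  qed
  have graph: "intrinsic_graph (pW ` S) \<phi> = S"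
  proof -
    have "intrinsic_graph (pW ` S) \<phi> = (\<lambda>x. pW x + pV x) ` S"
    proof -
      have "intrinsic_graph (pW ` S) \<phi> = (\<lambda>w. w + \<phi> w) ` pW ` S"
        by (auto simp: intrinsic_graph_def)
      also have "\<dots> = (\<lambda>x. pW x + pV x) ` S"
        unfolding image_image by (rule image_cong) (simp_all add: \<phi>)
      finally show ?thesis .
    qed
    also have "\<dots> = S" using proj(3) by (metis (no_types, lifting) image_cong image_ident)
    finally show ?thesis .
  qed
  obtain Kv where Kv: "Kv > 0" "\<And>x. gnorm (pV x) \<le> Kv * norm (hp x)"
    by (rule gnorm_pV_le_hp) blast
  \<comment> \<open>In a cone of this opening 2 (K + 1) \<open>gnorm (pW p)\<close> \<le> a |hp p|
    \<le> K \<open>gnorm (pW p)\<close>, which forces pW p = 0. The + 1 covers K = 0.\<close>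
  define \<alpha> where "\<alpha> = a / (2 * (K + 1) * Kv)"
  have \<alpha>: "\<alpha> > 0" using a K Kv by (simp add: \<alpha>_def)
  have "S \<inter> (\<lambda>y. x + y) ` intrinsic_cone W V \<alpha> = {x}" if x: "x \<in> S" for x
  proof (intro equalityI subsetI)
    fix y assume "y \<in> S \<inter> (\<lambda>y. x + y) ` intrinsic_cone W V \<alpha>"
    then obtain p where p: "y = x + p" "y \<in> S" "gnorm (pW p) \<le> \<alpha> * gnorm (pV p)"
      by (auto simp: intrinsic_cone_def)
    have xy: "- x + y = p" using p(1) by (simp flip: add.assoc)
    have "2 * (K + 1) * gnorm (pW p) \<le> 2 * (K + 1) * (\<alpha> * (Kv * norm (hp p)))"
      using \<alpha> K by (intro mult_left_mono order_trans[OF p(3)] Kv(2)) auto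
    also have "\<dots> = a * norm (hp p)" using K Kv(1) by (simp add: \<alpha>_def)
    also have "\<dots> \<le> K * gnorm (pW p)" using cone[OF x p(2)] by (simp add: xy)
    finally have "(K + 2) * gnorm (pW p) \<le> 0" by (simp add: algebra_simps)
    then have "gnorm (pW p) = 0" using K gnorm_nonneg[of "pW p"] by (simp add: mult_le_0_iff)
    then have "pW (- x + y) = 0" by (simp add: xy gnorm_eq_0)
    then show "y \<in> {x}" using eq[OF x p(2)] by simp
  next
    fix y assume "y \<in> {x}"
    moreover have "x \<in> (\<lambda>y. x + y) ` intrinsic_cone W V \<alpha>"
      by (rule image_eqI[of _ _ 0]) (simp_all add: intrinsic_cone_def)
    ultimately show "y \<in> S \<inter> (\<lambda>y. x + y) ` intrinsic_cone W V \<alpha>" using x by simp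
  qed
  then have "intrinsic_lipschitz W V (pW ` S) \<phi>"
    unfolding intrinsic_lipschitz_def graph using \<alpha> by blast
  moreover have "pW ` S \<subseteq> W" "\<phi> ` pW ` S \<subseteq> V" using proj(1,2) \<phi> by auto
  ultimately show ?thesis
    by (intro exI[of _ "pW ` S"] exI[of _ \<phi>] conjI graph[symmetric])
qed

text \<open>Distinct points of the graph never differ by an element of the cone, and off the cone
  its defining inequality is reversed. The factor k passes from the homogeneous to the Euclidean
  norm on V, whence the constant 1 / (k \<alpha>).\<close>

lemma coercive_map_if_intrinsic_graph:
  assumes S: "S \<noteq> {}" and graph: "S = intrinsic_graph A \<phi>" and lip: "intrinsic_lipschitz W V A \<phi>"
  shows "\<exists>a>0. \<exists>f :: 'g \<Rightarrow> real ^ 'k. (\<exists>K. K-lipschitz_on UNIV f) \<and> S \<subseteq> {x. f x = 0} \<and>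
      (\<forall>v\<in>V. \<forall>x. (f (x + v) - f x) \<bullet> ec v \<ge> a * (norm (ec v))\<^sup>2)"
proof -
  obtain \<alpha> where \<alpha>: "\<alpha> > 0" "\<And>x. x \<in> S \<Longrightarrow> S \<inter> (\<lambda>y. x + y) ` intrinsic_cone W V \<alpha> = {x}"
    using lip unfolding intrinsic_lipschitz_def graph by blast
  obtain k where k: "k > 0" "\<And>v. v \<in> V \<Longrightarrow> k * norm (ec v) \<le> gnorm v"
    by (rule norm_ec_bounds) blast
  show ?thesis
  proof (rule coercive_map_if_cone[OF S])
    show "1 / (k * \<alpha>) > 0" using k(1) \<alpha>(1) by simp
    fix x y assume xy: "x \<in> S" "y \<in> S"
    let ?p = "- x + y"
    show "norm (hp ?p) \<le> 1 / (k * \<alpha>) * gnorm (pW ?p)"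
    proof (cases "?p \<in> intrinsic_cone W V \<alpha>")
      case True
      have "y = x + ?p" by simp
      then have "y \<in> S \<inter> (\<lambda>y. x + y) ` intrinsic_cone W V \<alpha>" using True xy(2) by blast
      then have "y = x" using \<alpha>(2)[OF xy(1)] by simp
      then show ?thesis by simp
    next
      case False
      then have "\<alpha> * gnorm (pV ?p) \<le> gnorm (pW ?p)" by (simp add: intrinsic_cone_def)
      moreover have "\<alpha> * (k * norm (hp ?p)) \<le> \<alpha> * gnorm (pV ?p)"
        using k(2)[OF proj(2)[of ?p]] \<alpha>(1) by (simp add: hp_def)
      ultimately have "\<alpha> * (k * norm (hp ?p)) \<le> gnorm (pW ?p)" by linarith
      then show ?thesis using k(1) \<alpha>(1) by (simp add: field_simps)
    qed
  qed
qed

end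

theorem theorem1p4:
  fixes \<A> :: "('g::{metric_space, second_countable_topology, group_add}, 'e::euclidean_space) atlas"
    and s :: nat
    and L :: "nat \<Rightarrow> 'g field set"
    and \<delta> :: "real \<Rightarrow> 'g \<Rightarrow> 'g"
    and W V S :: "'g set"
    and X :: "'k::finite \<Rightarrow> 'g field"
  assumes "carnot_group \<A> s L"
    and "carnot_dilations \<A> s L \<delta>"
    and "homogeneous_distance \<delta>"
    and "homogeneous_subgroup \<A> \<delta> W"
    and "homogeneous_subgroup \<A> \<delta> V"
    and "complementary W V"
    and "horizontal \<A> L V"
    and "V \<noteq> {0}"
    and "field_basis X (subgroup_lie_algebra \<A> V)"
    and "S \<noteq> {}"
  shows "(\<exists>A \<phi>. A \<subseteq> W \<and> \<phi> ` A \<subseteq> V \<and> intrinsic_lipschitz W V A \<phi> \<and> S = intrinsic_graph A \<phi>) \<longleftrightarrow>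
    (\<exists>c>0. \<exists>f :: 'g \<Rightarrow> real ^ 'k. (\<exists>K. K-lipschitz_on UNIV f) \<and> S \<subseteq> {x. f x = 0} \<and>
      (\<forall>v\<in>V. \<forall>x. (f (x + v) - f x) \<bullet> exp_coords \<A> X v \<ge> c * (norm (exp_coords \<A> X v))\<^sup>2))"
proof -
  interpret lie_grp \<A>
    using assms(1) by unfold_locales (simp add: carnot_group_def)
  obtain U c where chart: "(U, c) \<in> \<A>" "0 \<in> U" using chart_cover by blast
  have strat: "1 \<le> s" "direct_sum_decomposition s L (lie_algebra \<A>)"
    using assms(1) by (simp_all add: carnot_group_def stratification_def)
  interpret horizontal_splitting \<A> U c s L \<delta> W V X
    by unfold_locales (fact chart strat assms)+
  show ?thesis (is "?graph \<longleftrightarrow> ?map")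
  proof
    assume ?graph
    then obtain A \<phi> where "intrinsic_lipschitz W V A \<phi>" "S = intrinsic_graph A \<phi>" by blast
    then show ?map by (intro coercive_map_if_intrinsic_graph[OF assms(10)])
  next
    assume ?map
    then obtain a f K where "a > 0" "K-lipschitz_on UNIV f" "S \<subseteq> {x. f x = 0}"
      "\<forall>v\<in>V. \<forall>x. (f (x + v) - f x) \<bullet> exp_coords \<A> X v \<ge> a * (norm (exp_coords \<A> X v))\<^sup>2"
      by blast
    then show ?graph by (rule intrinsic_graph_if_coercive_map)
  qed
qed

end
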